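(* Let $d\ge2$ be an integer. There exists $p_0\in(2,2^* )$ such that for every $p\in(2,p_0)$, with $\vartheta(p,d)=\frac{d(p-2)}{2p}$, $$\underline a(\vartheta(p,d),p)<a_\star^{\rm CKN}(p)\,,$$ and so there is symmetry breaking in a region where the radial extremals are linearly stable: for every $a\in\big(\underline a(\vartheta(p,d),p),\,a_\star^{\rm CKN}(p)\big)$, the radial extremals for $\theta=\vartheta(p,d)$ are linearly stable and $$\mathsf C_{\rm CKN}^*(\vartheta(p,d),p,a)<\mathsf C_{\rm CKN}(\vartheta(p,d),p,a)\,.$$
   Context: Notation: $2^*:=\frac{2d}{d-2}$ if $d\ge3$, $2^*:=\infty$ if $d=2$; $a_c:=\frac{d-2}{2}$; $\Lambda(a):=(a-a_c)^2$. Caffarelli-Kohn-Nirenberg inequality (CKN): for $a<a_c$, $p\in(2,2^* )$, $\theta\in[\vartheta(p,d),1]$, let $b$ be determined by $p=\frac{2d}{d-2+2(b-a)}$, i.e. $b=a-a_c+\frac dp$. Then $\mathsf C_{\rm CKN}(\theta,p,a)$ is the optimal (smallest, finite) constant such that for all smooth $u$ compactly supported in $\mathbb R^d\setminus\{0\}$, $$\||x|^{-b}u\|_{L^p(\mathbb R^d)}^2\le \mathsf C_{\rm CKN}(\theta,p,a)\,\||x|^{-a}\nabla u\|_{L^2(\mathbb R^d)}^{2\theta}\,\||x|^{-(a+1)}u\|_{L^2(\mathbb R^d)}^{2(1-\theta)}.$$ By completion, the inequality extends to the space $\mathcal D^{1,2}_a(\mathbb R^d)$ of functions $u\in L^1_{\rm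 loc}(\mathbb R^d)$ with $|x|^{-a}\nabla u\in L^2(\mathbb R^d)$ and $|x|^{-(a+1)}u\in L^2(\mathbb R^d)$. $\mathsf C^*_{\rm CKN}(\theta,p,a)$ is the optimal constant in the same inequality when restricted to radially symmetric functions $u$; one has $\mathsf C_{\rm CKN}\ge\mathsf C^*_{\rm CKN}$ and $\mathsf C^*_{\rm CKN}(\theta,p,a)=\mathsf C^*_{\rm CKN}(\theta,p,a_c-1)\,\Lambda(a)^{\frac{p-2}{2p}-\theta}$. Radial extremals are the functions realizing equality in the inequality restricted to radial functions. Symmetry breaking means $\mathsf C^*_{\rm CKN}(\theta,p,a)<\mathsf C_{\rm CKN}(\theta,p,a)$ (existence of extremals is not asserted). Definition of $a_\star^{\rm CKN}(p)$: let $\mathsf C_{\rm GN}(p)$ be the optimal constant in $\|u\|_{L^p(\mathbb R^d)}^2\le\mathsf C_{\rm GN}(p)\|\nabla u\|_{L^2(\mathbb R^d)}^{2\vartheta(p,d)}\|u\|_{L^2(\mathbb R^d)}^{2(1-\vartheta(p,d))}$ for all $u\in H^1(\mathbb R^d)$. Then $a_\star^{\rm CKN}(p)$ is the unique number $a<a_c$ such that $\mathsf C_{\rm GN}(p)=\mathsf C^*_{\rm CKN}(\vartheta(p,d),p,a)$. Definition of $\underline a$: $\displaystyle\underline a(\theta,p):=a_c-\frac{2\sqrt{d-1}}{p+2}\sqrt{\frac{2p\theta}{p-2}-1}$. Linear stability: under the change of variables $s=\log|x|$, $\omega=x/|x|$, $v(s,\omega)=|x|^{a_c-a}u(x)$,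 (CKN) becomes an inequality on the cylinder $\mathcal C=\mathbb R\times\mathbb S^{d-1}$, and one considers the functional $\mathcal E[v]=\big(\|\nabla v\|_{L^2(\mathcal C)}^2+\Lambda(a)\|v\|_{L^2(\mathcal C)}^2\big)^\theta\|v\|_{L^2(\mathcal C)}^{2(1-\theta)}$ on $\{v\in H^1(\mathcal C):\|v\|_{L^p(\mathcal C)}=1\}$ and the linear operator associated with its second variation around a minimizer among functions depending on $s$ only. This operator has a negative eigenvalue if $a<\underline a(\theta,p)$, and all its non-zero eigenvalues are positive if $a\in(\underline a(\theta,p),a_c)$; by definition, the radial extremals are called linearly stable when $a\in(\underline a(\theta,p),a_c)$. *)

theory Defs
  imports "HOL-Analysis.Analysis"
begin

text \<open>Parameters depending on the dimension \<open>d\<close>.\<close>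

definition two_star :: "nat \<Rightarrow> ereal" where
  "two_star d = (if d \<ge> 3 then ereal (2 * real d / (real d - 2)) else \<infinity>)"

definition a_crit :: "nat \<Rightarrow> real" where
  "a_crit d = (real d - 2) / 2"

definition vartheta :: "real \<Rightarrow> nat \<Rightarrow> real" where
  "vartheta p d = real d * (p - 2) / (2 * p)"

definition b_exp :: "nat \<Rightarrow> real \<Rightarrow> real \<Rightarrow> real" where
  "b_exp d p a = a - a_crit d + real d / p"

definition a_lower :: "nat \<Rightarrow> real \<Rightarrow> real \<Rightarrow> real" where
  "a_lower d \<theta> p =
     a_crit d - 2 * sqrt (real d - 1) / (p + 2) * sqrt (2 * p * \<theta> / (p - 2) - 1)"

text \<open>Smooth functions and gradients on \<open>\<real>\<^sup>d\<close>.\<close>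

definition partial :: "'n::finite \<Rightarrow> (real^'n \<Rightarrow> real) \<Rightarrow> real^'n \<Rightarrow> real" where
  "partial i u x = frechet_derivative u (at x) (axis i 1)"

definition grad :: "(real^'n::finite \<Rightarrow> real) \<Rightarrow> real^'n \<Rightarrow> real^'n" where
  "grad u x = (\<chi> i. partial i u x)"

primrec C_k :: "nat \<Rightarrow> (real^'n::finite \<Rightarrow> real) \<Rightarrow> bool" where
  "C_k 0 u \<longleftrightarrow> continuous_on UNIV u"
| "C_k (Suc k) u \<longleftrightarrow> (\<forall>x. u differentiable (at x)) \<and> (\<forall>i. C_k k (partial i u))"

definition smooth :: "(real^'n::finite \<Rightarrow> real) \<Rightarrow> bool" where
  "smooth u \<longleftrightarrow> (\<forall>k. C_k k u)"

definition supp :: "(real^'n::finite \<Rightarrow> real) \<Rightarrow> (real^'n) set" where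
  "supp u = closure {x. u x \<noteq> 0}"

definition test_functions :: "(real^'n::finite) set \<Rightarrow> (real^'n \<Rightarrow> real) set" where
  "test_functions \<Omega> = {u. smooth u \<and> compact (supp u) \<and> supp u \<subseteq> \<Omega>}"

definition radial :: "(real^'n::finite \<Rightarrow> real) \<Rightarrow> bool" where
  "radial u \<longleftrightarrow> (\<forall>x y. norm x = norm y \<longrightarrow> u x = u y)"

text \<open>Lebesgue spaces on \<open>\<real>\<^sup>d\<close> for exponents \<open>0 < p < \<infinity>\<close>. The value of \<open>Lp_norm\<close> is
  the norm only for functions satisfying \<open>in_Lp\<close>.\<close>

definition in_Lp :: "real \<Rightarrow> (real^'n::finite \<Rightarrow> 'b::euclidean_space) \<Rightarrow> bool" where
  "in_Lp p f \<longleftrightarrow> f \<in> borel_measurable lborel \<and> integrable lborel (\<lambda>x. norm (f x) powr p)"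

definition Lp_norm :: "real \<Rightarrow> (real^'n::finite \<Rightarrow> 'b::euclidean_space) \<Rightarrow> real" where
  "Lp_norm p f = (LINT x|lborel. norm (f x) powr p) powr (1 / p)"

text \<open>Optimal constants are infima in \<open>ennreal\<close>, so that no junk value arises before an
  inequality is known to hold with a finite constant. In \<open>ckn_constant_on F\<close> the functions in
  \<open>F\<close> are smooth with compact support in \<open>\<real>\<^sup>d - {0}\<close>, so all the integrals are finite.\<close>

definition ckn_constant_on ::
    "(real^'n::finite \<Rightarrow> real) set \<Rightarrow> real \<Rightarrow> real \<Rightarrow> real \<Rightarrow> ennreal" where
  "ckn_constant_on F \<theta> p a = Inf {C. \<forall>u\<in>F.
     ennreal ((Lp_norm p (\<lambda>x. norm x powr (- b_exp CARD('n) p a) * u x))\<^sup>2)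
     \<le> C * ennreal (Lp_norm 2 (\<lambda>x. norm x powr (- a) *\<^sub>R grad u x) powr (2 * \<theta>)
                   * Lp_norm 2 (\<lambda>x. norm x powr (- (a + 1)) * u x) powr (2 * (1 - \<theta>)))}"

definition C_CKN :: "'n::finite itself \<Rightarrow> real \<Rightarrow> real \<Rightarrow> real \<Rightarrow> ennreal" where
  "C_CKN _ \<theta> p a = ckn_constant_on (test_functions (- {0 :: real^'n})) \<theta> p a"

definition C_CKN_rad :: "'n::finite itself \<Rightarrow> real \<Rightarrow> real \<Rightarrow> real \<Rightarrow> ennreal" where
  "C_CKN_rad _ \<theta> p a =
     ckn_constant_on {u \<in> test_functions (- {0 :: real^'n}). radial u} \<theta> p a"

text \<open>\<open>H1 u G\<close>: \<open>u\<close> belongs to \<open>H\<^sup>1(\<real>\<^sup>d)\<close> and \<open>G\<close> is its weak gradient.\<close>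

definition H1 :: "(real^'n::finite \<Rightarrow> real) \<Rightarrow> (real^'n \<Rightarrow> real^'n) \<Rightarrow> bool" where
  "H1 u G \<longleftrightarrow> in_Lp 2 u \<and> in_Lp 2 G \<and>
     (\<forall>\<phi>\<in>test_functions UNIV. \<forall>i.
        (LINT x|lborel. u x * partial i \<phi> x) = - (LINT x|lborel. G x $ i * \<phi> x))"

text \<open>\<open>in_Lp p u\<close> is part of the inequality: the left-hand side is infinite otherwise.\<close>

definition C_GN :: "'n::finite itself \<Rightarrow> real \<Rightarrow> ennreal" where
  "C_GN _ p = Inf {C. \<forall>(u :: real^'n \<Rightarrow> real) G. H1 u G \<longrightarrow>
     in_Lp p u \<and>
     ennreal ((Lp_norm p u)\<^sup>2)
     \<le> C * ennreal (Lp_norm 2 G powr (2 * vartheta p CARD('n))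
                   * Lp_norm 2 u powr (2 * (1 - vartheta p CARD('n))))}"

definition a_star :: "'n::finite itself \<Rightarrow> real \<Rightarrow> real" where
  "a_star N p = (THE a. a < a_crit CARD('n) \<and>
     C_GN N p = C_CKN_rad N (vartheta p CARD('n)) p a)"

text \<open>Linear stability of the radial extremals is, by definition, this range of \<open>a\<close>. There all
  non-zero eigenvalues of the second variation of
  \<open>(\<parallel>\<nabla>v\<parallel>\<^sup>2 + (a - a\<^sub>c)\<^sup>2 \<parallel>v\<parallel>\<^sup>2) powr \<theta> * \<parallel>v\<parallel> powr (2 * (1 - \<theta>))\<close> on the unit sphere of
  \<open>L\<^sup>p(\<real> \<times> S\<^sup>d\<^sup>-\<^sup>1)\<close>, at a minimizer among functions of the first variable only, are positive, while
  a negative eigenvalue appears for \<open>a < a_lower d \<theta> p\<close>.\<close>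

definition radial_extremals_linearly_stable :: "nat \<Rightarrow> real \<Rightarrow> real \<Rightarrow> real \<Rightarrow> bool" where
  "radial_extremals_linearly_stable d \<theta> p a \<longleftrightarrow> a \<in> {a_lower d \<theta> p <..< a_crit d}"

end

theory Submission
  imports Defs "HOL-Probability.Probability"
begin

text \<open>In Emden--Fowler coordinates the radial inequality lives on the line, where scaling shows that its
  best constant is a multiple of a negative power of \<open>a\<^sub>c - a\<close>. Hence \<open>a\<^sub>\<star>\<close> is well defined, and for
  \<open>a < a\<^sub>\<star>\<close> the radial constant is below the Gagliardo--Nirenberg constant, which in turn bounds the
  full constant from below: translate a test function to infinity, where the weights become constant.

  It remains to show \<open>a_lower < a\<^sub>\<star>\<close>, i.e. that at \<open>a_lower\<close> the radial constant is below the
  Gagliardo--Nirenberg constant. The latter is bounded from below by a Gaussian. For the former the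
  sharp inequality on the line for \<open>p = 4\<close>, interpolated with \<open>p = 2\<close>, is already good enough. After
  taking roots of order proportional to \<open>p - 2\<close>, and letting \<open>p \<rightarrow> 2\<close>, one is left with an inequality for the
  area of the unit sphere.\<close>

subsection \<open>Calculus of smooth functions\<close>

text \<open>The constants are infima over different classes. \<open>C_GN\<close> ranges over all of
  H^1, with weak gradients and with membership in L^p as part of the inequality, while the other two
  only see test functions; so an inequality has to be carried from test functions to H^1 by cutoff,
  mollification and Fatou. Moreover \<open>a_star\<close> is a \<open>THE\<close>: it needs
  \<open>C_GN\<close> finite and positive, hence a Gagliardo-Nirenberg inequality with some
  constant, proved here by level sets for p < 2 + 4/d. Rough constants suffice near p = 2. There
  both constants have the form base to the power (p - 2) / (2 p), so only the bases at p = 2 matter.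
  Gaussians are the extremals of the logarithmic Sobolev inequality, the limit of
  Gagliardo-Nirenberg, so the lower bound loses nothing in the limit. On the line the limiting base
  is 2 / (pi e), and using the base 1/3 of the exponent 4 instead costs the factor 6 / (pi e), about
  0.70. The remaining quantity, the squared sphere area times ((d - 1) / (2 pi e))^(d - 1), tends to
  2 by Stirling, which leaves a margin in every dimension.\<close>

lemma C_k_imp_continuous: "C_k k u \<Longrightarrow> continuous_on UNIV u"
  by (cases k) (auto simp: continuous_on_eq_continuous_at intro: differentiable_imp_continuous_within)

lemma C_k_Suc_imp: "C_k (Suc k) u \<Longrightarrow> C_k k u"
proof (induction k arbitrary: u)
  case 0
  then show ?case using C_k_imp_continuous by fastforce
next
  case (Suc k)
  then show ?case by (metis C_k.simps(2))
qed

lemma partial_eqI: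
  assumes "(u has_derivative D) (at x)"
  shows "partial i u x = D (axis i 1)"
  by (simp add: partial_def frechet_derivative_at[OF assms, symmetric])

lemma has_derivative_grad:
  fixes u :: "real^'n \<Rightarrow> real"
  assumes "u differentiable (at x)"
  shows "(u has_derivative (\<lambda>h. grad u x \<bullet> h)) (at x)"
proof -
  have D: "(u has_derivative frechet_derivative u (at x)) (at x)"
    using assms by (simp add: frechet_derivative_works)
  then have l: "linear (frechet_derivative u (at x))"
    by (rule has_derivative_linear)
  have "frechet_derivative u (at x) = (\<lambda>h. grad u x \<bullet> h)"
  proof
    fix h :: "real^'n"
    have "h = (\<Sum>i\<in>UNIV. h $ i *\<^sub>R axis i 1)"
      by (metis basis_expansion scalar_mult_eq_scaleR)
    then have "frechet_derivative u (at x) h = (\<Sum>i\<in>UNIV. h $ i * frechet_derivative u (at x) (axis i 1))"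
      using linear_sum[OF l, of "\<lambda>i. h $ i *\<^sub>R axis i 1" UNIV] linear_cmul[OF l] by simp
    also have "\<dots> = grad u x \<bullet> h"
      by (simp add: inner_vec_def grad_def partial_def mult.commute)
    finally show "frechet_derivative u (at x) h = grad u x \<bullet> h" .
  qed
  with D show ?thesis by simp
qed

lemma grad_eqI:
  fixes u :: "real^'n \<Rightarrow> real"
  assumes "(u has_derivative (\<lambda>h. G \<bullet> h)) (at x)"
  shows "grad u x = G"
  by (simp add: vec_eq_iff grad_def partial_eqI[OF assms] inner_axis)

lemma partial_add:
  assumes "u differentiable (at x)" "v differentiable (at x)"
  shows "partial i (\<lambda>x. u x + v x) x = partial i u x + partial i v x"
  using partial_eqI[OF has_derivative_add[OF assms[unfolded frechet_derivative_works]]]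
  by (simp add: partial_def)

lemma partial_mult:
  fixes u v :: "real^'n \<Rightarrow> real"
  assumes "u differentiable (at x)" "v differentiable (at x)"
  shows "partial i (\<lambda>x. u x * v x) x = u x * partial i v x + partial i u x * v x"
  using partial_eqI[OF has_derivative_mult[OF assms[unfolded frechet_derivative_works]]]
  by (simp add: partial_def)

lemma C_k_const: "C_k k (\<lambda>x. c)"
proof (induction k arbitrary: c)
  case (Suc k)
  have "partial i (\<lambda>x. c) = (\<lambda>x. 0)" for i :: 'a
    by (rule ext) (simp add: partial_def)
  with Suc show ?case by simp
qed simp

lemma C_k_component: "C_k k (\<lambda>x. x $ j)"
proof (cases k)
  case (Suc k')
  have D: "((\<lambda>x::real^'a. x $ j) has_derivative (\<lambda>x. x $ j)) (at y)" for y
    by (intro bounded_linear_imp_has_derivative bounded_linear_vec_nth)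
  have "partial i (\<lambda>x::real^'a. x $ j) = (\<lambda>x. axis i 1 $ j)" for i
    by (rule ext) (simp add: partial_eqI[OF D])
  with Suc D show ?thesis by (auto simp: C_k_const differentiable_def)
qed (auto intro: continuous_intros)

lemma C_k_add: "C_k k u \<Longrightarrow> C_k k v \<Longrightarrow> C_k k (\<lambda>x. u x + v x)"
proof (induction k arbitrary: u v)
  case (Suc k)
  then have "partial i (\<lambda>x. u x + v x) = (\<lambda>x. partial i u x + partial i v x)" for i
    by (auto simp: partial_add)
  with Suc show ?case by auto
qed (auto intro: continuous_intros)

lemma C_k_mult: "C_k k u \<Longrightarrow> C_k k v \<Longrightarrow> C_k k (\<lambda>x. u x * v x)"
proof (induction k arbitrary: u v)
  case (Suc k)
  then have "partial i (\<lambda>x. u x * v x) = (\<lambda>x. u x * partial i v x + partial i u x * v x)" for i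
    by (auto simp: partial_mult)
  moreover have "C_k k u" "C_k k v" using Suc.prems by (auto intro: C_k_Suc_imp)
  ultimately show ?case using Suc by (auto intro!: C_k_add)
qed (auto intro: continuous_intros)

lemma C_k_sum: "(\<And>i. i \<in> I \<Longrightarrow> C_k k (f i)) \<Longrightarrow> C_k k (\<lambda>x. \<Sum>i\<in>I. f i x)"
  by (induction I rule: infinite_finite_induct) (auto simp: C_k_const intro!: C_k_add)

lemma C_k_inner_self: "C_k k (\<lambda>x. x \<bullet> x)"
  unfolding inner_vec_def inner_real_def by (intro C_k_sum C_k_mult C_k_component)

lemma partial_affine:
  fixes u :: "real^'n \<Rightarrow> real"
  assumes "u differentiable (at (c *\<^sub>R x + z))"
  shows "((\<lambda>x. u (c *\<^sub>R x + z)) differentiable (at x))"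
    and "partial i (\<lambda>x. u (c *\<^sub>R x + z)) x = c * partial i u (c *\<^sub>R x + z)"
proof -
  have "((\<lambda>x. u (c *\<^sub>R x + z)) has_derivative (\<lambda>h. grad u (c *\<^sub>R x + z) \<bullet> (c *\<^sub>R h))) (at x)"
    by (rule has_derivative_compose[where g = u and f = "\<lambda>x. c *\<^sub>R x + z"])
       (auto intro!: derivative_eq_intros has_derivative_grad[OF assms])
  then show "((\<lambda>x. u (c *\<^sub>R x + z)) differentiable (at x))"
    and "partial i (\<lambda>x. u (c *\<^sub>R x + z)) x = c * partial i u (c *\<^sub>R x + z)"
    by (auto simp: differentiable_def partial_eqI inner_axis grad_def)
qed

lemma C_k_cmult: "C_k k u \<Longrightarrow> C_k k (\<lambda>x. c * u x)"
  by (intro C_k_mult C_k_const)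

lemma C_k_affine:
  fixes u :: "real^'n \<Rightarrow> real"
  shows "C_k k u \<Longrightarrow> C_k k (\<lambda>x. u (c *\<^sub>R x + z))"
proof (induction k arbitrary: u)
  case 0
  then show ?case by (auto intro!: continuous_intros continuous_on_compose2[of UNIV u])
next
  case (Suc k)
  then have "partial i (\<lambda>x. u (c *\<^sub>R x + z)) = (\<lambda>x. c * partial i u (c *\<^sub>R x + z))" for i
    by (auto simp: partial_affine)
  with Suc show ?case by (auto simp: partial_affine(1) intro!: C_k_cmult)
qed

section \<open>Smooth functions of one real variable\<close>

definition smooth_seq :: "(nat \<Rightarrow> real \<Rightarrow> real) \<Rightarrow> bool" where
  "smooth_seq W \<longleftrightarrow> (\<forall>n t. (W n has_real_derivative W (Suc n) t) (at t))"

text \<open>\<open>C_k\<close> lives on \<open>real^'n\<close>. On the line smoothness is witnessed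
  by the whole sequence of derivatives, which is the form in which the chain rule consumes
  it.\<close>

definition smooth1 :: "(real \<Rightarrow> real) \<Rightarrow> bool" where
  "smooth1 w \<longleftrightarrow> (\<exists>W. smooth_seq W \<and> W 0 = w)"

text \<open>A class of functions in which every member has a derivative in the class consists of
  smooth functions. This spares all formulas for n-th derivatives: it is enough to exhibit a class
  closed under differentiation.\<close>

lemma smooth1_coinduct:
  assumes "f \<in> S"
    and "\<And>f. f \<in> S \<Longrightarrow> \<exists>g\<in>S. \<forall>t. (f has_real_derivative g t) (at t)"
  shows "smooth1 f"
proof -
  obtain D where D: "\<And>f. f \<in> S \<Longrightarrow> D f \<in> S" "\<And>f t. f \<in> S \<Longrightarrow> (f has_real_derivative D f t) (at t)"
    using assms(2) by metis
  have S: "(D ^^ n) f \<in> S" for n by (induction n) (auto simp: assms(1) D)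
  show ?thesis unfolding smooth1_def smooth_seq_def
    by (rule exI[of _ "\<lambda>n. (D ^^ n) f"]) (auto simp: D(2)[OF S])
qed

lemma smooth1_deriv:
  assumes "smooth1 w"
  obtains w' where "smooth1 w'" "\<And>t. (w has_real_derivative w' t) (at t)"
proof -
  obtain W where W: "smooth_seq W" "W 0 = w" using assms by (auto simp: smooth1_def)
  have "smooth1 (W 1)" unfolding smooth1_def
    by (rule exI[of _ "\<lambda>n. W (Suc n)"]) (use W in \<open>auto simp: smooth_seq_def\<close>)
  with W show ?thesis by (intro that[of "W 1"]) (auto simp: smooth_seq_def)
qed

text \<open>The chain rule turns \<open>W n\<close> into \<open>W (Suc n)\<close> times a partial
  derivative of f, so the induction on k has to treat all members of the sequence at once.\<close>

lemma C_k_compose: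
  assumes W: "smooth_seq W" and f: "\<And>k. C_k k f"
  shows "C_k k (\<lambda>x. W n (f x))"
proof (induction k arbitrary: n)
  case 0
  have "continuous_on UNIV (W n)"
    using W by (auto simp: smooth_seq_def continuous_on_eq_continuous_at intro: DERIV_isCont)
  then show ?case using C_k_imp_continuous[OF f] by (auto intro: continuous_on_compose2)
next
  case (Suc k)
  have df: "f differentiable (at x)" for x using f[of "Suc 0"] by auto
  have D: "((\<lambda>x. W n (f x)) has_derivative (\<lambda>h. frechet_derivative f (at x) h * W (Suc n) (f x))) (at x)" for x
    using df[of x] W unfolding frechet_derivative_works smooth_seq_def
    by (intro DERIV_compose_FDERIV[where f = "W n"]) auto
  have "partial i (\<lambda>x. W n (f x)) = (\<lambda>x. partial i f x * W (Suc n) (f x))" for i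
    using partial_eqI[OF D] by (auto simp: partial_def)
  moreover have "C_k k (partial i f)" for i using f[of "Suc k"] by auto
  moreover have "(\<lambda>x. W n (f x)) differentiable (at x)" for x using D differentiable_def by blast
  ultimately show ?case using Suc by (auto intro!: C_k_mult)
qed

lemma smooth_compose: "smooth1 w \<Longrightarrow> smooth f \<Longrightarrow> smooth (\<lambda>x. w (f x))"
  unfolding smooth1_def smooth_def using C_k_compose by blast

lemma smooth_const [simp]: "smooth (\<lambda>x. c)" by (simp add: smooth_def C_k_const)
lemma smooth_component [simp]: "smooth (\<lambda>x. x $ i)" by (simp add: smooth_def C_k_component)
lemma smooth_inner_self [simp]: "smooth (\<lambda>x. x \<bullet> x)" by (simp add: smooth_def C_k_inner_self)
lemma smooth_add: "smooth u \<Longrightarrow> smooth v \<Longrightarrow> smooth (\<lambda>x. u x + v x)"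
  by (simp add: smooth_def C_k_add)
lemma smooth_mult: "smooth u \<Longrightarrow> smooth v \<Longrightarrow> smooth (\<lambda>x. u x * v x)"
  by (simp add: smooth_def C_k_mult)
lemma smooth_affine: "smooth u \<Longrightarrow> smooth (\<lambda>x. u (c *\<^sub>R x + z))"
  by (simp add: smooth_def C_k_affine)
lemma smooth_partial: "smooth u \<Longrightarrow> smooth (partial i u)"
  by (metis C_k.simps(2) smooth_def)
lemma smooth_differentiable: "smooth u \<Longrightarrow> u differentiable (at x)"
  by (metis C_k.simps(2) smooth_def)
lemma smooth_continuous: "smooth u \<Longrightarrow> continuous_on UNIV u"
  by (metis C_k_imp_continuous smooth_def)
lemma smooth_measurable: "smooth u \<Longrightarrow> u \<in> borel_measurable borel"
  by (intro borel_measurable_continuous_onI smooth_continuous)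

lemma continuous_on_grad: "smooth u \<Longrightarrow> continuous_on UNIV (grad u)"
  unfolding grad_def by (intro continuous_on_vec_lambda smooth_continuous smooth_partial)

lemma grad_measurable: "smooth u \<Longrightarrow> grad u \<in> borel_measurable borel"
  by (intro borel_measurable_continuous_onI continuous_on_grad)

lemma smooth1_mult:
  assumes "smooth1 f" "smooth1 g"
  shows "smooth1 (\<lambda>t. f t * g t)"
proof -
  obtain F G where F: "smooth_seq F" "F 0 = f" and G: "smooth_seq G" "G 0 = g"
    using assms by (auto simp: smooth1_def)
  \<comment> \<open>Finite sums of products of derivatives of f and g, indexed by lists of pairs of
    orders. The Leibniz rule replaces a pair (i,j) by the two pairs (i+1,j) and (i,j+1), so these
    sums are closed under differentiation.\<close>
  define s where "s L t = (\<Sum>(i,j)\<leftarrow>L. F i t * G j t)" for L t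
  have s_Cons: "s ((i,j) # L) t = F i t * G j t + s L t" for i j L t by (simp add: s_def)
  have "\<exists>L'. \<forall>t. (s L has_real_derivative s L' t) (at t)" for L
  proof (induction L)
    case Nil
    show ?case by (rule exI[of _ "[]"]) (auto simp: s_def[abs_def])
  next
    case (Cons p L)
    obtain i j where p: "p = (i,j)" by force
    obtain L' where L': "(s L has_real_derivative s L' t) (at t)" for t using Cons by auto
    have "s (p # L) = (\<lambda>t. F i t * G j t + s L t)" by (auto simp: s_def p)
    moreover have "((\<lambda>t. F i t * G j t + s L t) has_real_derivative s ((Suc i,j) # (i,Suc j) # L') t) (at t)" for t
      using F(1) G(1) L'[of t] unfolding smooth_seq_def
      by (auto intro!: derivative_eq_intros simp: s_Cons)
    ultimately show ?case by metis
  qed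
  then have "smooth1 (s [(0,0)])"
    by (intro smooth1_coinduct[where S = "range s"]) auto
  then show ?thesis by (simp add: s_def[abs_def] F G)
qed

lemma smooth1_exp: "smooth1 (\<lambda>t. exp (c * t))"
proof (rule smooth1_coinduct[where S = "range (\<lambda>k t. k * exp (c * t))"])
  fix f assume "f \<in> range (\<lambda>k t. k * exp (c * t))"
  then obtain k where f: "f = (\<lambda>t. k * exp (c * t))" by auto
  show "\<exists>g\<in>range (\<lambda>k t. k * exp (c * t)). \<forall>t. (f has_real_derivative g t) (at t)"
    unfolding f by (rule bexI[of _ "\<lambda>t. (k * c) * exp (c * t)"]) (auto intro!: derivative_eq_intros)
qed (auto intro!: image_eqI[of _ _ 1])

lemma smooth1_affine:
  assumes "smooth1 f"
  shows "smooth1 (\<lambda>t. f (a * t + b))"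
proof -
  from assms obtain F where F: "smooth_seq F" "F 0 = f" by (auto simp: smooth1_def)
  have D: "((\<lambda>t. F n (a * t + b)) has_real_derivative F (Suc n) (a * t + b) * a) (at t)" for n t
  proof (rule DERIV_chain2[where f = "F n" and g = "\<lambda>t. a * t + b"])
    show "((\<lambda>t. a * t + b) has_real_derivative a) (at t)" by (auto intro!: derivative_eq_intros)
  qed (use F in \<open>auto simp: smooth_seq_def\<close>)
  have "((\<lambda>t. a ^ n * F n (a * t + b)) has_real_derivative a ^ Suc n * F (Suc n) (a * t + b)) (at t)" for n t
    using DERIV_cmult[OF D[of n t], of "a ^ n"] by (simp add: mult_ac)
  then have "smooth_seq (\<lambda>n t. a ^ n * F n (a * t + b))" by (simp add: smooth_seq_def)
  moreover have "(\<lambda>t. a ^ 0 * F 0 (a * t + b)) = (\<lambda>t. f (a * t + b))" by (simp add: F)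
  ultimately show ?thesis unfolding smooth1_def by blast
qed

lemma smooth1_imp_continuous: "smooth1 f \<Longrightarrow> continuous_on UNIV f"
  by (metis DERIV_isCont continuous_at_imp_continuous_on smooth1_deriv)

text \<open>All derivatives of exp(-1/t), extended by zero to t \<le> 0, are of this form, which
  makes \<open>range flat\<close> a class closed under differentiation.\<close>

definition flat :: "real poly \<Rightarrow> real \<Rightarrow> real" where
  "flat P t = (if t > 0 then poly P (1/t) * exp (-1/t) else 0)"

lemma flat_tendsto_0: "(flat P \<longlongrightarrow> 0) (at 0)"
proof -
  have "((\<lambda>x. x ^ k * poly P x / exp x) \<longlongrightarrow> 0) at_top" for k
  proof (induction P arbitrary: k)
    case (pCons a P)
    have "((\<lambda>x. a * (x ^ k / exp x) + x ^ Suc k * poly P x / exp x) \<longlongrightarrow> a * 0 + 0) at_top"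
      by (intro tendsto_intros pCons tendsto_power_div_exp_0)
    then show ?case by (simp add: field_simps)
  qed simp
  from this[of 0] have "((\<lambda>x. poly P x / exp x) \<longlongrightarrow> 0) at_top" by simp
  then have "((\<lambda>t. poly P (inverse t) / exp (inverse t)) \<longlongrightarrow> 0) (at_right 0)"
    by (rule filterlim_compose[OF _ filterlim_inverse_at_top_right])
  then have "(flat P \<longlongrightarrow> 0) (at_right 0)"
    by (rule Lim_transform_eventually)
       (auto simp: eventually_at_right_less flat_def exp_minus field_simps intro!: eventually_at_rightI[of 0 1])
  moreover have "(flat P \<longlongrightarrow> 0) (at_left 0)"
    by (rule Lim_transform_eventually[OF tendsto_const])
       (auto simp: flat_def intro!: eventually_at_leftI[of "-1" 0])
  ultimately show ?thesis by (simp add: filterlim_split_at)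
qed

text \<open>With y = 1/t the operator d/dt is - y^2 d/dy. Applied to P(y) exp(-y) it gives y^2 (P -
  P')(y) exp(-y), and \<open>[:0,0,1:]\<close> is the polynomial y^2.\<close>

lemma flat_deriv:
  "(flat P has_real_derivative flat ([:0,0,1:] * (P - pderiv P)) t) (at t)"
proof (cases t "0::real" rule: linorder_cases)
  case greater
  have "((\<lambda>t. poly P (1/t) * exp (-1/t)) has_real_derivative flat ([:0,0,1:] * (P - pderiv P)) t) (at t)"
  proof -
    have "((\<lambda>t. poly P (1/t)) has_real_derivative poly (pderiv P) (1/t) * (-1/t\<^sup>2)) (at t)"
      by (rule DERIV_chain2[OF poly_DERIV])
         (use greater in \<open>auto intro!: derivative_eq_intros simp: power2_eq_square\<close>)
    moreover have "((\<lambda>t. exp (-1/t)) has_real_derivative exp (-1/t) * (1/t\<^sup>2)) (at t)"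
      by (rule DERIV_chain2[OF DERIV_exp])
         (use greater in \<open>auto intro!: derivative_eq_intros simp: power2_eq_square\<close>)
    ultimately have "((\<lambda>t. poly P (1/t) * exp (-1/t)) has_real_derivative
        poly (pderiv P) (1/t) * (-1/t\<^sup>2) * exp (-1/t) + exp (-1/t) * (1/t\<^sup>2) * poly P (1/t)) (at t)"
      by (rule DERIV_mult)
    moreover have "flat ([:0,0,1:] * (P - pderiv P)) t =
        poly (pderiv P) (1/t) * (-1/t\<^sup>2) * exp (-1/t) + exp (-1/t) * (1/t\<^sup>2) * poly P (1/t)"
      using greater by (simp add: flat_def power2_eq_square algebra_simps)
    ultimately show ?thesis by simp
  qed
  moreover have "\<forall>\<^sub>F s in nhds t. flat P s = poly P (1/s) * exp (-1/s)"
    using eventually_nhds_in_open[of "{0<..}" t] greater by (simp add: flat_def eventually_mono)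
  ultimately show ?thesis by (subst DERIV_cong_ev[OF refl _ refl])
next
  case less
  have "\<forall>\<^sub>F s in nhds t. flat P s = 0"
    using eventually_nhds_in_open[of "{..<0}" t] less by (simp add: flat_def eventually_mono)
  moreover have "((\<lambda>s. 0) has_real_derivative flat ([:0,0,1:] * (P - pderiv P)) t) (at t)"
    using less by (simp add: flat_def)
  ultimately show ?thesis by (subst DERIV_cong_ev[OF refl _ refl])
next
  case equal
  have "((\<lambda>h. (flat P (0 + h) - flat P 0) / h) \<longlongrightarrow> 0) (at 0)"
  \<comment> \<open>Dividing by t multiplies the polynomial by 1/t, so the difference quotient at 0
    is again a flat function, that of \<open>pCons 0 P\<close>.\<close>
  proof (rule Lim_transform_eventually[OF flat_tendsto_0[of "pCons 0 P"]])
    show "\<forall>\<^sub>F x in at 0. flat (pCons 0 P) x = (flat P (0 + x) - flat P 0) / x"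
      by (auto simp: flat_def field_simps)
  qed
  then show ?thesis by (simp add: equal DERIV_def) (simp add: flat_def)
qed

definition bump :: "real \<Rightarrow> real" where
  "bump t = (if t > 0 then exp (-1/t) else 0)"

lemma smooth1_bump: "smooth1 bump"
proof -
  have "bump = flat 1" by (auto simp: bump_def flat_def)
  then show ?thesis by (intro smooth1_coinduct[where S = "range flat"]) (use flat_deriv in blast)+
qed

lemma bump_nonneg: "bump t \<ge> 0" and bump_pos_iff: "bump t > 0 \<longleftrightarrow> t > 0"
  and bump_eq_0_iff: "bump t = 0 \<longleftrightarrow> t \<le> 0"
  by (auto simp: bump_def)

lemma bump_mono: "s \<le> t \<Longrightarrow> bump s \<le> bump t"
  by (auto simp: bump_def field_simps)

section \<open>Invariance of Lebesgue integrals under translation and reflection\<close>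

lemma lborel_distr_isometry:
  assumes "\<bar>c\<bar> = 1"
  shows "distr lborel borel (\<lambda>x. t + c *\<^sub>R x) = (lborel :: 'a::euclidean_space measure)"
  using lborel_affine[of c t] assms by (auto simp: density_1)

lemma nn_integral_lborel_shift:
  fixes f :: "'a::euclidean_space \<Rightarrow> ennreal"
  assumes [measurable]: "f \<in> borel_measurable borel"
  shows "(\<integral>\<^sup>+x. f (x + t) \<partial>lborel) = (\<integral>\<^sup>+x. f x \<partial>lborel)"
    and "(\<integral>\<^sup>+x. f (x - t) \<partial>lborel) = (\<integral>\<^sup>+x. f x \<partial>lborel)"
    and "(\<integral>\<^sup>+x. f (t - x) \<partial>lborel) = (\<integral>\<^sup>+x. f x \<partial>lborel)"
proof -
  have *: "(\<integral>\<^sup>+x. f x \<partial>lborel) = (\<integral>\<^sup>+x. f (s + c *\<^sub>R x) \<partial>lborel)" if "\<bar>c\<bar> = 1" for c s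
    by (subst lborel_distr_isometry[OF that, of s, symmetric], subst nn_integral_distr) auto
  from *[of 1 t] show "(\<integral>\<^sup>+x. f (x + t) \<partial>lborel) = (\<integral>\<^sup>+x. f x \<partial>lborel)" by (simp add: add.commute)
  from *[of 1 "-t"] show "(\<integral>\<^sup>+x. f (x - t) \<partial>lborel) = (\<integral>\<^sup>+x. f x \<partial>lborel)" by simp
  from *[of "-1" t] show "(\<integral>\<^sup>+x. f (t - x) \<partial>lborel) = (\<integral>\<^sup>+x. f x \<partial>lborel)" by simp
qed

lemma integral_lborel_shift:
  fixes f :: "'a::euclidean_space \<Rightarrow> 'b::euclidean_space"
  assumes [measurable]: "f \<in> borel_measurable borel"
  shows "(LINT x|lborel. f (x + t)) = (LINT x|lborel. f x)"
    and "(LINT x|lborel. f (x - t)) = (LINT x|lborel. f x)"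
    and "(LINT x|lborel. f (t - x)) = (LINT x|lborel. f x)"
proof -
  have *: "(LINT x|lborel. f x) = (LINT x|lborel. f (s + c *\<^sub>R x))" if "\<bar>c\<bar> = 1" for c s
    by (subst lborel_distr_isometry[OF that, of s, symmetric], subst integral_distr) auto
  from *[of 1 t] show "(LINT x|lborel. f (x + t)) = (LINT x|lborel. f x)" by (simp add: add.commute)
  from *[of 1 "-t"] show "(LINT x|lborel. f (x - t)) = (LINT x|lborel. f x)" by simp
  from *[of "-1" t] show "(LINT x|lborel. f (t - x)) = (LINT x|lborel. f x)" by simp
qed

lemma integrable_lborel_shift:
  fixes f :: "'a::euclidean_space \<Rightarrow> 'b::euclidean_space"
  assumes "integrable lborel f"
  shows "integrable lborel (\<lambda>x. f (x + t))" "integrable lborel (\<lambda>x. f (x - t))"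
    "integrable lborel (\<lambda>x. f (t - x))"
proof -
  have *: "integrable lborel (\<lambda>x. f (s + c *\<^sub>R x))" if "\<bar>c\<bar> = 1" for c s
  proof -
    have "integrable (distr lborel borel (\<lambda>x. s + c *\<^sub>R x)) f"
      by (simp add: lborel_distr_isometry[OF that] assms)
    then show ?thesis using assms by (subst (asm) integrable_distr_eq) auto
  qed
  from *[of 1 t] show "integrable lborel (\<lambda>x. f (x + t))" by (simp add: add.commute)
  from *[of 1 "-t"] show "integrable lborel (\<lambda>x. f (x - t))" by simp
  from *[of "-1" t] show "integrable lborel (\<lambda>x. f (t - x))" by simp
qed

lemma integrable_bounded_support:
  fixes f :: "'a::euclidean_space \<Rightarrow> 'b::euclidean_space"
  assumes "continuous_on UNIV f" "\<And>x. R < norm x \<Longrightarrow> f x = 0"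
  shows "integrable lborel f"
proof -
  have "integrable lborel (\<lambda>x. indicator (cball 0 R) x *\<^sub>R f x)"
    by (rule borel_integrable_compact) (use assms in \<open>auto intro: continuous_on_subset\<close>)
  moreover have "(\<lambda>x. indicator (cball 0 R) x *\<^sub>R f x) = f"
    using assms(2) by (force simp: indicator_def)
  ultimately show ?thesis by simp
qed

lemma bounded_bounded_support:
  fixes f :: "'a::euclidean_space \<Rightarrow> 'b::euclidean_space"
  assumes "continuous_on UNIV f" "\<And>x. R < norm x \<Longrightarrow> f x = 0"
  obtains L where "L > 0" "\<And>x. norm (f x) \<le> L"
proof -
  have "compact (f ` cball 0 R)"
    using assms by (intro compact_continuous_image) (auto intro: continuous_on_subset)
  then obtain L where L: "L > 0" "\<And>x. x \<in> cball 0 R \<Longrightarrow> norm (f x) \<le> L"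
    using bounded_pos compact_imp_bounded by (metis image_eqI)
  have "norm (f x) \<le> L" for x
    using L assms(2)[of x] by (cases "norm x \<le> R") auto
  with L show ?thesis using that by blast
qed

subsection \<open>Test functions\<close>

lemma test_functions_iff:
  "u \<in> test_functions UNIV \<longleftrightarrow> smooth u \<and> (\<exists>R. \<forall>x. R < norm x \<longrightarrow> u x = 0)"
proof -
  have "compact (supp u) \<longleftrightarrow> (\<exists>R. \<forall>x. R < norm x \<longrightarrow> u x = 0)"
    unfolding supp_def compact_closure bounded_iff mem_Collect_eq Ball_def by (meson not_le)
  then show ?thesis by (auto simp: test_functions_def)
qed

lemma test_functionsI: "smooth u \<Longrightarrow> (\<And>x. R < norm x \<Longrightarrow> u x = 0) \<Longrightarrow> u \<in> test_functions UNIV"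
  by (auto simp: test_functions_iff)

lemma test_functionsE:
  assumes "u \<in> test_functions UNIV"
  obtains R where "R > 0" "smooth u" "\<And>x. R < norm x \<Longrightarrow> u x = 0"
proof -
  from assms obtain R where "smooth u" "\<And>x. R < norm x \<Longrightarrow> u x = 0"
    by (auto simp: test_functions_iff)
  then show ?thesis by (intro that[of "max 1 R"]) auto
qed

lemma test_functions_punctured_iff:
  "u \<in> test_functions (- {0}) \<longleftrightarrow> u \<in> test_functions UNIV \<and> (\<exists>r>0. \<forall>x. norm x < r \<longrightarrow> u x = 0)"
proof -
  have "0 \<notin> supp u \<longleftrightarrow> (\<exists>r>0. \<forall>x. norm x < r \<longrightarrow> u x = 0)"
    unfolding supp_def closure_approachable by (auto simp: dist_norm)
  then show ?thesis by (auto simp: test_functions_def)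
qed

lemma partial_eq_0_support:
  assumes "\<And>x. R < norm x \<Longrightarrow> u x = 0" "R < norm x"
  shows "partial i u x = 0"
proof -
  have "open {x::real^'a. R < norm x}" by (intro open_Collect_less continuous_intros)
  moreover have "((\<lambda>x. 0) has_derivative (\<lambda>h. 0)) (at x)" by simp
  ultimately have "(u has_derivative (\<lambda>h. 0)) (at x)"
    using assms by (metis (mono_tags, lifting) has_derivative_transform_within_open mem_Collect_eq)
  then show ?thesis by (simp add: partial_eqI)
qed

lemma grad_eq_0_support:
  assumes "\<And>x. R < norm x \<Longrightarrow> u x = 0" "R < norm x"
  shows "grad u x = 0"
  using partial_eq_0_support[OF assms] by (simp add: grad_def vec_eq_iff)

lemma test_functions_partial:
  assumes "u \<in> test_functions UNIV"
  shows "partial i u \<in> test_functions UNIV"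
proof -
  from assms obtain R where "smooth u" "\<And>x. R < norm x \<Longrightarrow> u x = 0" by (metis test_functionsE)
  then show ?thesis by (auto intro!: test_functionsI[of _ R] smooth_partial partial_eq_0_support)
qed

lemma test_functions_mult:
  assumes "u \<in> test_functions UNIV" "smooth v"
  shows "(\<lambda>x. v x * u x) \<in> test_functions UNIV"
proof -
  from assms obtain R where "smooth u" "\<And>x. R < norm x \<Longrightarrow> u x = 0" by (metis test_functionsE)
  with assms show ?thesis by (auto intro!: test_functionsI[of _ R] smooth_mult)
qed

lemma test_functions_affine:
  assumes "u \<in> test_functions UNIV" "c \<noteq> 0"
  shows "(\<lambda>x. u (c *\<^sub>R x + z)) \<in> test_functions UNIV"
proof -
  from assms obtain R where R: "smooth u" "\<And>x. R < norm x \<Longrightarrow> u x = 0" by (metis test_functionsE)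
  have "u (c *\<^sub>R x + z) = 0" if "(R + norm z) / \<bar>c\<bar> < norm x" for x
  proof (rule R)
    have "R + norm z < norm (c *\<^sub>R x)" using that \<open>c \<noteq> 0\<close> by (simp add: field_simps)
    also have "\<dots> \<le> norm (c *\<^sub>R x + z) + norm z" using norm_triangle_ineq4[of "c *\<^sub>R x + z" z] by simp
    finally show "R < norm (c *\<^sub>R x + z)" by simp
  qed
  with R show ?thesis by (auto intro!: test_functionsI smooth_affine)
qed

lemma test_integrable: "u \<in> test_functions UNIV \<Longrightarrow> integrable lborel u"
  by (elim test_functionsE) (auto intro: integrable_bounded_support smooth_continuous)

lemma test_measurable: "u \<in> test_functions UNIV \<Longrightarrow> u \<in> borel_measurable borel"
  by (auto simp: test_functions_def smooth_measurable)

lemma test_bounded: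
  assumes "u \<in> test_functions UNIV"
  obtains L where "L > 0" "\<And>x. \<bar>u x\<bar> \<le> L"
proof -
  from assms obtain R where "smooth u" "\<And>x. R < norm x \<Longrightarrow> u x = 0" by (metis test_functionsE)
  then show ?thesis using bounded_bounded_support[OF smooth_continuous] that by (metis real_norm_def)
qed

lemma test_grad_bounded:
  assumes "u \<in> test_functions UNIV"
  obtains L where "L > 0" "\<And>x. norm (grad u x) \<le> L"
proof -
  from assms obtain R where "smooth u" "\<And>x. R < norm x \<Longrightarrow> u x = 0" by (metis test_functionsE)
  note u = this
  have "grad u x = 0" if "R < norm x" for x using grad_eq_0_support[of R u x] u(2) that by blast
  then show ?thesis using bounded_bounded_support[OF continuous_on_grad[OF u(1)]] that by metis
qed

lemma test_lipschitz:
  fixes u :: "real^'n \<Rightarrow> real"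
  assumes "smooth u" "\<And>x. norm (grad u x) \<le> L"
  shows "\<bar>u x - u y\<bar> \<le> L * norm (x - y)"
proof -
  have "norm (u x - u y) \<le> L * norm (x - y)"
  proof (rule differentiable_bound[of UNIV u "\<lambda>x h. grad u x \<bullet> h"])
    show "(u has_derivative (\<lambda>h. grad u x \<bullet> h)) (at x within UNIV)" for x
      by (rule has_derivative_grad[OF smooth_differentiable[OF assms(1)]])
    show "onorm (\<lambda>h. grad u x \<bullet> h) \<le> L" for x
      by (rule onorm_le) (metis Cauchy_Schwarz_ineq2 assms(2) mult_right_mono norm_ge_zero order_trans real_norm_def)
  qed auto
  then show ?thesis by simp
qed

subsection \<open>Convolution with test functions\<close>

definition locint :: "(real^'n \<Rightarrow> real) \<Rightarrow> bool" where
  "locint u \<longleftrightarrow> (\<forall>R. integrable lborel (\<lambda>x. indicator (cball 0 R) x * u x))"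

definition conv :: "(real^'n \<Rightarrow> real) \<Rightarrow> (real^'n \<Rightarrow> real) \<Rightarrow> real^'n \<Rightarrow> real" where
  "conv u \<phi> x = (LINT y|lborel. u y * \<phi> (x - y))"

lemma locint_measurable:
  assumes "locint u"
  shows "u \<in> borel_measurable borel"
proof (rule borel_measurable_LIMSEQ_real[where u = "\<lambda>n x. indicator (cball 0 (real n)) x * u x"])
  show "(\<lambda>x. indicator (cball 0 (real n)) x * u x) \<in> borel_measurable borel" for n
    using assms[unfolded locint_def, rule_format, THEN borel_measurable_integrable] by simp
  show "(\<lambda>n. indicator (cball 0 (real n)) x * u x) \<longlonglongrightarrow> u x" for x
  proof (rule tendsto_eventually)
    obtain N :: nat where "norm x \<le> real N" using real_arch_simple by blast
    then show "\<forall>\<^sub>F n in sequentially. indicator (cball 0 (real n)) x * u x = u x"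
      by (intro eventually_sequentiallyI[of N]) (auto simp: indicator_def)
  qed
qed

lemma locint_mult_integrable:
  assumes u: "locint u" and [measurable]: "g \<in> borel_measurable borel"
    and b: "\<And>y. \<bar>g y\<bar> \<le> L" and s: "\<And>y. R < norm y \<Longrightarrow> g y = 0"
  shows "integrable lborel (\<lambda>y. u y * g y)"
proof (rule Bochner_Integration.integrable_bound)
  show "integrable lborel (\<lambda>y. L * (indicator (cball 0 R) y * u y))"
    using u unfolding locint_def by (intro integrable_mult_right) auto
  have [measurable]: "u \<in> borel_measurable borel" by (rule locint_measurable[OF u])
  show "(\<lambda>y. u y * g y) \<in> borel_measurable lborel" by simp
  have "norm (u y * g y) \<le> norm (L * (indicator (cball 0 R) y * u y))" for y
    using b[of y] s[of y] mult_right_mono[OF b[of y] abs_ge_zero[of "u y"]]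
    by (cases "norm y \<le> R") (auto simp: indicator_def abs_mult mult_ac)
  then show "AE y in lborel. norm (u y * g y) \<le> norm (L * (indicator (cball 0 R) y * u y))" by simp
qed

lemma conv_integrable:
  assumes "locint u" "\<phi> \<in> test_functions UNIV"
  shows "integrable lborel (\<lambda>y. u y * \<phi> (x - y))"
proof -
  from assms(2) obtain R where R: "smooth \<phi>" "\<And>x. R < norm x \<Longrightarrow> \<phi> x = 0" by (metis test_functionsE)
  from assms(2) obtain L where L: "\<And>x. \<bar>\<phi> x\<bar> \<le> L" by (metis test_bounded)
  have [measurable]: "\<phi> \<in> borel_measurable borel" using assms by (simp add: test_measurable)
  show ?thesis
  proof (rule locint_mult_integrable[OF assms(1)])
    show "\<bar>\<phi> (x - y)\<bar> \<le> L" for y by (rule L)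
    show "\<phi> (x - y) = 0" if "norm x + R < norm y" for y
    proof (rule R)
      have "norm y \<le> norm x + norm (x - y)" by norm
      with that show "R < norm (x - y)" by simp
    qed
  qed simp
qed

text \<open>The remainder quotient r h of the mollifier is bounded by 2 L because \<phi> is
  Lipschitz, vanishes outside a fixed ball for increments of norm at most 1, and tends to 0
  pointwise. Dominated convergence with a local multiple of u then gives differentiability with all
  derivatives falling on \<phi>.\<close>

lemma conv_has_derivative:
  fixes u \<phi> :: "real^'n \<Rightarrow> real"
  assumes u: "locint u" and \<phi>: "\<phi> \<in> test_functions UNIV"
  shows "(conv u \<phi> has_derivative (\<lambda>h. \<Sum>i\<in>UNIV. h $ i * conv u (partial i \<phi>) x)) (at x)"
proof -
  from \<phi> obtain R where R: "R > 0" "smooth \<phi>" "\<And>x. R < norm x \<Longrightarrow> \<phi> x = 0" by (metis test_functionsE)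
  from \<phi> obtain L where L: "L > 0" "\<And>x. norm (grad \<phi> x) \<le> L" by (metis test_grad_bounded)
  have [measurable]: "\<phi> \<in> borel_measurable borel" using \<phi> by (simp add: test_measurable)
  have [measurable]: "u \<in> borel_measurable borel" by (rule locint_measurable[OF u])
  have [measurable]: "grad \<phi> \<in> borel_measurable borel" by (rule grad_measurable[OF R(2)])
  define r where "r h z = (\<phi> (z + h) - \<phi> z - grad \<phi> z \<bullet> h) / norm h" for h z :: "real^'n"
  have r_meas: "(\<lambda>y. r h (x - y)) \<in> borel_measurable borel" for h unfolding r_def by measurable
  have r_bound: "\<bar>r h z\<bar> \<le> 2 * L" for h z
  proof (cases "h = 0")
    case False
    have "\<bar>\<phi> (z + h) - \<phi> z - grad \<phi> z \<bullet> h\<bar> \<le> \<bar>\<phi> (z + h) - \<phi> z\<bar> + \<bar>grad \<phi> z \<bullet> h\<bar>" by simp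
    also have "\<dots> \<le> L * norm h + L * norm h"
    proof (intro add_mono)
      show "\<bar>\<phi> (z + h) - \<phi> z\<bar> \<le> L * norm h"
        using test_lipschitz[OF R(2) L(2), of "z + h" z] by simp
      show "\<bar>grad \<phi> z \<bullet> h\<bar> \<le> L * norm h"
        by (metis Cauchy_Schwarz_ineq2 L(2) mult_right_mono norm_ge_zero order_trans)
    qed
    finally show ?thesis using False by (simp add: r_def field_simps)
  qed (use L in \<open>simp add: r_def\<close>)
  have r_supp: "r h z = 0" if "norm h \<le> 1" "R + 1 < norm z" for h z
  proof -
    have "norm z \<le> norm (z + h) + norm h" by norm
    with that R have "R < norm (z + h)" "R < norm z" by auto
    then show ?thesis using R(3) grad_eq_0_support[of R \<phi> z] by (simp add: r_def)
  qed
  have eq: "(conv u \<phi> (x + h) - conv u \<phi> x - (\<Sum>i\<in>UNIV. h $ i * conv u (partial i \<phi>) x)) / norm h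
      = (LINT y|lborel. u y * r h (x - y))" for h
  proof -
    have i: "integrable lborel (\<lambda>y. u y * \<phi> (z - y))" "integrable lborel (\<lambda>y. u y * partial i \<phi> (z - y))" for z i
      by (intro conv_integrable[OF u] \<phi> test_functions_partial)+
    have "(LINT y|lborel. u y * r h (x - y)) =
        (LINT y|lborel. (u y * \<phi> (x + h - y) - u y * \<phi> (x - y) - (\<Sum>i\<in>UNIV. h $ i * (u y * partial i \<phi> (x - y)))) / norm h)"
      by (intro Bochner_Integration.integral_cong)
         (auto simp: r_def grad_def inner_vec_def diff_add_eq algebra_simps sum_distrib_left diff_divide_distrib add_divide_distrib)
    also have "\<dots> = (conv u \<phi> (x + h) - conv u \<phi> x - (\<Sum>i\<in>UNIV. h $ i * conv u (partial i \<phi>) x)) / norm h"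
      unfolding conv_def using i by simp
    finally show ?thesis by simp
  qed
  have lim: "((\<lambda>h. LINT y|lborel. u y * r h (x - y)) \<longlongrightarrow> 0) (at 0)"
    unfolding tendsto_at_iff_sequentially
  proof (intro allI impI)
    fix X :: "nat \<Rightarrow> real^'n"
    assume X: "\<forall>i. X i \<in> UNIV - {0}" "X \<longlonglongrightarrow> 0"
    have "(\<lambda>n. norm (X n)) \<longlonglongrightarrow> 0" using X(2) by (simp add: tendsto_norm_zero)
    then have "\<forall>\<^sub>F n in sequentially. norm (X n) < 1" by (rule order_tendstoD) simp
    then obtain N where N: "\<And>n. n \<ge> N \<Longrightarrow> norm (X n) \<le> 1" by (meson eventually_sequentially less_imp_le)
    \<comment> \<open>From index N on the increments have norm at most 1, where the support bound
      for r holds. The shift is undone at the end by \<open>LIMSEQ_offset\<close>.\<close>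
    define Y where "Y n = X (n + N)" for n
    have Y: "Y n \<noteq> 0" "norm (Y n) \<le> 1" for n using X N by (auto simp: Y_def)
    have Ylim: "Y \<longlonglongrightarrow> 0" unfolding Y_def by (rule LIMSEQ_ignore_initial_segment[OF X(2)])
    have "(\<lambda>n. LINT y|lborel. u y * r (Y n) (x - y)) \<longlonglongrightarrow> (LINT y|(lborel :: (real^'n) measure). 0)"
    proof (rule integral_dominated_convergence)
      show "integrable lborel (\<lambda>y. 2 * L * norm (indicator (cball 0 (norm x + R + 1)) y * u y))"
        using u unfolding locint_def by (intro integrable_mult_right integrable_norm) auto
      show "AE y in lborel. (\<lambda>n. u y * r (Y n) (x - y)) \<longlonglongrightarrow> 0"
      proof (intro AE_I2)
        fix y
        have "((\<lambda>h. norm (r h (x - y))) \<longlongrightarrow> 0) (at 0)"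
          using has_derivative_grad[OF smooth_differentiable[OF R(2)], of "x - y"]
          by (simp add: has_derivative_at r_def abs_divide)
        then have "((\<lambda>h. r h (x - y)) \<longlongrightarrow> 0) (at 0)" by (rule tendsto_norm_zero_cancel)
        then have "(\<lambda>n. r (Y n) (x - y)) \<longlonglongrightarrow> 0"
          using Y Ylim unfolding tendsto_at_iff_sequentially comp_def by auto
        then show "(\<lambda>n. u y * r (Y n) (x - y)) \<longlonglongrightarrow> 0" by (rule tendsto_mult_right_zero)
      qed
      fix n
      have "norm (u y * r (Y n) (x - y)) \<le> 2 * L * norm (indicator (cball 0 (norm x + R + 1)) y * u y)" for y
      proof (cases "norm y \<le> norm x + R + 1")
        case True
        then show ?thesis using mult_right_mono[OF r_bound[of "Y n" "x - y"] abs_ge_zero[of "u y"]]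
          by (simp add: abs_mult indicator_def mult_ac)
      next
        case False
        have "norm y \<le> norm x + norm (x - y)" by norm
        with False have "R + 1 < norm (x - y)" by simp
        with Y show ?thesis using L by (simp add: r_supp)
      qed
      then show "AE y in lborel. norm (u y * r (Y n) (x - y)) \<le> 2 * L * norm (indicator (cball 0 (norm x + R + 1)) y * u y)"
        by simp
    qed (use r_meas in measurable)
    then have "(\<lambda>n. LINT y|lborel. u y * r (X (n + N)) (x - y)) \<longlonglongrightarrow> 0" by (simp add: Y_def)
    then show "((\<lambda>h. LINT y|lborel. u y * r h (x - y)) \<circ> X) \<longlonglongrightarrow> 0"
      unfolding comp_def by (rule LIMSEQ_offset)
  qed
  have "((\<lambda>h. norm (conv u \<phi> (x + h) - conv u \<phi> x - (\<Sum>i\<in>UNIV. h $ i * conv u (partial i \<phi>) x)) / norm h) \<longlongrightarrow> 0) (at 0)"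
    using tendsto_rabs_zero[OF lim] by (simp add: eq[symmetric] abs_divide)
  moreover have "bounded_linear (\<lambda>h::real^'n. \<Sum>i\<in>UNIV. h $ i * conv u (partial i \<phi>) x)"
    by (intro bounded_linear_sum bounded_linear_mult_left[THEN bounded_linear_compose] bounded_linear_vec_nth)
  ultimately show ?thesis by (simp add: has_derivative_at)
qed

lemma partial_conv:
  assumes "locint u" "\<phi> \<in> test_functions UNIV"
  shows "partial i (conv u \<phi>) x = conv u (partial i \<phi>) x"
proof -
  have "(\<Sum>j\<in>UNIV. axis i 1 $ j * conv u (partial j \<phi>) x) = conv u (partial i \<phi>) x"
    by (subst sum.remove[of _ i]) (auto simp: axis_def intro!: sum.neutral)
  then show ?thesis using partial_eqI[OF conv_has_derivative[OF assms]] by simp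
qed

lemma smooth_conv:
  assumes u: "locint u" and "\<phi> \<in> test_functions UNIV"
  shows "smooth (conv u \<phi>)"
proof -
  have "C_k k (conv u \<phi>)" if "\<phi> \<in> test_functions UNIV" for k \<phi>
    using that
  proof (induction k arbitrary: \<phi>)
    case 0
    have "isCont (conv u \<phi>) x" for x
      by (rule has_derivative_continuous[OF conv_has_derivative[OF u 0]])
    then show ?case by (simp add: continuous_on_eq_continuous_at)
  next
    case (Suc k)
    have "partial i (conv u \<phi>) = conv u (partial i \<phi>)" for i
      using partial_conv[OF u Suc.prems] by auto
    then show ?case using Suc conv_has_derivative[OF u Suc.prems]
      by (auto simp: differentiable_def test_functions_partial)
  qed
  with assms show ?thesis by (simp add: smooth_def)
qed

text \<open>Convolving with the constant function 1 gives the constant \<integral>\<phi>, whose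
  partial derivative is 0; but this derivative is also the convolution of 1 with the partial
  derivative of \<phi>.\<close>

lemma integral_partial_eq_0:
  assumes \<phi>: "\<phi> \<in> test_functions UNIV"
  shows "(LINT x|lborel. partial i \<phi> x) = 0"
proof -
  have l: "locint (\<lambda>x::real^'a. 1)"
    unfolding locint_def by (auto intro!: integrable_real_indicator emeasure_lborel_cball_finite[unfolded infinity_ennreal_def])
  have c: "conv (\<lambda>x. 1) \<psi> x = (LINT y|lborel. \<psi> y)" if "\<psi> \<in> test_functions UNIV" for \<psi> :: "real^'a \<Rightarrow> real" and x
    unfolding conv_def using integral_lborel_shift(3)[OF test_measurable[OF that]] by simp
  have "(LINT x|lborel. partial i \<phi> x) = conv (\<lambda>x. 1) (partial i \<phi>) 0"
    using c[OF test_functions_partial[OF \<phi>]] by simp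
  also have "\<dots> = partial i (conv (\<lambda>x. 1) \<phi>) 0"
    by (rule partial_conv[OF l \<phi>, symmetric])
  also have "conv (\<lambda>x. 1) \<phi> = (\<lambda>x. LINT y|lborel. \<phi> y)" using c[OF \<phi>] by auto
  also have "partial i \<dots> 0 = 0" by (rule partial_eqI) simp
  finally show ?thesis .
qed

subsection \<open>Mollification\<close>

text \<open>Fatou's lemma with a convergent bound. It is the way in which L^p bounds pass to limits
  below: almost everywhere convergence is enough, and integrability of the limit comes for
  free.\<close>

lemma nn_integral_le_tendsto:
  fixes f :: "'a \<Rightarrow> real"
  assumes [measurable]: "\<And>n. g n \<in> borel_measurable M"
    and lim: "AE x in M. (\<lambda>n. g n x) \<longlonglongrightarrow> f x"
    and le: "\<And>n. (\<integral>\<^sup>+x. ennreal (g n x) \<partial>M) \<le> ennreal (c n)" and c: "c \<longlonglongrightarrow> c'"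
  shows "(\<integral>\<^sup>+x. ennreal (f x) \<partial>M) \<le> ennreal c'"
proof -
  have "(\<integral>\<^sup>+x. ennreal (f x) \<partial>M) = (\<integral>\<^sup>+x. liminf (\<lambda>n. ennreal (g n x)) \<partial>M)"
  proof (rule nn_integral_cong_AE, use lim in eventually_elim)
    case (elim x)
    then have "(\<lambda>n. ennreal (g n x)) \<longlonglongrightarrow> ennreal (f x)" by (rule tendsto_ennrealI)
    then show ?case using lim_imp_Liminf sequentially_bot by metis
  qed
  also have "\<dots> \<le> liminf (\<lambda>n. \<integral>\<^sup>+x. ennreal (g n x) \<partial>M)" by (rule nn_integral_liminf) simp
  also have "\<dots> \<le> liminf (\<lambda>n. ennreal (c n))" by (intro Liminf_mono always_eventually allI le)
  also have "\<dots> = ennreal c'"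
    using tendsto_ennrealI[OF c] by (rule lim_imp_Liminf[OF sequentially_bot])
  finally show ?thesis .
qed

section \<open>Continuity of translations in L^1\<close>

definition l1shift :: "('a::euclidean_space \<Rightarrow> real) \<Rightarrow> 'a \<Rightarrow> ennreal" where
  "l1shift w z = (\<integral>\<^sup>+x. ennreal \<bar>w (x - z) - w x\<bar> \<partial>lborel)"

lemma nn_integral_abs_diff_triangle:
  fixes f g h :: "'a \<Rightarrow> real"
  assumes [measurable]: "f \<in> borel_measurable M" "g \<in> borel_measurable M" "h \<in> borel_measurable M"
  shows "(\<integral>\<^sup>+x. ennreal \<bar>f x - h x\<bar> \<partial>M) \<le> (\<integral>\<^sup>+x. ennreal \<bar>f x - g x\<bar> \<partial>M) + (\<integral>\<^sup>+x. ennreal \<bar>g x - h x\<bar> \<partial>M)"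
  by (subst nn_integral_add[symmetric])
     (auto intro!: nn_integral_mono simp: ennreal_plus[symmetric] simp del: ennreal_plus)

lemma l1shift_approx:
  assumes [measurable]: "w \<in> borel_measurable borel" "v \<in> borel_measurable borel"
  shows "l1shift w z \<le> l1shift v z + 2 * (\<integral>\<^sup>+x. ennreal \<bar>w x - v x\<bar> \<partial>lborel)"
proof -
  let ?D = "\<integral>\<^sup>+x. ennreal \<bar>w x - v x\<bar> \<partial>lborel"
  have D: "(\<integral>\<^sup>+x. ennreal \<bar>w (x - z) - v (x - z)\<bar> \<partial>lborel) = ?D"
    by (rule nn_integral_lborel_shift(2)) simp
  have D': "(\<integral>\<^sup>+x. ennreal \<bar>v x - w x\<bar> \<partial>lborel) = ?D" by (simp add: abs_minus_commute)
  have "l1shift w z \<le> ?D + (\<integral>\<^sup>+x. ennreal \<bar>v (x - z) - w x\<bar> \<partial>lborel)"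
    unfolding l1shift_def D[symmetric] by (rule nn_integral_abs_diff_triangle) auto
  also have "\<dots> \<le> ?D + (l1shift v z + ?D)"
    unfolding l1shift_def D'[symmetric]
    by (intro add_left_mono nn_integral_abs_diff_triangle) auto
  finally show ?thesis by (simp add: mult_2 add_ac)
qed

text \<open>The absolute difference of the two indicators is their sum minus twice their product, so
  only the overlap integral has to converge. Outside U the product vanishes identically, and at a
  point of the open set U the translated indicator is eventually 1; so the boundary of U causes no
  trouble.\<close>

lemma l1shift_open:
  fixes U :: "'a::euclidean_space set"
  assumes U: "open U" "emeasure lborel U < \<infinity>" and Z: "Z \<longlonglongrightarrow> 0"
  shows "(\<lambda>n. l1shift (indicator U) (Z n)) \<longlonglongrightarrow> 0"
proof -
  have [measurable]: "U \<in> sets borel" using U by simp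
  have i: "integrable lborel (indicator U :: 'a \<Rightarrow> real)"
    using U by (auto intro!: integrable_real_indicator)
  have i': "integrable lborel (\<lambda>x. indicator U (x - z) :: real)" for z
    by (rule integrable_lborel_shift(2)[OF i])
  have ii: "integrable lborel (\<lambda>x. indicator U (x - z) * indicator U x :: real)" for z
    by (rule Bochner_Integration.integrable_bound[OF i]) (auto simp: indicator_def)
  have eq: "l1shift (indicator U) z
      = ennreal (2 * measure lborel U - 2 * (LINT x|lborel. indicator U (x - z) * indicator U x))" for z
  proof -
    have "l1shift (indicator U) z = (\<integral>\<^sup>+x. ennreal (indicator U (x - z) + indicator U x - 2 * (indicator U (x - z) * indicator U x)) \<partial>lborel)"
      unfolding l1shift_def by (intro nn_integral_cong) (auto simp: indicator_def)
    also have "\<dots> = ennreal (LINT x|lborel. indicator U (x - z) + indicator U x - 2 * (indicator U (x - z) * indicator U x))"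
      using i i' ii
      by (intro nn_integral_eq_integral AE_I2 Bochner_Integration.integrable_add Bochner_Integration.integrable_diff
          integrable_mult_right) (auto split: split_indicator)
    also have "(LINT x|lborel. indicator U (x - z) + indicator U x - 2 * (indicator U (x - z) * indicator U x))
        = measure lborel U + measure lborel U - 2 * (LINT x|lborel. indicator U (x - z) * indicator U x)"
    proof -
      have "(LINT x|lborel. indicator U (x - z)) = measure lborel U"
        using integral_lborel_shift(2)[of "indicator U :: 'a \<Rightarrow> real" z] by simp
      then show ?thesis using i i' ii by simp
    qed
    finally show ?thesis by simp
  qed
  have "(\<lambda>n. LINT x|lborel. indicator U (x - Z n) * indicator U x :: real) \<longlonglongrightarrow> (LINT x|lborel. indicator U x)"
  proof (rule integral_dominated_convergence[OF _ _ i])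
    show "AE x in lborel. (\<lambda>n. indicator U (x - Z n) * indicator U x :: real) \<longlonglongrightarrow> indicator U x"
    proof (intro AE_I2)
      fix x
      show "(\<lambda>n. indicator U (x - Z n) * indicator U x :: real) \<longlonglongrightarrow> indicator U x"
      proof (cases "x \<in> U")
        case True
        have "(\<lambda>n. x - Z n) \<longlonglongrightarrow> x - 0" by (intro tendsto_intros Z)
        then have "\<forall>\<^sub>F n in sequentially. x - Z n \<in> U" using U True by (intro topological_tendstoD) auto
        then show ?thesis by (intro tendsto_eventually) (auto elim!: eventually_mono simp: True)
      qed simp
    qed
  qed (auto simp: indicator_def)
  then have "(\<lambda>n. 2 * measure lborel U - 2 * (LINT x|lborel. indicator U (x - Z n) * indicator U x)) \<longlonglongrightarrow> 2 * measure lborel U - 2 * measure lborel U"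
    by (intro tendsto_intros) simp
  from tendsto_ennrealI[OF this] show ?thesis unfolding eq by simp
qed

lemma ennreal_tendsto_0_iff_le:
  fixes f :: "nat \<Rightarrow> ennreal"
  shows "f \<longlonglongrightarrow> 0 \<longleftrightarrow> (\<forall>e>0. \<forall>\<^sub>F n in sequentially. f n \<le> ennreal e)"
proof
  assume f: "f \<longlonglongrightarrow> 0"
  show "\<forall>e>0. \<forall>\<^sub>F n in sequentially. f n \<le> ennreal e"
  proof (intro allI impI)
    fix e :: real assume "e > 0"
    then have "\<forall>\<^sub>F n in sequentially. f n < ennreal e" using f by (intro order_tendstoD) auto
    then show "\<forall>\<^sub>F n in sequentially. f n \<le> ennreal e" by (auto elim: eventually_mono)
  qed
next
  assume *: "\<forall>e>0. \<forall>\<^sub>F n in sequentially. f n \<le> ennreal e"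
  show "f \<longlonglongrightarrow> 0"
  proof (rule order_tendstoI)
    fix a :: ennreal assume "0 < a"
    then obtain e where e: "0 < ennreal e" "ennreal e < a"
      by (metis dense ennreal_enn2real infinity_ennreal_def order_less_imp_not_less top.not_eq_extremum)
    then have "\<forall>\<^sub>F n in sequentially. f n \<le> ennreal e" using * by (simp add: ennreal_less_zero_iff)
    then show "\<forall>\<^sub>F n in sequentially. f n < a" using e(2) by (auto elim!: eventually_mono)
  qed simp
qed

lemma l1shift_tendsto_0_approx:
  assumes w: "w \<in> borel_measurable borel"
    and a: "\<And>e. e > 0 \<Longrightarrow> \<exists>v \<in> borel_measurable borel. (\<lambda>n. l1shift v (Z n)) \<longlonglongrightarrow> 0 \<and>
      (\<integral>\<^sup>+x. ennreal \<bar>w x - v x\<bar> \<partial>lborel) \<le> ennreal e"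
  shows "(\<lambda>n. l1shift w (Z n)) \<longlonglongrightarrow> 0"
  unfolding ennreal_tendsto_0_iff_le
proof (intro allI impI)
  fix e :: real assume e: "e > 0"
  obtain v where v: "v \<in> borel_measurable borel" "(\<lambda>n. l1shift v (Z n)) \<longlonglongrightarrow> 0"
    "(\<integral>\<^sup>+x. ennreal \<bar>w x - v x\<bar> \<partial>lborel) \<le> ennreal (e/4)"
    using a[of "e/4"] e by auto
  have "\<forall>\<^sub>F n in sequentially. l1shift v (Z n) \<le> ennreal (e/2)"
    using v(2) e by (simp add: ennreal_tendsto_0_iff_le)
  then show "\<forall>\<^sub>F n in sequentially. l1shift w (Z n) \<le> ennreal e"
  proof eventually_elim
    case (elim n)
    have "l1shift w (Z n) \<le> l1shift v (Z n) + 2 * (\<integral>\<^sup>+x. ennreal \<bar>w x - v x\<bar> \<partial>lborel)"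
      by (rule l1shift_approx[OF w v(1)])
    also have "\<dots> \<le> ennreal (e/2) + 2 * ennreal (e/4)"
      by (intro add_mono mult_left_mono elim v(3)) auto
    also have "2 * ennreal (e/4) = ennreal (e/2)"
      using e by (simp add: ennreal_mult'[symmetric] flip: ennreal_numeral)
    also have "ennreal (e/2) + ennreal (e/2) = ennreal e"
      using e by (simp flip: ennreal_plus)
    finally show ?case .
  qed
qed

text \<open>The property is stable under approximation in L^1. Sets of finite measure are
  approximated from outside by open sets, using outer regularity, and general integrable functions
  by simple ones.\<close>

theorem l1shift_tendsto_0:
  fixes w :: "'a::euclidean_space \<Rightarrow> real"
  assumes "integrable lborel w" and Z: "Z \<longlonglongrightarrow> 0"
  shows "(\<lambda>n. l1shift w (Z n)) \<longlonglongrightarrow> 0"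
  using assms(1)
proof (induction w rule: integrable_induct)
  case (base A c)
  have A[measurable]: "A \<in> sets borel" and Afin: "emeasure lborel A < \<infinity>" using base by auto
  show ?case
  proof (rule l1shift_tendsto_0_approx)
    fix e :: real assume e: "e > 0"
    \<comment> \<open>The added 1 keeps k positive when c = 0, so that e / k makes sense.\<close>
    define k where "k = \<bar>c\<bar> + 1"
    have k: "k > 0" "\<bar>c\<bar> \<le> k" by (auto simp: k_def)
    obtain U where U: "open U" "A \<subseteq> U" "emeasure lborel (U - A) < ennreal (e / k)"
      using outer_regular_lborel[OF A, of "e / k"] e k by auto
    have [measurable]: "U \<in> sets borel" using U by simp
    have "emeasure lborel U \<le> emeasure lborel A + emeasure lborel (U - A)"
      using emeasure_subadditive[of A lborel "U - A"] U(2) by (simp add: Un_absorb1)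
    also have "\<dots> < \<infinity>" using U(3) Afin by (auto simp: less_top[symmetric])
    finally have "emeasure lborel U < \<infinity>" .
    from l1shift_open[OF U(1) this Z] have o: "(\<lambda>n. l1shift (indicator U) (Z n)) \<longlonglongrightarrow> 0" .
    have s: "l1shift (\<lambda>x. indicator U x * c) z = ennreal \<bar>c\<bar> * l1shift (indicator U) z" for z
      unfolding l1shift_def
      by (subst nn_integral_cmult[symmetric])
         (auto simp: ennreal_mult[symmetric] abs_mult[symmetric] algebra_simps intro!: nn_integral_cong)
    show "\<exists>v\<in>borel_measurable borel. (\<lambda>n. l1shift v (Z n)) \<longlonglongrightarrow> 0 \<and>
      (\<integral>\<^sup>+x. ennreal \<bar>indicator A x *\<^sub>R c - v x\<bar> \<partial>lborel) \<le> ennreal e"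
    proof (intro bexI[of _ "\<lambda>x. indicator U x * c"] conjI)
      have "(\<lambda>n. ennreal \<bar>c\<bar> * l1shift (indicator U) (Z n)) \<longlonglongrightarrow> ennreal \<bar>c\<bar> * 0"
        by (intro ennreal_tendsto_cmult o) auto
      then show "(\<lambda>n. l1shift (\<lambda>x. indicator U x * c) (Z n)) \<longlonglongrightarrow> 0" by (simp add: s)
      have "(\<integral>\<^sup>+x. ennreal \<bar>indicator A x *\<^sub>R c - indicator U x * c\<bar> \<partial>lborel)
          = (\<integral>\<^sup>+x. ennreal \<bar>c\<bar> * indicator (U - A) x \<partial>lborel)"
        using U(2) by (intro nn_integral_cong) (auto simp: indicator_def)
      also have "\<dots> = ennreal \<bar>c\<bar> * emeasure lborel (U - A)"
        by (rule nn_integral_cmult_indicator) simp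
      also have "\<dots> \<le> ennreal k * ennreal (e / k)"
        using U(3) k by (intro mult_mono ennreal_leI) auto
      also have "\<dots> = ennreal e" using k e by (simp add: ennreal_mult[symmetric])
      finally show "(\<integral>\<^sup>+x. ennreal \<bar>indicator A x *\<^sub>R c - indicator U x * c\<bar> \<partial>lborel) \<le> ennreal e" .
    qed simp
  qed simp
next
  case (add f g)
  have [measurable]: "f \<in> borel_measurable borel" "g \<in> borel_measurable borel"
    using add(1,2) by (auto dest: borel_measurable_integrable)
  have "(\<lambda>n. l1shift f (Z n) + l1shift g (Z n)) \<longlonglongrightarrow> 0 + 0"
    by (intro tendsto_add add.IH)
  moreover have "l1shift (\<lambda>x. f x + g x) z \<le> l1shift f z + l1shift g z" for z
    unfolding l1shift_def
    by (subst nn_integral_add[symmetric])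
       (auto intro!: nn_integral_mono simp: ennreal_plus[symmetric] simp del: ennreal_plus)
  ultimately show ?case
    using tendsto_sandwich[where f = "\<lambda>_. 0" and c = "0::ennreal" and net = sequentially
        and g = "\<lambda>n. l1shift (\<lambda>x. f x + g x) (Z n)" and h = "\<lambda>n. l1shift f (Z n) + l1shift g (Z n)"] by simp
next
  case (lim f s)
  show ?case
  proof (rule l1shift_tendsto_0_approx)
    show "f \<in> borel_measurable borel" using lim by (auto dest: borel_measurable_integrable)
    fix e :: real assume e: "e > 0"
    have "(\<lambda>i. LINT x|lborel. norm (f x - s i x)) \<longlonglongrightarrow> (LINT x|(lborel::'a measure). 0)"
    proof (rule integral_dominated_convergence)
      \<comment> \<open>The induction rule provides approximants bounded by 2 |f|, whence the factor
        3 = 1 + 2 for their distance from f.\<close>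
      show "integrable lborel (\<lambda>x. 3 * norm (f x))" using lim(4) by auto
      show "AE x in lborel. (\<lambda>i. norm (f x - s i x)) \<longlonglongrightarrow> 0"
      proof (intro AE_I2)
        fix x :: 'a
        have "(\<lambda>i. norm (f x - s i x)) \<longlonglongrightarrow> norm (f x - f x)" using lim(2) by (intro tendsto_intros) auto
        then show "(\<lambda>i. norm (f x - s i x)) \<longlonglongrightarrow> 0" by simp
      qed
      have "norm (norm (f x - s i x)) \<le> 3 * norm (f x)" for i x
        using lim(3)[of x i] by (simp add: norm_triangle_le_diff)
      then show "AE x in lborel. norm (norm (f x - s i x)) \<le> 3 * norm (f x)" for i by simp
    qed (use lim(1,4) in auto)
    then have "\<forall>\<^sub>F i in sequentially. (LINT x|lborel. norm (f x - s i x)) < e"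
      using e by (intro order_tendstoD) auto
    then obtain i where i: "(LINT x|lborel. norm (f x - s i x)) < e"
      by (auto simp: eventually_sequentially)
    have "(\<integral>\<^sup>+x. ennreal \<bar>f x - s i x\<bar> \<partial>lborel) = ennreal (LINT x|lborel. \<bar>f x - s i x\<bar>)"
      using lim by (intro nn_integral_eq_integral) auto
    also have "\<dots> \<le> ennreal e" using i by (intro ennreal_leI) simp
    finally show "\<exists>v\<in>borel_measurable borel. (\<lambda>n. l1shift v (Z n)) \<longlonglongrightarrow> 0 \<and> (\<integral>\<^sup>+x. ennreal \<bar>f x - v x\<bar> \<partial>lborel) \<le> ennreal e"
      using lim(1)[of i] lim(5)[of i] by (intro bexI[of _ "s i"]) (auto dest: borel_measurable_integrable)
  qed
qed

lemma l1shift_small: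
  fixes w :: "'a::euclidean_space \<Rightarrow> real"
  assumes w: "integrable lborel w" and e: "e > 0"
  obtains d where "d > 0" "\<And>z. norm z < d \<Longrightarrow> l1shift w z \<le> ennreal e"
proof (rule ccontr)
  assume "\<not> thesis"
  with that have "\<exists>z. norm z < 1 / real (Suc n) \<and> \<not> l1shift w z \<le> ennreal e" for n
    by (metis of_nat_0_less_iff zero_less_Suc zero_less_divide_1_iff)
  then obtain Z where Z: "\<And>n. norm (Z n) < 1 / real (Suc n)" "\<And>n. \<not> l1shift w (Z n) \<le> ennreal e" by metis
  have "Z \<longlonglongrightarrow> 0"
    by (rule Lim_null_comparison[OF _ LIMSEQ_inverse_real_of_nat])
       (use Z(1) in \<open>auto simp: inverse_eq_divide less_imp_le simp del: of_nat_Suc\<close>)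
  from l1shift_tendsto_0[OF w this] e have "\<forall>\<^sub>F n in sequentially. l1shift w (Z n) \<le> ennreal e"
    by (simp add: ennreal_tendsto_0_iff_le)
  with Z(2) show False by (auto simp: eventually_sequentially)
qed

lemma mollifier_exists:
  assumes "e > (0::real)"
  obtains \<phi> :: "real^'n \<Rightarrow> real" where "\<phi> \<in> test_functions UNIV" "\<And>x. \<phi> x \<ge> 0"
    "\<And>x. norm x \<ge> e \<Longrightarrow> \<phi> x = 0" "(LINT x|lborel. \<phi> x) = 1"
proof -
  define f where "f x = bump (e\<^sup>2 + (-1) * (x \<bullet> x))" for x :: "real^'n"
  have sm: "smooth f" unfolding f_def
    by (intro smooth_compose[OF smooth1_bump] smooth_add smooth_mult smooth_const smooth_inner_self)
  have f0: "f x = 0 \<longleftrightarrow> norm x \<ge> e" for x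
    using assms by (simp add: f_def bump_eq_0_iff power2_norm_eq_inner[symmetric] power2_le_iff_abs_le abs_le_square_iff[symmetric])
  have t: "f \<in> test_functions UNIV" by (rule test_functionsI[OF sm, of e]) (simp add: f0)
  define Z where "Z = (LINT x|lborel. f x)"
  have "Z > 0"
  proof -
    have fi: "integrable lborel f" by (rule test_integrable[OF t])
    have fn: "f x \<ge> 0" for x by (simp add: f_def bump_nonneg)
    have "Z \<noteq> 0"
    proof
      assume "Z = 0"
      then have "AE x::real^'n in lborel. f x = 0"
        using integral_nonneg_eq_0_iff_AE[OF fi] fn by (simp add: Z_def)
      then have "AE x::real^'n in lborel. x \<notin> ball 0 e" by (auto simp: f0 not_less elim: eventually_mono)
      then have "emeasure lborel (ball (0::real^'n) e) = 0"
        by (subst (asm) AE_iff_measurable[of "ball 0 e"]) auto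
      with assms show False by (simp add: emeasure_ball unit_ball_vol_pos less_imp_neq[symmetric])
    qed
    moreover have "Z \<ge> 0" unfolding Z_def by (rule Bochner_Integration.integral_nonneg) (simp add: fn)
    ultimately show ?thesis by simp
  qed
  show ?thesis
  proof (rule that[of "\<lambda>x. (1/Z) * f x"])
    show "(\<lambda>x. (1/Z) * f x) \<in> test_functions UNIV" by (rule test_functions_mult[OF t smooth_const])
    show "(1/Z) * f x \<ge> 0" for x using \<open>Z > 0\<close> by (simp add: f_def bump_nonneg)
    show "(LINT x|lborel. (1/Z) * f x) = 1"
      using \<open>Z > 0\<close> by (subst integral_mult_right_zero) (simp add: Z_def)
  qed (auto simp: f0)
qed

text \<open>Since \<phi> has integral 1, \<open>conv w \<phi> x - w x\<close> is the \<phi>-average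
  of w(x - z) - w(x). After Tonelli the bound is the \<phi>-average of \<open>l1shift w z\<close>,
  and only z with norm below d contribute.\<close>

lemma conv_l1_le:
  fixes w \<phi> :: "real^'n \<Rightarrow> real"
  assumes w: "integrable lborel w" and \<phi>: "\<phi> \<in> test_functions UNIV" "\<And>x. \<phi> x \<ge> 0"
    "(LINT x|lborel. \<phi> x) = 1" "\<And>x. norm x \<ge> d \<Longrightarrow> \<phi> x = 0"
    and e: "\<And>z. norm z < d \<Longrightarrow> l1shift w z \<le> ennreal e"
  shows "(\<integral>\<^sup>+x. ennreal \<bar>conv w \<phi> x - w x\<bar> \<partial>lborel) \<le> ennreal e"
proof -
  have l: "locint w" unfolding locint_def
    using integrable_mult_indicator[OF _ w] by (auto simp: real_scaleR_def)
  have [measurable]: "w \<in> borel_measurable borel" by (rule locint_measurable[OF l])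
  have [measurable]: "\<phi> \<in> borel_measurable borel" by (rule test_measurable[OF \<phi>(1)])
  have i\<phi>: "integrable lborel \<phi>" by (rule test_integrable[OF \<phi>(1)])
  have pw: "ennreal \<bar>conv w \<phi> x - w x\<bar> \<le> (\<integral>\<^sup>+z. ennreal (\<phi> z) * ennreal \<bar>w (x - z) - w x\<bar> \<partial>lborel)" for x
  proof -
    have i: "integrable lborel (\<lambda>z. w (x - z) * \<phi> z)"
      using integrable_lborel_shift(3)[OF conv_integrable[OF l \<phi>(1), of x], of x] by simp
    have "conv w \<phi> x = (LINT z|lborel. w (x - z) * \<phi> z)"
      unfolding conv_def using integral_lborel_shift(3)[of "\<lambda>y. w y * \<phi> (x - y)" x] by simp
    then have "conv w \<phi> x - w x = (LINT z|lborel. w (x - z) * \<phi> z - w x * \<phi> z)"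
      using i i\<phi> \<phi>(3) by simp
    also have "\<bar>\<dots>\<bar> \<le> (LINT z|lborel. \<bar>w (x - z) * \<phi> z - w x * \<phi> z\<bar>)" by (rule integral_abs_bound)
    also have "ennreal \<dots> = (\<integral>\<^sup>+z. ennreal \<bar>w (x - z) * \<phi> z - w x * \<phi> z\<bar> \<partial>lborel)"
      using i i\<phi> by (intro nn_integral_eq_integral[symmetric]) auto
    also have "\<dots> = (\<integral>\<^sup>+z. ennreal (\<phi> z) * ennreal \<bar>w (x - z) - w x\<bar> \<partial>lborel)"
    proof (rule nn_integral_cong)
      fix z
      have "\<bar>w (x - z) * \<phi> z - w x * \<phi> z\<bar> = \<phi> z * \<bar>w (x - z) - w x\<bar>"
        using \<phi>(2)[of z] abs_mult[of "\<phi> z" "w (x - z) - w x"] by (simp add: algebra_simps)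
      then show "ennreal \<bar>w (x - z) * \<phi> z - w x * \<phi> z\<bar> = ennreal (\<phi> z) * ennreal \<bar>w (x - z) - w x\<bar>"
        using \<phi>(2)[of z] by (simp add: ennreal_mult)
    qed
    finally show ?thesis by (simp add: ennreal_leI)
  qed
  have "(\<integral>\<^sup>+x. ennreal \<bar>conv w \<phi> x - w x\<bar> \<partial>lborel)
      \<le> (\<integral>\<^sup>+x. (\<integral>\<^sup>+z. ennreal (\<phi> z) * ennreal \<bar>w (x - z) - w x\<bar> \<partial>lborel) \<partial>lborel)"
    by (intro nn_integral_mono pw)
  also have "\<dots> = (\<integral>\<^sup>+z. (\<integral>\<^sup>+x. ennreal (\<phi> z) * ennreal \<bar>w (x - z) - w x\<bar> \<partial>lborel) \<partial>lborel)"
    by (rule lborel_pair.Fubini') (simp add: split_beta')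
  also have "\<dots> = (\<integral>\<^sup>+z. ennreal (\<phi> z) * l1shift w z \<partial>lborel)"
    by (simp add: nn_integral_cmult l1shift_def)
  also have "\<dots> \<le> (\<integral>\<^sup>+z. ennreal (\<phi> z) * ennreal e \<partial>lborel)"
    using e \<phi>(4) by (intro nn_integral_mono) (metis linorder_not_le mult_left_mono ennreal_0 mult_zero_left zero_le)
  also have "\<dots> = ennreal e * (\<integral>\<^sup>+z. ennreal (\<phi> z) \<partial>lborel)" by (simp add: mult.commute[of _ "ennreal e"] nn_integral_cmult)
  also have "(\<integral>\<^sup>+z. ennreal (\<phi> z) \<partial>lborel) = 1"
    using nn_integral_eq_integral[OF i\<phi>] \<phi>(2,3) by simp
  finally show ?thesis by simp
qed

text \<open>Jensen's inequality for the probability density \<phi>(x - y), obtained pointwise from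
  the nonnegative variance of u around its mean \<open>conv u \<phi> x\<close>. Tonelli then removes
  the density.\<close>

lemma conv_sq_le:
  fixes u \<phi> :: "real^'n \<Rightarrow> real"
  assumes u: "locint u" "integrable lborel (\<lambda>x. (u x)\<^sup>2)"
    and \<phi>: "\<phi> \<in> test_functions UNIV" "\<And>x. \<phi> x \<ge> 0" "(LINT x|lborel. \<phi> x) = 1"
  shows "(\<integral>\<^sup>+x. ennreal ((conv u \<phi> x)\<^sup>2) \<partial>lborel) \<le> ennreal (LINT x|lborel. (u x)\<^sup>2)"
proof -
  have l2: "locint (\<lambda>x. (u x)\<^sup>2)" unfolding locint_def
    using integrable_mult_indicator[OF _ u(2)] by (auto simp: real_scaleR_def)
  have [measurable]: "u \<in> borel_measurable borel" by (rule locint_measurable[OF u(1)])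
  have [measurable]: "\<phi> \<in> borel_measurable borel" by (rule test_measurable[OF \<phi>(1)])
  have i\<phi>: "integrable lborel \<phi>" by (rule test_integrable[OF \<phi>(1)])
  have pw: "ennreal ((conv u \<phi> x)\<^sup>2) \<le> (\<integral>\<^sup>+y. ennreal ((u y)\<^sup>2) * ennreal (\<phi> (x - y)) \<partial>lborel)" for x
  proof -
    note i = conv_integrable[OF u(1) \<phi>(1), of x] conv_integrable[OF l2 \<phi>(1), of x]
      integrable_lborel_shift(3)[OF i\<phi>, of x]
    define c where "c = conv u \<phi> x"
    have "0 \<le> (LINT y|lborel. (u y - c)\<^sup>2 * \<phi> (x - y))"
      by (rule Bochner_Integration.integral_nonneg) (use \<phi>(2) in auto)
    also have "\<dots> = (LINT y|lborel. (u y)\<^sup>2 * \<phi> (x - y) - 2 * c * (u y * \<phi> (x - y)) + c\<^sup>2 * \<phi> (x - y))"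
      by (simp add: power2_diff algebra_simps)
    also have "\<dots> = (LINT y|lborel. (u y)\<^sup>2 * \<phi> (x - y)) - 2 * c * c + c\<^sup>2 * 1"
      using i \<phi>(3) integral_lborel_shift(3)[of \<phi> x] by (simp add: c_def conv_def)
    finally have "c\<^sup>2 \<le> (LINT y|lborel. (u y)\<^sup>2 * \<phi> (x - y))" by (simp add: power2_eq_square)
    then have "ennreal (c\<^sup>2) \<le> ennreal (LINT y|lborel. (u y)\<^sup>2 * \<phi> (x - y))" by (rule ennreal_leI)
    also have "\<dots> = (\<integral>\<^sup>+y. ennreal ((u y)\<^sup>2 * \<phi> (x - y)) \<partial>lborel)"
      using i(2) \<phi>(2) by (intro nn_integral_eq_integral[symmetric]) auto
    finally show ?thesis using \<phi>(2) by (simp add: c_def ennreal_mult)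
  qed
  have "(\<integral>\<^sup>+x. ennreal ((conv u \<phi> x)\<^sup>2) \<partial>lborel)
      \<le> (\<integral>\<^sup>+x. (\<integral>\<^sup>+y. ennreal ((u y)\<^sup>2) * ennreal (\<phi> (x - y)) \<partial>lborel) \<partial>lborel)"
    by (intro nn_integral_mono pw)
  also have "\<dots> = (\<integral>\<^sup>+y. (\<integral>\<^sup>+x. ennreal ((u y)\<^sup>2) * ennreal (\<phi> (x - y)) \<partial>lborel) \<partial>lborel)"
    by (rule lborel_pair.Fubini') (simp add: split_beta')
  also have "\<dots> = (\<integral>\<^sup>+y. ennreal ((u y)\<^sup>2) * (\<integral>\<^sup>+x. ennreal (\<phi> x) \<partial>lborel) \<partial>lborel)"
    using nn_integral_lborel_shift(2)[of "\<lambda>x. ennreal (\<phi> x)"] by (simp add: nn_integral_cmult)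
  also have "(\<integral>\<^sup>+z. ennreal (\<phi> z) \<partial>lborel) = 1"
    using nn_integral_eq_integral[OF i\<phi>] \<phi>(2,3) by simp
  finally show ?thesis using nn_integral_eq_integral[OF u(2)] by simp
qed

section \<open>From test functions to H^1\<close>

lemma grad_mult:
  fixes u v :: "real^'n \<Rightarrow> real"
  assumes "u differentiable (at x)" "v differentiable (at x)"
  shows "grad (\<lambda>x. u x * v x) x = u x *\<^sub>R grad v x + v x *\<^sub>R grad u x"
  by (simp add: vec_eq_iff grad_def partial_mult[OF assms])

lemma grad_affine:
  fixes u :: "real^'n \<Rightarrow> real"
  assumes "u differentiable (at (c *\<^sub>R x + z))"
  shows "grad (\<lambda>x. u (c *\<^sub>R x + z)) x = c *\<^sub>R grad u (c *\<^sub>R x + z)"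
  by (simp add: vec_eq_iff grad_def partial_affine[OF assms])

text \<open>The nonnegative integral makes \<open>\<bar>u\<bar> powr p\<close> being integrable part of the inequality.\<close>

definition gn_ineq :: "real \<Rightarrow> real \<Rightarrow> real \<Rightarrow> (real^'n \<Rightarrow> real) \<Rightarrow> (real^'n \<Rightarrow> real^'n) \<Rightarrow> bool" where
  "gn_ineq C p t u G \<longleftrightarrow> (\<integral>\<^sup>+x. ennreal (\<bar>u x\<bar> powr p) \<partial>lborel)
    \<le> ennreal ((C * ((LINT x|lborel. (norm (G x))\<^sup>2) powr t * (LINT x|lborel. (u x)\<^sup>2) powr (1 - t))) powr (p/2))"

lemma smooth_cutoff:
  obtains \<eta> :: "real^'n \<Rightarrow> real" where "\<eta> \<in> test_functions UNIV" "\<And>x. 0 \<le> \<eta> x \<and> \<eta> x \<le> 1" "\<eta> 0 = 1"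
proof (rule that[of "\<lambda>x. (1 / bump 1) * bump (1 + (-1) * (x \<bullet> x))"])
  have p: "bump 1 > 0" by (simp add: bump_pos_iff)
  have sm: "smooth (\<lambda>x::real^'n. bump (1 + (-1) * (x \<bullet> x)))"
    by (intro smooth_compose[OF smooth1_bump] smooth_add smooth_mult smooth_const smooth_inner_self)
  have "bump (1 + (-1) * (x \<bullet> x)) = 0" if "1 < norm x" for x :: "real^'n"
    using that by (simp add: bump_eq_0_iff power2_norm_eq_inner[symmetric])
  then show "(\<lambda>x::real^'n. (1 / bump 1) * bump (1 + (-1) * (x \<bullet> x))) \<in> test_functions UNIV"
    by (intro test_functions_mult[OF _ smooth_const] test_functionsI[OF sm, of 1]) auto
  show "0 \<le> (1 / bump 1) * bump (1 + (-1) * (x \<bullet> x)) \<and> (1 / bump 1) * bump (1 + (-1) * (x \<bullet> x)) \<le> 1" for x :: "real^'n"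
    using p bump_mono[of "1 - x \<bullet> x" 1] by (simp add: bump_nonneg)
  show "(1 / bump 1) * bump (1 + (-1) * ((0::real^'n) \<bullet> 0)) = 1" using p by simp
qed

lemma sq_sum_le:
  fixes a b e :: real
  assumes "e > 0"
  shows "(a + b)\<^sup>2 \<le> (1 + e) * a\<^sup>2 + (1 + 1/e) * b\<^sup>2"
proof -
  have "0 \<le> (e * a - b)\<^sup>2 / e" using assms by simp
  then show ?thesis using assms by (simp add: power2_eq_square field_simps)
qed

text \<open>Multiply v by the dilated cutoffs \<eta>(c x) with c tending to 0. The cutoff does not
  increase the L^2 norm and contributes only O(c) to the gradient, while the L^p integrals are
  controlled in the limit by Fatou.\<close>

lemma gn_ineq_smooth:
  fixes v :: "real^'n \<Rightarrow> real"
  assumes test: "\<And>w::real^'n \<Rightarrow> real. w \<in> test_functions UNIV \<Longrightarrow> gn_ineq C p t w (grad w)"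
    and C: "C \<ge> 0" and t: "0 < t" "t < 1" and p: "p > 0"
    and v: "smooth v" "integrable lborel (\<lambda>x. (v x)\<^sup>2)" "integrable lborel (\<lambda>x. (norm (grad v x))\<^sup>2)"
  shows "gn_ineq C p t v (grad v)"
proof -
  obtain \<eta> :: "real^'n \<Rightarrow> real" where \<eta>: "\<eta> \<in> test_functions UNIV" "\<And>x. 0 \<le> \<eta> x \<and> \<eta> x \<le> 1" "\<eta> 0 = 1"
    by (rule smooth_cutoff) blast
  obtain L where L: "L > 0" "\<And>x. norm (grad \<eta> x) \<le> L" using test_grad_bounded[OF \<eta>(1)] by blast
  have [measurable]: "v \<in> borel_measurable borel" "grad v \<in> borel_measurable borel" "\<eta> \<in> borel_measurable borel"
    using v \<eta> by (auto intro: smooth_measurable grad_measurable test_measurable)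
  define A B where "A = (LINT x|lborel. (norm (grad v x))\<^sup>2)" and "B = (LINT x|lborel. (v x)\<^sup>2)"
  have AB: "A \<ge> 0" "B \<ge> 0" unfolding A_def B_def by (auto intro!: Bochner_Integration.integral_nonneg)
  define c where "c n = 1 / real (Suc n)" for n
  have c: "c n > 0" "c n \<le> 1" for n by (auto simp: c_def)
  define w where "w n x = \<eta> (c n *\<^sub>R x + 0) * v x" for n x
  have \<eta>c: "(\<lambda>x. \<eta> (c n *\<^sub>R x + 0)) \<in> test_functions UNIV" for n
    using c[of n] by (intro test_functions_affine \<eta>) auto
  have w: "w n \<in> test_functions UNIV" for n
    using test_functions_mult[OF \<eta>c v(1), of n] by (simp add: w_def[abs_def] mult.commute)
  have wle: "(w n x)\<^sup>2 \<le> (v x)\<^sup>2" for n x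
    using \<eta>(2)[of "c n *\<^sub>R x + 0"] by (simp add: w_def power_mult_distrib mult_left_le_one_le power_le_one)
  have wB: "(LINT x|lborel. (w n x)\<^sup>2) \<le> B" for n
    unfolding B_def by (rule integral_mono_AE') (use wle v in auto)
  \<comment> \<open>\<open>sq_sum_le\<close> is used with weight c n itself: the main term is then
    multiplied by 1 + c n, and the error (1 + 1 / c n) (L c n)^2 B is still of order c n.\<close>
  define A' where "A' n = (1 + c n) * A + (1 + 1 / c n) * (L * c n)\<^sup>2 * B" for n
  have wA: "(LINT x|lborel. (norm (grad (w n) x))\<^sup>2) \<le> A' n" for n
  proof -
    have "(norm (grad (w n) x))\<^sup>2 \<le> (1 + c n) * (norm (grad v x))\<^sup>2 + (1 + 1 / c n) * (L * c n)\<^sup>2 * (v x)\<^sup>2" for x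
    proof -
      have d: "\<eta> differentiable (at y)" "(\<lambda>x. \<eta> (c n *\<^sub>R x + 0)) differentiable (at y)" "v differentiable (at y)" for y
        using \<eta>c[of n] \<eta> v by (auto simp: test_functions_def intro: smooth_differentiable)
      have "norm (grad (w n) x) = norm (\<eta> (c n *\<^sub>R x + 0) *\<^sub>R grad v x + (c n * v x) *\<^sub>R grad \<eta> (c n *\<^sub>R x + 0))"
        unfolding w_def[abs_def] by (simp only: grad_mult[OF d(2,3)] grad_affine[OF d(1)] scaleR_scaleR mult.commute[of "v x"])
      also have "\<dots> \<le> \<bar>\<eta> (c n *\<^sub>R x + 0)\<bar> * norm (grad v x) + c n * \<bar>v x\<bar> * norm (grad \<eta> (c n *\<^sub>R x + 0))"
        using norm_triangle_ineq[of "\<eta> (c n *\<^sub>R x + 0) *\<^sub>R grad v x" "(c n * v x) *\<^sub>R grad \<eta> (c n *\<^sub>R x + 0)"] c[of n]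
        by (simp add: abs_mult)
      also have "\<dots> \<le> 1 * norm (grad v x) + c n * \<bar>v x\<bar> * L"
        using \<eta>(2)[of "c n *\<^sub>R x + 0"] L(2)[of "c n *\<^sub>R x + 0"] c[of n]
        by (intro add_mono mult_mono mult_nonneg_nonneg) auto
      finally have "(norm (grad (w n) x))\<^sup>2 \<le> (norm (grad v x) + L * c n * \<bar>v x\<bar>)\<^sup>2"
        by (intro power_mono) (auto simp: mult_ac)
      also have "\<dots> \<le> (1 + c n) * (norm (grad v x))\<^sup>2 + (1 + 1 / c n) * (L * c n * \<bar>v x\<bar>)\<^sup>2"
        by (rule sq_sum_le[OF c(1)])
      finally show ?thesis by (simp add: power_mult_distrib mult_ac)
    qed
    then have "(LINT x|lborel. (norm (grad (w n) x))\<^sup>2)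
        \<le> (LINT x|lborel. (1 + c n) * (norm (grad v x))\<^sup>2 + (1 + 1 / c n) * (L * c n)\<^sup>2 * (v x)\<^sup>2)"
      using v c[of n] by (intro integral_mono_AE') auto
    also have "\<dots> = A' n" using v by (simp add: A'_def A_def B_def)
    finally show ?thesis .
  qed
  have c0: "c \<longlonglongrightarrow> 0" unfolding c_def using LIMSEQ_inverse_real_of_nat by (simp add: inverse_eq_divide)
  have A'lim: "A' \<longlonglongrightarrow> A"
  proof -
    have "A' = (\<lambda>n. (1 + c n) * A + (c n + 1) * c n * L\<^sup>2 * B)"
      using c(1) by (auto simp: A'_def power2_eq_square field_simps order.strict_implies_not_eq[symmetric])
    moreover have "(\<lambda>n. (1 + c n) * A + (c n + 1) * c n * L\<^sup>2 * B) \<longlonglongrightarrow> (1 + 0) * A + (0 + 1) * 0 * L\<^sup>2 * B"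
      by (intro tendsto_intros c0)
    ultimately show ?thesis by simp
  qed
  have A'0: "A' n \<ge> 0" for n using AB c[of n] L by (simp add: A'_def)
  show ?thesis unfolding gn_ineq_def A_def[symmetric] B_def[symmetric]
  proof (rule nn_integral_le_tendsto[where g = "\<lambda>n x. \<bar>w n x\<bar> powr p"])
    show "(\<lambda>x. \<bar>w n x\<bar> powr p) \<in> borel_measurable lborel" for n unfolding w_def by measurable
    show "AE x in lborel. (\<lambda>n. \<bar>w n x\<bar> powr p) \<longlonglongrightarrow> \<bar>v x\<bar> powr p"
    proof (intro AE_I2 tendsto_powr' tendsto_intros)
      fix x
      have "(\<lambda>n. \<eta> (c n *\<^sub>R x + 0)) \<longlonglongrightarrow> \<eta> (0 *\<^sub>R x + 0)"
      proof (rule isCont_tendsto_compose[where g = \<eta>])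
        show "isCont \<eta> (0 *\<^sub>R x + 0)"
          using \<eta>(1) by (metis continuous_on_eq_continuous_at open_UNIV UNIV_I smooth_continuous test_functions_iff)
      qed (intro tendsto_intros c0)
      then have "(\<lambda>n. \<eta> (c n *\<^sub>R x + 0) * v x) \<longlonglongrightarrow> 1 * v x" using \<eta>(3) by (intro tendsto_intros) simp
      then show "(\<lambda>n. w n x) \<longlonglongrightarrow> v x" by (simp add: w_def)
    qed (use p in auto)
    show "(\<integral>\<^sup>+x. ennreal (\<bar>w n x\<bar> powr p) \<partial>lborel) \<le> ennreal ((C * (A' n powr t * B powr (1 - t))) powr (p/2))" for n
    proof (rule order_trans[OF test[OF w, unfolded gn_ineq_def]])
      show "ennreal ((C * ((LINT x|lborel. (norm (grad (w n) x))\<^sup>2) powr t * (LINT x|lborel. (w n x)\<^sup>2) powr (1 - t))) powr (p / 2))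
        \<le> ennreal ((C * (A' n powr t * B powr (1 - t))) powr (p / 2))"
        using C p t wA[of n] wB[of n]
        by (intro ennreal_leI powr_mono2 mult_left_mono mult_mono)
           (auto intro!: Bochner_Integration.integral_nonneg mult_nonneg_nonneg)
    qed
    show "(\<lambda>n. (C * (A' n powr t * B powr (1 - t))) powr (p/2)) \<longlonglongrightarrow> (C * (A powr t * B powr (1 - t))) powr (p/2)"
      using A'0 t p C AB by (intro tendsto_powr' tendsto_intros A'lim) (auto intro!: always_eventually)
  qed
qed

text \<open>The weak derivative is tested against y \<mapsto> \<phi>(x - y). The reflection changes
  the sign of its partial derivatives, which cancels the sign in the definition of
  \<open>H1\<close>.\<close>

lemma H1_conv:
  fixes u :: "real^'n \<Rightarrow> real"
  assumes u: "locint u" "\<And>i. locint (\<lambda>x. G x $ i)" "H1 u G" and \<phi>: "\<phi> \<in> test_functions UNIV"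
  shows "grad (conv u \<phi>) x = (\<chi> i. conv (\<lambda>x. G x $ i) \<phi> x)"
proof -
  have "partial i (conv u \<phi>) x = conv (\<lambda>x. G x $ i) \<phi> x" for i
  proof -
    define \<psi> where "\<psi> y = \<phi> ((-1) *\<^sub>R y + x)" for y
    have \<psi>: "\<psi> \<in> test_functions UNIV" unfolding \<psi>_def by (intro test_functions_affine \<phi>) simp
    have d: "\<phi> differentiable (at y)" for y using \<phi> by (auto simp: test_functions_def intro: smooth_differentiable)
    have p: "partial i \<psi> y = - partial i \<phi> (x - y)" for y
      unfolding \<psi>_def using partial_affine(2)[OF d, where c = "-1" and x = y and z = x and i = i] by simp
    have "partial i (conv u \<phi>) x = (LINT y|lborel. u y * partial i \<phi> (x - y))"
      using partial_conv[OF u(1) \<phi>] by (simp add: conv_def)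
    also have "\<dots> = - (LINT y|lborel. u y * partial i \<psi> y)" by (simp add: p)
    also have "\<dots> = (LINT y|lborel. G y $ i * \<psi> y)" using u(3) \<psi> by (simp add: H1_def)
    finally show ?thesis by (simp add: conv_def \<psi>_def)
  qed
  then show ?thesis by (simp add: grad_def)
qed

lemma locint_sq:
  fixes u :: "real^'n \<Rightarrow> real"
  assumes [measurable]: "u \<in> borel_measurable borel" and "integrable lborel (\<lambda>x. (u x)\<^sup>2)"
  shows "locint u"
  unfolding locint_def
proof
  fix R
  show "integrable lborel (\<lambda>x. indicator (cball 0 R) x * u x)"
  proof (rule Bochner_Integration.integrable_bound)
    show "integrable lborel (\<lambda>x. indicator (cball (0::real^'n) R) x + (u x)\<^sup>2)"
      using assms(2) emeasure_lborel_cball_finite[of "0::real^'n" R]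
      by (intro Bochner_Integration.integrable_add integrable_real_indicator) auto
    have "\<bar>u x\<bar> \<le> 1 + (u x)\<^sup>2" for x
      using zero_le_power2[of "\<bar>u x\<bar> - 1"] by (simp add: power2_diff)
    then show "AE x in lborel. norm (indicator (cball 0 R) x * u x) \<le> norm (indicator (cball 0 R) x + (u x)\<^sup>2)"
      by (auto simp: indicator_def)
    show "(\<lambda>x. indicator (cball 0 R) x * u x) \<in> borel_measurable lborel"
      using assms(1) by (intro borel_measurable_times borel_measurable_indicator) auto
  qed
qed

lemma norm_vec_sq: "(norm (v::real^'n))\<^sup>2 = (\<Sum>i\<in>UNIV. (v $ i)\<^sup>2)"
  unfolding power2_norm_eq_inner inner_vec_def by (simp add: power2_eq_square)

lemma in_Lp_2_iff: "in_Lp 2 f \<longleftrightarrow> f \<in> borel_measurable borel \<and> integrable lborel (\<lambda>x. (norm (f x))\<^sup>2)"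
  by (simp add: in_Lp_def)

text \<open>Mollification increases neither L^2 norm, so the smooth case bounds the L^p integrals of
  all mollifications of u by the same number K. It remains to make mollifications converge almost
  everywhere, first on balls, and to let the radius grow.\<close>

theorem gn_ineq_H1:
  fixes u :: "real^'n \<Rightarrow> real"
  assumes test: "\<And>w::real^'n \<Rightarrow> real. w \<in> test_functions UNIV \<Longrightarrow> gn_ineq C p t w (grad w)"
    and C: "C \<ge> 0" and t: "0 < t" "t < 1" and p: "p > 0"
    and u: "H1 u G"
  shows "gn_ineq C p t u G"
proof -
  have u2: "u \<in> borel_measurable borel" "integrable lborel (\<lambda>x. (u x)\<^sup>2)"
    and G2: "G \<in> borel_measurable borel" "integrable lborel (\<lambda>x. (norm (G x))\<^sup>2)"
    using u by (auto simp: H1_def in_Lp_2_iff)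
  note [measurable] = u2(1) G2(1)
  have lu: "locint u" by (rule locint_sq[OF u2])
  have Gi[measurable]: "(\<lambda>x. G x $ i) \<in> borel_measurable borel" for i
    by (rule measurable_compose[OF G2(1)]) (intro borel_measurable_continuous_onI continuous_intros)
  have Gi2: "integrable lborel (\<lambda>x. (G x $ i)\<^sup>2)" for i
  proof (rule Bochner_Integration.integrable_bound[OF G2(2)])
    have "norm ((G x $ i)\<^sup>2) \<le> norm ((norm (G x))\<^sup>2)" for x
      using abs_le_square_iff[of "G x $ i" "norm (G x)"] component_le_norm_cart[of "G x" i] by simp
    then show "AE x in lborel. norm ((G x $ i)\<^sup>2) \<le> norm ((norm (G x))\<^sup>2)" by simp
    show "(\<lambda>x. (G x $ i)\<^sup>2) \<in> borel_measurable lborel" using Gi by simp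
  qed
  have lG: "locint (\<lambda>x. G x $ i)" for i by (rule locint_sq[OF _ Gi2]) simp
  define A B where "A = (LINT x|lborel. (norm (G x))\<^sup>2)" and "B = (LINT x|lborel. (u x)\<^sup>2)"
  define K where "K = (C * (A powr t * B powr (1 - t))) powr (p/2)"
  have conv_bound: "(\<integral>\<^sup>+x. ennreal (\<bar>conv u \<phi> x\<bar> powr p) \<partial>lborel) \<le> ennreal K"
    if \<phi>: "\<phi> \<in> test_functions UNIV" "\<And>x. \<phi> x \<ge> 0" "(LINT x|lborel. \<phi> x) = 1" for \<phi>
  proof -
    have sm: "smooth (conv u \<phi>)" by (rule smooth_conv[OF lu \<phi>(1)])
    have [measurable]: "conv u \<phi> \<in> borel_measurable borel" "grad (conv u \<phi>) \<in> borel_measurable borel"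
      "conv (\<lambda>x. G x $ i) \<phi> \<in> borel_measurable borel" for i
      using sm smooth_conv[OF lG \<phi>(1)] by (auto intro: smooth_measurable grad_measurable)
    have b: "(\<integral>\<^sup>+x. ennreal ((conv u \<phi> x)\<^sup>2) \<partial>lborel) \<le> ennreal B"
      unfolding B_def by (rule conv_sq_le[OF lu u2(2) \<phi>])
    have a: "(\<integral>\<^sup>+x. ennreal ((norm (grad (conv u \<phi>) x))\<^sup>2) \<partial>lborel) \<le> ennreal A"
    proof -
      have "(\<integral>\<^sup>+x. ennreal ((norm (grad (conv u \<phi>) x))\<^sup>2) \<partial>lborel)
        = (\<integral>\<^sup>+x. (\<Sum>i\<in>UNIV. ennreal ((conv (\<lambda>x. G x $ i) \<phi> x)\<^sup>2)) \<partial>lborel)"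
        by (intro nn_integral_cong) (simp add: H1_conv[OF lu lG u \<phi>(1)] norm_vec_sq)
      also have "\<dots> = (\<Sum>i\<in>UNIV. \<integral>\<^sup>+x. ennreal ((conv (\<lambda>x. G x $ i) \<phi> x)\<^sup>2) \<partial>lborel)"
        by (rule nn_integral_sum) simp
      also have "\<dots> \<le> (\<Sum>i\<in>UNIV. ennreal (LINT x|lborel. (G x $ i)\<^sup>2))"
        by (intro sum_mono conv_sq_le[OF lG Gi2 \<phi>])
      also have "\<dots> = ennreal (\<Sum>i\<in>UNIV. (LINT x|lborel. (G x $ i)\<^sup>2))"
        by (intro sum_ennreal) (auto intro!: Bochner_Integration.integral_nonneg)
      also have "(\<Sum>i\<in>UNIV. (LINT x|lborel. (G x $ i)\<^sup>2)) = A"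
        unfolding A_def using Gi2 by (subst Bochner_Integration.integral_sum[symmetric])
          (auto simp: norm_vec_sq)
      finally show ?thesis .
    qed
    have ib: "integrable lborel (\<lambda>x. (conv u \<phi> x)\<^sup>2)"
      using b by (intro integrableI_bounded) (auto simp: less_top[symmetric] top_unique)
    have ia: "integrable lborel (\<lambda>x. (norm (grad (conv u \<phi>) x))\<^sup>2)"
      using a by (intro integrableI_bounded) (auto simp: less_top[symmetric] top_unique)
    have AB: "A \<ge> 0" "B \<ge> 0" unfolding A_def B_def by (auto intro!: Bochner_Integration.integral_nonneg)
    have b': "(LINT x|lborel. (conv u \<phi> x)\<^sup>2) \<le> B"
      using b AB nn_integral_eq_integral[OF ib] by simp
    have a': "(LINT x|lborel. (norm (grad (conv u \<phi>) x))\<^sup>2) \<le> A"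
      using a AB nn_integral_eq_integral[OF ia] by simp
    have "gn_ineq C p t (conv u \<phi>) (grad (conv u \<phi>))"
      by (rule gn_ineq_smooth[OF test C t p sm ib ia])
    then show ?thesis unfolding gn_ineq_def K_def
      by (rule order_trans)
         (use C p t a' b' in \<open>intro ennreal_leI powr_mono2 mult_left_mono mult_mono;
           auto intro!: Bochner_Integration.integral_nonneg mult_nonneg_nonneg\<close>)
  qed
  have ball_bound: "(\<integral>\<^sup>+x. ennreal (indicator (ball 0 R) x * \<bar>u x\<bar> powr p) \<partial>lborel) \<le> ennreal K" if "R > 0" for R
  proof -
    \<comment> \<open>The L^1 theory needs an integrable function, and u is only locally integrable.
      The mollifiers are supported in the unit ball, so on the ball of radius R truncation at R + 1
      does not change the convolution.\<close>
    define w where "w x = indicator (cball 0 (R + 1)) x * u x" for x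
    have w: "integrable lborel w" using lu unfolding w_def locint_def by auto
    have lw: "locint w" unfolding locint_def
      using integrable_mult_indicator[OF _ w] by (auto simp: real_scaleR_def)
    define Q where "Q n \<phi> \<longleftrightarrow> \<phi> \<in> test_functions UNIV \<and> (\<forall>x. \<phi> x \<ge> 0) \<and> (LINT x|lborel. \<phi> x) = 1 \<and>
      (\<forall>x. norm x \<ge> 1 \<longrightarrow> \<phi> x = 0) \<and> (\<integral>\<^sup>+x. ennreal \<bar>conv w \<phi> x - w x\<bar> \<partial>lborel) \<le> ennreal (1 / real (Suc n))" for n \<phi>
    have "\<exists>\<phi>. Q n \<phi>" for n
    proof -
      obtain d where d: "d > 0" "\<And>z. norm z < d \<Longrightarrow> l1shift w z \<le> ennreal (1 / real (Suc n))"
        using l1shift_small[OF w, of "1 / real (Suc n)"] by (auto simp del: of_nat_Suc)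
      obtain \<phi> :: "real^'n \<Rightarrow> real" where \<phi>: "\<phi> \<in> test_functions UNIV" "\<And>x. \<phi> x \<ge> 0"
        "\<And>x. norm x \<ge> min 1 d \<Longrightarrow> \<phi> x = 0" "(LINT x|lborel. \<phi> x) = 1"
        using mollifier_exists[of "min 1 d"] d by (metis less_numeral_extra(1) min_less_iff_conj)
      have "(\<integral>\<^sup>+x. ennreal \<bar>conv w \<phi> x - w x\<bar> \<partial>lborel) \<le> ennreal (1 / real (Suc n))"
        by (rule conv_l1_le[OF w \<phi>(1,2,4), of d]) (use \<phi>(3) d(2) in auto)
      with \<phi> show ?thesis unfolding Q_def by (intro exI[of _ \<phi>]) auto
    qed
    then obtain \<phi> where Q: "\<And>n. Q n (\<phi> n)" by metis
    have \<phi>: "\<And>n. \<phi> n \<in> test_functions UNIV" "\<And>n x. \<phi> n x \<ge> 0"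
      "\<And>n. (LINT x|lborel. \<phi> n x) = 1" "\<And>n x. norm x \<ge> 1 \<Longrightarrow> \<phi> n x = 0"
      "\<And>n. (\<integral>\<^sup>+x. ennreal \<bar>conv w (\<phi> n) x - w x\<bar> \<partial>lborel) \<le> ennreal (1 / real (Suc n))"
      using Q unfolding Q_def by blast+
    have [measurable]: "conv u (\<phi> n) \<in> borel_measurable borel" "conv w (\<phi> n) \<in> borel_measurable borel"
      "w \<in> borel_measurable borel" for n
      using smooth_conv[OF lu \<phi>(1)] smooth_conv[OF lw \<phi>(1)] w
      by (auto intro: smooth_measurable dest: borel_measurable_integrable)
    have i: "integrable lborel (\<lambda>x. conv w (\<phi> n) x - w x)" for n
      using \<phi>(5)[of n] by (intro integrableI_bounded) (auto simp: less_top[symmetric] top_unique)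
    have "(\<lambda>n. LINT x|lborel. norm (conv w (\<phi> n) x - w x)) \<longlonglongrightarrow> 0"
    proof (rule Lim_null_comparison[OF always_eventually LIMSEQ_inverse_real_of_nat], rule allI)
      fix n
      have "(LINT x|lborel. norm (conv w (\<phi> n) x - w x)) \<le> 1 / real (Suc n)"
        using \<phi>(5)[of n] nn_integral_eq_integral[OF integrable_norm[OF i[of n]]] by simp
      then show "norm (LINT x|lborel. norm (conv w (\<phi> n) x - w x)) \<le> inverse (real (Suc n))"
        by (simp add: inverse_eq_divide abs_of_nonneg Bochner_Integration.integral_nonneg)
    qed
    \<comment> \<open>L^1 convergence yields almost everywhere convergence only along a subsequence,
      which is enough for Fatou.\<close>
    from tendsto_L1_AE_subseq[OF i this]
    obtain r where r: "strict_mono r" "AE x in lborel. (\<lambda>n. conv w (\<phi> (r n)) x - w x) \<longlonglongrightarrow> 0" by blast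
    have cw: "conv w (\<phi> n) x = conv u (\<phi> n) x" if "x \<in> ball 0 R" for n x
    proof -
      have "w y * \<phi> n (x - y) = u y * \<phi> n (x - y)" for y
      proof (cases "norm y \<le> R + 1")
        case False
        have "norm y \<le> norm x + norm (x - y)" by norm
        with False that have "norm (x - y) \<ge> 1" by simp
        then show ?thesis by (simp add: \<phi>(4))
      qed (simp add: w_def)
      then show ?thesis unfolding conv_def by (rule Bochner_Integration.integral_cong[OF refl])
    qed
    have [measurable]: "ball 0 R \<in> sets (borel :: (real^'n) measure)" by simp
    show ?thesis
    proof (rule nn_integral_le_tendsto[where g = "\<lambda>n x. indicator (ball 0 R) x * \<bar>conv u (\<phi> (r n)) x\<bar> powr p"])
      show "AE x in lborel. (\<lambda>n. indicator (ball 0 R) x * \<bar>conv u (\<phi> (r n)) x\<bar> powr p) \<longlonglongrightarrow> indicator (ball 0 R) x * \<bar>u x\<bar> powr p"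
        using r(2)
      proof eventually_elim
        case (elim x)
        show ?case
        proof (cases "x \<in> ball 0 R")
          case True
          then have "w x = u x" by (auto simp: w_def)
          with elim have "(\<lambda>n. conv u (\<phi> (r n)) x) \<longlonglongrightarrow> u x"
            using cw[OF True] by (simp add: LIM_zero_iff)
          then have "(\<lambda>n. \<bar>conv u (\<phi> (r n)) x\<bar> powr p) \<longlonglongrightarrow> \<bar>u x\<bar> powr p"
            using p by (intro tendsto_powr' tendsto_intros) auto
          with True show ?thesis by simp
        qed simp
      qed
      show "(\<integral>\<^sup>+x. ennreal (indicator (ball 0 R) x * \<bar>conv u (\<phi> (r n)) x\<bar> powr p) \<partial>lborel) \<le> ennreal K" for n
        by (rule order_trans[OF nn_integral_mono conv_bound[OF \<phi>(1) \<phi>(2) \<phi>(3)]]) (auto simp: indicator_def)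
      show "(\<lambda>x. indicator (ball 0 R) x * \<bar>conv u (\<phi> (r n)) x\<bar> powr p) \<in> borel_measurable lborel" for n
        by measurable
    qed simp
  qed
  show ?thesis unfolding gn_ineq_def A_def[symmetric] B_def[symmetric] K_def[symmetric]
  proof (rule nn_integral_le_tendsto[where g = "\<lambda>n x. indicator (ball 0 (real (Suc n))) x * \<bar>u x\<bar> powr p"])
    show "AE x in lborel. (\<lambda>n. indicator (ball 0 (real (Suc n))) x * \<bar>u x\<bar> powr p) \<longlonglongrightarrow> \<bar>u x\<bar> powr p"
    proof (intro AE_I2 tendsto_eventually)
      fix x :: "real^'n"
      obtain N :: nat where "norm x \<le> real N" using real_arch_simple by blast
      then show "\<forall>\<^sub>F n in sequentially. indicator (ball 0 (real (Suc n))) x * \<bar>u x\<bar> powr p = \<bar>u x\<bar> powr p"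
        by (intro eventually_sequentiallyI[of N]) (auto simp: indicator_def)
    qed
    have [measurable]: "ball 0 R \<in> sets (borel :: (real^'n) measure)" for R by simp
    show "(\<lambda>x. indicator (ball 0 (real (Suc n))) x * \<bar>u x\<bar> powr p) \<in> borel_measurable lborel" for n
      by measurable
    show "(\<integral>\<^sup>+x. ennreal (indicator (ball 0 (real (Suc n))) x * \<bar>u x\<bar> powr p) \<partial>lborel) \<le> ennreal K" for n
      by (rule ball_bound) simp
  qed simp
qed

subsection \<open>The Gagliardo--Nirenberg inequality\<close>

text \<open>The increment u(x - z) - u(x) is the integral of the directional derivative along a
  segment. Cauchy-Schwarz on the unit interval squares it, and after Tonelli translation invariance
  makes the integral over x independent of the point of the segment.\<close>

lemma translation_sq_le:
  fixes u :: "real^'n \<Rightarrow> real"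
  assumes u: "u \<in> test_functions UNIV"
  shows "(\<integral>\<^sup>+x. ennreal ((u x - u (x - z))\<^sup>2) \<partial>lborel)
    \<le> ennreal ((norm z)\<^sup>2 * (LINT x|lborel. (norm (grad u x))\<^sup>2))"
proof -
  have sm: "smooth u" using u by (simp add: test_functions_def)
  obtain R where R: "\<And>x. R < norm x \<Longrightarrow> u x = 0" using u by (metis test_functionsE)
  have cg: "continuous_on UNIV (grad u)" by (rule continuous_on_grad[OF sm])
  have [measurable]: "u \<in> borel_measurable borel" "grad u \<in> borel_measurable borel"
    using sm by (auto intro: smooth_measurable grad_measurable)
  have iA: "integrable lborel (\<lambda>x. (norm (grad u x))\<^sup>2)"
    by (rule integrable_bounded_support[where R = R]) (use cg grad_eq_0_support[OF R] in \<open>auto intro!: continuous_intros\<close>)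
  \<comment> \<open>The indicator of the unit interval, carried as an idempotent weight so that all
    integrals run over the whole line. It is one of the two factors in Cauchy-Schwarz, with integral
    1.\<close>
  define I :: "real \<Rightarrow> real" where "I s = indicator {0..1} s" for s
  have I: "I s * I s = I s" "I s \<ge> 0" for s by (auto simp: I_def indicator_def)
  have II: "I s * (I s * y) = I s * y" for s y by (metis I(1) mult.assoc)
  have [measurable]: "I \<in> borel_measurable borel" unfolding I_def by measurable
  have "ennreal ((u x - u (x - z))\<^sup>2) \<le> (\<integral>\<^sup>+s. ennreal (I s) * ennreal ((norm z)\<^sup>2 * (norm (grad u (x - s *\<^sub>R z)))\<^sup>2) \<partial>lborel)" for x
  proof -
    define g where "g s = grad u (x - s *\<^sub>R z) \<bullet> (- z)" for s
    have gc: "continuous_on A g" for A unfolding g_def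
      by (intro continuous_intros continuous_on_compose2[OF cg]) auto
    have [measurable]: "g \<in> borel_measurable borel" by (rule borel_measurable_continuous_onI[OF gc])
    have "((\<lambda>s. u (x - s *\<^sub>R z)) has_real_derivative g s) (at s)" for s
    proof -
      have "((\<lambda>s. u (x - s *\<^sub>R z)) has_derivative (\<lambda>h. grad u (x - s *\<^sub>R z) \<bullet> (- (h *\<^sub>R z)))) (at s)"
        by (rule has_derivative_compose[where g = u and f = "\<lambda>s. x - s *\<^sub>R z"])
           (auto intro!: derivative_eq_intros has_derivative_grad smooth_differentiable[OF sm])
      then show ?thesis unfolding has_field_derivative_def g_def
        by (rule has_derivative_eq_rhs) auto
    qed
    then have F: "((\<lambda>s. u (x - s *\<^sub>R z)) has_vector_derivative g s) (at s within {0..1})" for s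
      by (simp add: has_real_derivative_iff_has_vector_derivative[symmetric] has_field_derivative_at_within)
    have "(LINT s|lborel. indicator {0..1} s *\<^sub>R g s) = u (x - 1 *\<^sub>R z) - u (x - 0 *\<^sub>R z)"
      by (rule integral_FTC_atLeastAtMost[OF _ F gc]) simp
    then have eq: "(LINT s|lborel. I s * g s) = u (x - z) - u x" by (simp add: I_def)
    have iI: "integrable lborel (\<lambda>s. I s * g s)"
      using borel_integrable_atLeastAtMost'[of 0 1 g] gc by (simp add: I_def set_integrable_def)
    have "\<bar>u (x - z) - u x\<bar> \<le> (LINT s|lborel. norm (I s * g s))"
      unfolding eq[symmetric] by (metis integral_norm_bound real_norm_def)
    then have "ennreal \<bar>u (x - z) - u x\<bar> \<le> ennreal (LINT s|lborel. norm (I s * g s))" by (rule ennreal_leI)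
    also have "\<dots> = (\<integral>\<^sup>+s. ennreal (I s) * ennreal (I s * \<bar>g s\<bar>) \<partial>lborel)"
      using I by (subst nn_integral_eq_integral[OF integrable_norm[OF iI], symmetric])
        (auto simp: abs_mult ennreal_mult[symmetric] II)
    finally have "(ennreal \<bar>u (x - z) - u x\<bar>)\<^sup>2 \<le> (\<integral>\<^sup>+s. ennreal (I s) * ennreal (I s * \<bar>g s\<bar>) \<partial>lborel)\<^sup>2"
      by (rule power_mono) simp
    also have "\<dots> \<le> (\<integral>\<^sup>+s. (ennreal (I s))\<^sup>2 \<partial>lborel) * (\<integral>\<^sup>+s. (ennreal (I s * \<bar>g s\<bar>))\<^sup>2 \<partial>lborel)"
      by (rule Cauchy_Schwarz_nn_integral) auto
    also have "(\<integral>\<^sup>+s. (ennreal (I s))\<^sup>2 \<partial>lborel) = (\<integral>\<^sup>+s. indicator {0..1} s \<partial>(lborel::real measure))"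
      by (intro nn_integral_cong) (auto simp: I_def indicator_def)
    also have "\<dots> = 1" by simp
    also have "(\<integral>\<^sup>+s. (ennreal (I s * \<bar>g s\<bar>))\<^sup>2 \<partial>lborel) \<le> (\<integral>\<^sup>+s. ennreal (I s) * ennreal ((norm z)\<^sup>2 * (norm (grad u (x - s *\<^sub>R z)))\<^sup>2) \<partial>lborel)"
    proof (rule nn_integral_mono)
      fix s
      have "\<bar>g s\<bar> \<le> norm (grad u (x - s *\<^sub>R z)) * norm z"
        unfolding g_def using Cauchy_Schwarz_ineq2[of "grad u (x - s *\<^sub>R z)" "-z"] by simp
      then have "\<bar>g s\<bar>\<^sup>2 \<le> (norm z)\<^sup>2 * (norm (grad u (x - s *\<^sub>R z)))\<^sup>2"
        by (metis abs_ge_zero mult.commute power_mono power_mult_distrib)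
      then have "I s * \<bar>g s\<bar>\<^sup>2 \<le> I s * ((norm z)\<^sup>2 * (norm (grad u (x - s *\<^sub>R z)))\<^sup>2)"
        using I by (intro mult_left_mono) auto
      moreover have "(I s * \<bar>g s\<bar>)\<^sup>2 = I s * \<bar>g s\<bar>\<^sup>2" using II[of s "\<bar>g s\<bar> * \<bar>g s\<bar>"] by (simp only: power_mult_distrib power2_eq_square mult.assoc mult.left_commute)
      ultimately show "(ennreal (I s * \<bar>g s\<bar>))\<^sup>2 \<le> ennreal (I s) * ennreal ((norm z)\<^sup>2 * (norm (grad u (x - s *\<^sub>R z)))\<^sup>2)"
        using I by (simp add: ennreal_power ennreal_mult[symmetric] ennreal_leI)
    qed
    finally show ?thesis by (simp add: ennreal_power power2_commute)
  qed
  then have "(\<integral>\<^sup>+x. ennreal ((u x - u (x - z))\<^sup>2) \<partial>lborel)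
      \<le> (\<integral>\<^sup>+x. (\<integral>\<^sup>+s. ennreal (I s) * ennreal ((norm z)\<^sup>2 * (norm (grad u (x - s *\<^sub>R z)))\<^sup>2) \<partial>lborel) \<partial>lborel)"
    by (intro nn_integral_mono)
  also have "\<dots> = (\<integral>\<^sup>+s. (\<integral>\<^sup>+x. ennreal (I s) * ennreal ((norm z)\<^sup>2 * (norm (grad u (x - s *\<^sub>R z)))\<^sup>2) \<partial>lborel) \<partial>lborel)"
    by (rule lborel_pair.Fubini') (simp add: split_beta')
  also have "\<dots> = (\<integral>\<^sup>+s. ennreal (I s) * ennreal ((norm z)\<^sup>2 * (LINT x|lborel. (norm (grad u x))\<^sup>2)) \<partial>lborel)"
  proof (rule nn_integral_cong)
    fix s
    have "(\<integral>\<^sup>+x. ennreal ((norm z)\<^sup>2 * (norm (grad u (x - s *\<^sub>R z)))\<^sup>2) \<partial>lborel)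
       = (\<integral>\<^sup>+x. ennreal ((norm z)\<^sup>2 * (norm (grad u x))\<^sup>2) \<partial>lborel)"
      by (rule nn_integral_lborel_shift(2)) simp
    also have "\<dots> = ennreal (LINT x|lborel. (norm z)\<^sup>2 * (norm (grad u x))\<^sup>2)"
      using iA by (intro nn_integral_eq_integral) auto
    finally show "(\<integral>\<^sup>+x. ennreal (I s) * ennreal ((norm z)\<^sup>2 * (norm (grad u (x - s *\<^sub>R z)))\<^sup>2) \<partial>lborel)
      = ennreal (I s) * ennreal ((norm z)\<^sup>2 * (LINT x|lborel. (norm (grad u x))\<^sup>2))"
      by (subst nn_integral_cmult) auto
  qed
  also have "\<dots> = ennreal ((norm z)\<^sup>2 * (LINT x|lborel. (norm (grad u x))\<^sup>2)) * (\<integral>\<^sup>+s. ennreal (I s) \<partial>lborel)"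
    by (subst nn_integral_multc) (auto simp: mult.commute)
  also have "(\<integral>\<^sup>+s. ennreal (I s) \<partial>lborel) = 1"
  proof -
    have "(\<integral>\<^sup>+s. ennreal (I s) \<partial>lborel) = (\<integral>\<^sup>+s. indicator {0..1} s \<partial>(lborel::real measure))"
      by (intro nn_integral_cong) (auto simp: I_def indicator_def)
    then show ?thesis by simp
  qed
  finally show ?thesis by simp
qed

text \<open>The radius is so large that the mean of \<open>u\<^sup>2\<close> over a ball of radius \<open>r\<close> is at most \<open>l\<^sup>2 / 4\<close>. So
  where \<open>\<bar>u x\<bar> > l\<close>, most of \<open>u x\<close> is oscillation of \<open>u\<close> on the ball around \<open>x\<close>.\<close>

lemma level_set_sq_le:
  fixes u :: "real^'n \<Rightarrow> real"
  assumes u: "u \<in> test_functions UNIV" and l: "l > 0" and r: "r > 0"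
    and A: "(LINT x|lborel. (norm (grad u x))\<^sup>2) \<le> A" and B: "(LINT x|lborel. (u x)\<^sup>2) \<le> B"
    and rl: "4 * B \<le> l\<^sup>2 * measure lborel (ball (0::real^'n) r)"
  shows "(\<integral>\<^sup>+x. ennreal ((u x)\<^sup>2 * indicator {x. l < \<bar>u x\<bar>} x) \<partial>lborel) \<le> ennreal (4 * r\<^sup>2 * A)"
proof -
  define V where "V = measure lborel (ball (0::real^'n) r)"
  have V: "emeasure lborel (ball (0::real^'n) r) = ennreal V" "V > 0"
    using emeasure_lborel_ball_finite[of "0::real^'n" r] content_ball_pos[OF r, of "0::real^'n"]
    unfolding V_def by (auto intro!: emeasure_eq_ennreal_measure simp: less_top measure_def)
  have sm: "smooth u" using u by (simp add: test_functions_def)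
  obtain R where R: "\<And>x. R < norm x \<Longrightarrow> u x = 0" using u by (metis test_functionsE)
  have [measurable]: "u \<in> borel_measurable borel" using sm by (rule smooth_measurable)
  have iB: "integrable lborel (\<lambda>x. (u x)\<^sup>2)"
    by (rule integrable_bounded_support[where R = R]) (use smooth_continuous[OF sm] R in \<open>auto intro!: continuous_intros\<close>)
  have Apos: "A \<ge> 0" using A by (rule order_trans[rotated]) (auto intro: Bochner_Integration.integral_nonneg)
  define b where "b z = ennreal (indicator (ball (0::real^'n) r) z)" for z
  have [measurable]: "ball 0 r \<in> sets (borel :: (real^'n) measure)" by simp
  have [measurable]: "b \<in> borel_measurable borel" unfolding b_def by measurable
  have bV: "(\<integral>\<^sup>+z. b z \<partial>lborel) = ennreal V"
    unfolding b_def V(1)[symmetric] by (simp add: ennreal_indicator)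
  define J where "J x = (\<integral>\<^sup>+z. b z * ennreal ((u x - u (x - z))\<^sup>2) \<partial>lborel)" for x
  have [measurable]: "J \<in> borel_measurable borel" unfolding J_def by measurable
  have pw: "ennreal V * ennreal ((u x)\<^sup>2 * indicator {x. l < \<bar>u x\<bar>} x) \<le> 4 * J x" for x
  proof (cases "l < \<bar>u x\<bar>")
    case True
    have "ennreal V * ennreal ((u x)\<^sup>2) = (\<integral>\<^sup>+z. b z * ennreal ((u x)\<^sup>2) \<partial>lborel)"
      by (subst nn_integral_multc) (auto simp: bV)
    also have "\<dots> \<le> (\<integral>\<^sup>+z. 2 * (b z * ennreal ((u x - u (x - z))\<^sup>2)) + 2 * ennreal ((u (x - z))\<^sup>2) \<partial>lborel)"
    proof (rule nn_integral_mono)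
      fix z
      have "0 \<le> (u x - 2 * u (x - z))\<^sup>2" by simp
      then have "(u x)\<^sup>2 \<le> 2 * (u x - u (x - z))\<^sup>2 + 2 * (u (x - z))\<^sup>2"
        by (simp add: power2_eq_square algebra_simps)
      then have "ennreal ((u x)\<^sup>2) \<le> ennreal (2 * (u x - u (x - z))\<^sup>2 + 2 * (u (x - z))\<^sup>2)" by (rule ennreal_leI)
      also have "\<dots> = 2 * ennreal ((u x - u (x - z))\<^sup>2) + 2 * ennreal ((u (x - z))\<^sup>2)"
        by (simp add: ennreal_mult')
      finally show "b z * ennreal ((u x)\<^sup>2) \<le> 2 * (b z * ennreal ((u x - u (x - z))\<^sup>2)) + 2 * ennreal ((u (x - z))\<^sup>2)"
        by (cases "z \<in> ball 0 r") (auto simp: b_def)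
    qed
    also have "\<dots> = 2 * J x + 2 * (\<integral>\<^sup>+z. ennreal ((u (x - z))\<^sup>2) \<partial>lborel)"
      unfolding J_def by (subst nn_integral_add) (auto simp: nn_integral_cmult)
    also have "(\<integral>\<^sup>+z. ennreal ((u (x - z))\<^sup>2) \<partial>lborel) = (\<integral>\<^sup>+z. ennreal ((u z)\<^sup>2) \<partial>lborel)"
      by (rule nn_integral_lborel_shift(3)) simp
    also have "\<dots> = ennreal (LINT x|lborel. (u x)\<^sup>2)" using iB by (intro nn_integral_eq_integral) auto
    \<comment> \<open>The second term is absorbed: where |u(x)| > l, the hypothesis on r bounds 2
      \<integral>u^2 by half of the left-hand side V u(x)^2.\<close>
    also have "2 * J x + 2 * ennreal (LINT x|lborel. (u x)\<^sup>2) \<le> 2 * J x + ennreal (V * (u x)\<^sup>2 / 2)"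
    proof (rule add_left_mono)
      have "l\<^sup>2 \<le> (u x)\<^sup>2" using True l by (intro abs_le_square_iff[THEN iffD1]) auto
      then have "4 * (LINT x|lborel. (u x)\<^sup>2) \<le> V * (u x)\<^sup>2"
        using B rl V(2) unfolding V_def by (smt (verit) mult.commute mult_left_mono)
      then have "ennreal (2 * (LINT x|lborel. (u x)\<^sup>2)) \<le> ennreal (V * (u x)\<^sup>2 / 2)"
        by (intro ennreal_leI) simp
      then show "2 * ennreal (LINT x|lborel. (u x)\<^sup>2) \<le> ennreal (V * (u x)\<^sup>2 / 2)" by (simp add: ennreal_mult')
    qed
    finally have *: "ennreal (V * (u x)\<^sup>2) \<le> 2 * J x + ennreal (V * (u x)\<^sup>2 / 2)"
      using V(2) by (simp add: ennreal_mult)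
    have "ennreal (V * (u x)\<^sup>2) \<le> 4 * J x"
    proof (cases "J x")
      case (real j)
      with * have "ennreal (V * (u x)\<^sup>2) \<le> ennreal (2 * j + V * (u x)\<^sup>2 / 2)"
        using V(2) by (simp add: ennreal_mult')
      then have "V * (u x)\<^sup>2 \<le> 2 * j + V * (u x)\<^sup>2 / 2" using real V(2) by (subst (asm) ennreal_le_iff) auto
      then have "ennreal (V * (u x)\<^sup>2) \<le> ennreal (4 * j)" by (intro ennreal_leI) simp
      with real show ?thesis by (simp add: ennreal_mult')
    qed (simp add: ennreal_mult_top)
    then show ?thesis using True V(2) by (simp add: ennreal_mult)
  qed simp
  have "ennreal V * (\<integral>\<^sup>+x. ennreal ((u x)\<^sup>2 * indicator {x. l < \<bar>u x\<bar>} x) \<partial>lborel) \<le> 4 * (\<integral>\<^sup>+x. J x \<partial>lborel)"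
  proof -
    have "(\<integral>\<^sup>+x. ennreal V * ennreal ((u x)\<^sup>2 * indicator {x. l < \<bar>u x\<bar>} x) \<partial>lborel) \<le> (\<integral>\<^sup>+x. 4 * J x \<partial>lborel)"
      by (intro nn_integral_mono pw)
    then show ?thesis by (simp add: nn_integral_cmult)
  qed
  also have "4 * (\<integral>\<^sup>+x. J x \<partial>lborel) \<le> 4 * (ennreal V * ennreal (r\<^sup>2 * A))"
  proof (rule mult_left_mono)
    have "(\<integral>\<^sup>+x. J x \<partial>lborel) = (\<integral>\<^sup>+z. (\<integral>\<^sup>+x. b z * ennreal ((u x - u (x - z))\<^sup>2) \<partial>lborel) \<partial>lborel)"
      unfolding J_def by (rule lborel_pair.Fubini') (simp add: split_beta')
    also have "\<dots> \<le> (\<integral>\<^sup>+z. b z * ennreal (r\<^sup>2 * A) \<partial>lborel)"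
    proof (rule nn_integral_mono)
      fix z
      show "(\<integral>\<^sup>+x. b z * ennreal ((u x - u (x - z))\<^sup>2) \<partial>lborel) \<le> b z * ennreal (r\<^sup>2 * A)"
      proof (cases "norm z < r")
        case True
        have "(\<integral>\<^sup>+x. ennreal ((u x - u (x - z))\<^sup>2) \<partial>lborel) \<le> ennreal ((norm z)\<^sup>2 * (LINT x|lborel. (norm (grad u x))\<^sup>2))"
          by (rule translation_sq_le[OF u])
        also have "\<dots> \<le> ennreal (r\<^sup>2 * A)" using True A Apos
          by (intro ennreal_leI mult_mono power_mono) (auto intro: Bochner_Integration.integral_nonneg)
        finally show ?thesis by (subst nn_integral_cmult) (auto intro!: mult_left_mono)
      qed (simp add: b_def)
    qed
    also have "\<dots> = ennreal V * ennreal (r\<^sup>2 * A)" by (subst nn_integral_multc) (auto simp: bV)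
    finally show "(\<integral>\<^sup>+x. J x \<partial>lborel) \<le> ennreal V * ennreal (r\<^sup>2 * A)" .
  qed simp
  also have "4 * (ennreal V * ennreal (r\<^sup>2 * A)) = ennreal V * ennreal (4 * r\<^sup>2 * A)"
    using Apos V by (simp add: ennreal_mult' mult_ac)
  finally show ?thesis using V(2) by (subst (asm) ennreal_mult_le_mult_iff) auto
qed

text \<open>Above L, the least n with y \<le> 2^n L satisfies n = k + 1 with y > 2^k L, so the
  single term k of the series already dominates.\<close>

lemma powr_dyadic_le:
  fixes y L q :: real
  assumes "L > 0" "q > 0" "y \<ge> 0"
  shows "ennreal (y powr q) \<le> ennreal (L powr q) +
    (\<Sum>k. ennreal ((2 ^ Suc k * L) powr q) * indicator {y. 2 ^ k * L < y} y)"
proof (cases "y \<le> L")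
  case True
  then have "ennreal (y powr q) \<le> ennreal (L powr q)" using assms by (intro ennreal_leI powr_mono2) auto
  then show ?thesis by (rule order_trans) simp
next
  case False
  have "\<exists>n. y \<le> 2 ^ n * L"
    using real_arch_pow[of 2 "y / L"] assms by (auto simp: field_simps intro: less_imp_le)
  define n where "n = (LEAST n. y \<le> 2 ^ n * L)"
  have n: "y \<le> 2 ^ n * L" unfolding n_def by (rule LeastI_ex) fact
  then obtain k where k: "n = Suc k" using False by (cases n) auto
  have "\<not> y \<le> 2 ^ k * L" using not_less_Least[of k "\<lambda>n. y \<le> 2 ^ n * L"] k by (simp add: n_def)
  then have "ennreal (y powr q) \<le> ennreal ((2 ^ Suc k * L) powr q) * indicator {y. 2 ^ k * L < y} y"
    using n k assms by (auto intro!: ennreal_leI powr_mono2)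
  also have "\<dots> \<le> (\<Sum>k. ennreal ((2 ^ Suc k * L) powr q) * indicator {y. 2 ^ k * L < y} y)"
  proof -
    have "f k \<le> suminf f" for f :: "nat \<Rightarrow> ennreal"
      using sum_le_suminf[OF summableI, of "{k}" f] by simp
    then show ?thesis .
  qed
  finally show ?thesis by (rule order_trans) simp
qed

text \<open>Write |u|^p as u^2 |u|^(p - 2) and cut the second factor into dyadic levels. The
  integral of u^2 over the set |u| > l decays like l^(-4/d) by \<open>level_set_sq_le\<close>, which
  beats the growth l^(p - 2) precisely for p < 2 + 4/d. A and B are positive upper bounds, not the
  integrals themselves, because the level L is a product of possibly negative powers of
  them.\<close>

lemma gagliardo_nirenberg_aux:
  fixes u :: "real^'n \<Rightarrow> real"
  assumes u: "u \<in> test_functions UNIV" and p: "2 < p" "p < 2 + 4 / real CARD('n)"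
    and A: "(LINT x|lborel. (norm (grad u x))\<^sup>2) \<le> A" "A > 0" and B: "(LINT x|lborel. (u x)\<^sup>2) \<le> B" "B > 0"
  defines "d \<equiv> real CARD('n)" and "V \<equiv> measure lborel (ball (0::real^'n) 1)"
  shows "(\<integral>\<^sup>+x. ennreal (\<bar>u x\<bar> powr p) \<partial>lborel)
    \<le> ennreal ((1 + 2 powr (p - 2) * (4 * (4 / V) powr (2/d)) / (1 - 2 powr (p - 2 - 4/d)))
        * (A powr (d * (p - 2) / 4) * B powr (p / 2 - d * (p - 2) / 4)))"
proof -
  have d: "d > 0" by (simp add: d_def)
  have V: "V > 0" unfolding V_def using content_ball_pos[of 1 "0::real^'n"] by simp
  have sm: "smooth u" using u by (simp add: test_functions_def)
  obtain R where R: "\<And>x. R < norm x \<Longrightarrow> u x = 0" using u by (metis test_functionsE)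
  have [measurable]: "u \<in> borel_measurable borel" using sm by (rule smooth_measurable)
  have iB: "integrable lborel (\<lambda>x. (u x)\<^sup>2)"
    by (rule integrable_bounded_support[where R = R]) (use smooth_continuous[OF sm] R in \<open>auto intro!: continuous_intros\<close>)
  define K where "K = 4 * A * (4 * B / V) powr (2/d)"
  have K: "K > 0" unfolding K_def using A B V by simp
  define m where "m l = (\<integral>\<^sup>+x. ennreal ((u x)\<^sup>2 * indicator {x. l < \<bar>u x\<bar>} x) \<partial>lborel)" for l
  have m: "m l \<le> ennreal (K * l powr (- 4/d))" if l: "l > 0" for l
  proof -
    \<comment> \<open>The radius that turns the condition 4 B \<le> l^2 |ball r| of the level set
      estimate into an equality.\<close>
    define r where "r = (4 * B / (V * l\<^sup>2)) powr (1/d)"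
    have r: "r > 0" unfolding r_def using B V l by simp
    have rd: "r ^ CARD('n) = 4 * B / (V * l\<^sup>2)"
    proof -
      have "r ^ CARD('n) = r powr d" by (simp add: powr_realpow[OF r] d_def)
      also have "\<dots> = 4 * B / (V * l\<^sup>2)" using B V l d by (simp add: r_def powr_powr)
      finally show ?thesis .
    qed
    have "4 * B \<le> l\<^sup>2 * measure lborel (ball (0::real^'n) r)"
      using content_ball_conv_unit_ball[of r "0::real^'n"] r rd V l by (simp add: V_def)
    from level_set_sq_le[OF u l r A(1) B(1) this] have "m l \<le> ennreal (4 * r\<^sup>2 * A)" unfolding m_def .
    also have "4 * r\<^sup>2 * A = K * l powr (- 4/d)"
    proof -
      have "r\<^sup>2 = (4 * B / V / l\<^sup>2) powr (2/d)"
      proof -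
        have "r\<^sup>2 = r powr 2" using r by simp
        also have "\<dots> = (4 * B / V / l\<^sup>2) powr (2/d)" by (simp add: r_def powr_powr)
        finally show ?thesis .
      qed
      also have "\<dots> = (4 * B / V) powr (2/d) / (l powr 2) powr (2/d)"
        using B V l by (subst powr_divide) auto
      also have "(l powr 2) powr (2/d) = l powr (4/d)" by (simp add: powr_powr)
      finally show ?thesis by (simp add: K_def powr_minus_divide[of l "4/d"])
    qed
    finally show ?thesis .
  qed
  \<comment> \<open>The base level balances the two parts: A B^(2/d) L^(-4/d) = B, so the part below
    L and the dyadic series are both multiples of L^(p - 2) B.\<close>
  define L where "L = (A * B powr (2/d - 1)) powr (d/4)"
  have L: "L > 0" unfolding L_def using A B by simp
  \<comment> \<open>The ratio of consecutive dyadic terms.\<close>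
  define q where "q = 2 powr (p - 2 - 4/d)"
  have q: "0 < q" "q < 1" using p by (auto simp: q_def d_def powr_less_one)
  define c where "c = 2 powr (p - 2) * K * L powr (p - 2 - 4/d)"
  have c: "c \<ge> 0" using K by (simp add: c_def)
  have "(\<integral>\<^sup>+x. ennreal (\<bar>u x\<bar> powr p) \<partial>lborel)
     \<le> (\<integral>\<^sup>+x. ennreal (L powr (p - 2)) * ennreal ((u x)\<^sup>2) +
        (\<Sum>k. ennreal ((2 ^ Suc k * L) powr (p - 2)) * ennreal ((u x)\<^sup>2 * indicator {x. 2 ^ k * L < \<bar>u x\<bar>} x)) \<partial>lborel)"
  proof (rule nn_integral_mono)
    fix x
    have "\<bar>u x\<bar> powr p = (u x)\<^sup>2 * \<bar>u x\<bar> powr (p - 2)"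
    proof (cases "u x = 0")
      case False
      have "\<bar>u x\<bar> powr p = \<bar>u x\<bar> powr 2 * \<bar>u x\<bar> powr (p - 2)" by (simp only: powr_add[symmetric]) simp
      also have "\<bar>u x\<bar> powr 2 = (u x)\<^sup>2" using False by (subst powr_numeral) auto
      finally show ?thesis .
    qed simp
    then have "ennreal (\<bar>u x\<bar> powr p) = ennreal ((u x)\<^sup>2) * ennreal (\<bar>u x\<bar> powr (p - 2))" by (simp add: ennreal_mult)
    also have "\<dots> \<le> ennreal ((u x)\<^sup>2) * (ennreal (L powr (p - 2)) +
        (\<Sum>k. ennreal ((2 ^ Suc k * L) powr (p - 2)) * indicator {y. 2 ^ k * L < y} \<bar>u x\<bar>))"
      using p by (intro mult_left_mono powr_dyadic_le[OF L]) auto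
    also have "\<dots> = ennreal (L powr (p - 2)) * ennreal ((u x)\<^sup>2) +
        (\<Sum>k. ennreal ((u x)\<^sup>2) * (ennreal ((2 ^ Suc k * L) powr (p - 2)) * indicator {y. 2 ^ k * L < y} \<bar>u x\<bar>))"
      by (simp add: distrib_left mult.commute del: power_Suc)
    also have "(\<lambda>k. ennreal ((u x)\<^sup>2) * (ennreal ((2 ^ Suc k * L) powr (p - 2)) * indicator {y. 2 ^ k * L < y} \<bar>u x\<bar>))
       = (\<lambda>k. ennreal ((2 ^ Suc k * L) powr (p - 2)) * ennreal ((u x)\<^sup>2 * indicator {x. 2 ^ k * L < \<bar>u x\<bar>} x))"
      by (rule ext) (auto simp: indicator_def mult_ac)
    finally show "ennreal (\<bar>u x\<bar> powr p) \<le> ennreal (L powr (p - 2)) * ennreal ((u x)\<^sup>2) +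
        (\<Sum>k. ennreal ((2 ^ Suc k * L) powr (p - 2)) * ennreal ((u x)\<^sup>2 * indicator {x. 2 ^ k * L < \<bar>u x\<bar>} x))" .
  qed
  also have "\<dots> = ennreal (L powr (p - 2)) * ennreal (LINT x|lborel. (u x)\<^sup>2) + (\<Sum>k. ennreal ((2 ^ Suc k * L) powr (p - 2)) * m (2 ^ k * L))"
    unfolding m_def using nn_integral_eq_integral[OF iB]
    by (subst nn_integral_add) (auto simp: nn_integral_suminf nn_integral_cmult simp del: power_Suc)
  also have "\<dots> \<le> ennreal (L powr (p - 2)) * ennreal B + (\<Sum>k. ennreal (c * q ^ k))"
  proof (intro add_mono mult_left_mono suminf_le summableI ennreal_leI B(1))
    fix k
    have "ennreal ((2 ^ Suc k * L) powr (p - 2)) * m (2 ^ k * L)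
        \<le> ennreal ((2 ^ Suc k * L) powr (p - 2)) * ennreal (K * (2 ^ k * L) powr (- 4/d))"
      using m[of "2 ^ k * L"] L by (intro mult_left_mono) auto
    also have "\<dots> = ennreal (c * q ^ k)"
    proof -
      have "(2 ^ Suc k * L) powr (p - 2) * (K * (2 ^ k * L) powr (- 4/d)) = c * q ^ k"
      proof -
        have 1: "(2 ^ Suc k * L) powr (p - 2) = 2 powr (p - 2) * (2 ^ k * L) powr (p - 2)"
          using L by (simp add: powr_mult)
        have "(2 ^ k * L) powr (p - 2) * (2 ^ k * L) powr (- 4/d) = (2 ^ k * L) powr (p - 2 - 4/d)"
          by (simp flip: powr_add)
        also have "\<dots> = (2 powr real k) powr (p - 2 - 4/d) * L powr (p - 2 - 4/d)"
          using L by (simp add: powr_mult powr_realpow)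
        also have "(2 powr real k) powr (p - 2 - 4/d) = q ^ k"
          using q(1) by (simp add: powr_realpow[symmetric]) (simp add: q_def powr_powr mult.commute)
        finally have 2: "(2 ^ k * L) powr (p - 2) * (2 ^ k * L) powr (- 4/d) = q ^ k * L powr (p - 2 - 4/d)" .
        have "(2 ^ Suc k * L) powr (p - 2) * (K * (2 ^ k * L) powr (- 4/d))
          = 2 powr (p - 2) * K * ((2 ^ k * L) powr (p - 2) * (2 ^ k * L) powr (- 4/d))"
          unfolding 1 by (simp only: mult_ac)
        then show ?thesis unfolding 2 c_def by (simp only: mult_ac)
      qed
      then show ?thesis using K by (simp add: ennreal_mult[symmetric] del: power_Suc)
    qed
    finally show "ennreal ((2 ^ Suc k * L) powr (p - 2)) * m (2 ^ k * L) \<le> ennreal (c * q ^ k)" .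
  qed auto
  also have "(\<Sum>k. ennreal (c * q ^ k)) = ennreal (c * (1 / (1 - q)))"
    using geometric_sums[of q] q c by (intro suminf_ennreal_eq sums_mult) auto
  also have "ennreal (L powr (p - 2)) * ennreal B + ennreal (c * (1 / (1 - q)))
      = ennreal (L powr (p - 2) * B + c * (1 / (1 - q)))"
    using B c q by (simp add: ennreal_mult[symmetric])
  also have "L powr (p - 2) * B + c * (1 / (1 - q)) = (1 + 2 powr (p - 2) * (4 * (4 / V) powr (2/d)) / (1 - q)) * (L powr (p - 2) * B)"
  proof -
    have "c = 2 powr (p - 2) * (K * L powr (- 4/d)) * L powr (p - 2)"
      unfolding c_def by (simp flip: powr_add)
    also have "K * L powr (- 4/d) = 4 * (4 / V) powr (2/d) * B"
    proof -
      have "L powr (- 4/d) = (A * B powr (2/d - 1)) powr (-1)" using d by (simp add: L_def powr_powr)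
      also have "\<dots> = 1 / (A * B powr (2/d - 1))" using A B by (simp add: powr_minus_divide)
      also have "B powr (2/d - 1) = B powr (2/d) / B" using B by (simp add: powr_diff)
      finally have "L powr (- 4/d) = B / (A * B powr (2/d))" by simp
      moreover have "(4 * B / V) powr (2/d) = (4 / V) powr (2/d) * B powr (2/d)"
        using B V by (simp add: powr_mult[symmetric])
      ultimately show ?thesis using A B by (simp add: K_def)
    qed
    finally show ?thesis using q by (simp add: field_simps)
  qed
  also have "L powr (p - 2) * B = A powr (d * (p - 2) / 4) * B powr (p / 2 - d * (p - 2) / 4)"
  proof -
    have "L powr (p - 2) = A powr (d * (p - 2) / 4) * B powr ((2/d - 1) * (d * (p - 2) / 4))"
      using A B by (simp add: L_def powr_powr powr_mult mult.assoc)
    also have "(2/d - 1) * (d * (p - 2) / 4) = p / 2 - d * (p - 2) / 4 - 1" using d by (simp add: field_simps)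
    finally show ?thesis using B by (simp add: powr_diff)
  qed
  finally show ?thesis unfolding q_def .
qed

text \<open>The auxiliary estimate is applied with the two integrals increased by 1 / (n + 1), to
  make them positive, and n tends to infinity. The exponents agree because of
  \<open>vartheta\<close>, and the factor M becomes the constant M^(2/p).\<close>

theorem gagliardo_nirenberg:
  assumes p: "2 < p" "p < 2 + 4 / real CARD('n::finite)"
  shows "\<exists>C\<ge>0. \<forall>u\<in>test_functions UNIV. gn_ineq C p (vartheta p CARD('n)) (u :: real^'n \<Rightarrow> real) (grad u)"
proof -
  define d where "d = real CARD('n)"
  have d: "d > 0" by (simp add: d_def)
  define t where "t = vartheta p CARD('n)"
  define M where "M = 1 + 2 powr (p - 2) * (4 * (4 / measure lborel (ball (0::real^'n) 1)) powr (2/d)) / (1 - 2 powr (p - 2 - 4/d))"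
  have M: "M \<ge> 0" unfolding M_def
    using p by (intro add_nonneg_nonneg divide_nonneg_nonneg) (auto simp: d_def powr_less_one less_imp_le)
  have al: "d * (p - 2) / 4 > 0" "p / 2 - d * (p - 2) / 4 > 0" using p d by (auto simp: d_def[symmetric] field_simps)
  have "gn_ineq (M powr (2/p)) p t u (grad u)" if u: "u \<in> test_functions UNIV" for u :: "real^'n \<Rightarrow> real"
  proof -
    define A B where "A = (LINT x|lborel. (norm (grad u x))\<^sup>2)" and "B = (LINT x|lborel. (u x)\<^sup>2)"
    have AB: "A \<ge> 0" "B \<ge> 0" unfolding A_def B_def by (auto intro!: Bochner_Integration.integral_nonneg)
    define e where "e n = 1 / real (Suc n)" for n
    have e: "e n > 0" for n by (simp add: e_def)
    have e0: "e \<longlonglongrightarrow> 0" unfolding e_def using LIMSEQ_inverse_real_of_nat by (simp add: inverse_eq_divide)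
    have "(\<lambda>n. M * ((A + e n) powr (d * (p - 2) / 4) * (B + e n) powr (p / 2 - d * (p - 2) / 4)))
      \<longlonglongrightarrow> M * ((A + 0) powr (d * (p - 2) / 4) * (B + 0) powr (p / 2 - d * (p - 2) / 4))"
      using al AB e by (intro tendsto_intros tendsto_powr' e0) (auto intro!: always_eventually add_nonneg_nonneg less_imp_le)
    then have "(\<lambda>n. ennreal (M * ((A + e n) powr (d * (p - 2) / 4) * (B + e n) powr (p / 2 - d * (p - 2) / 4))))
      \<longlonglongrightarrow> ennreal (M * (A powr (d * (p - 2) / 4) * B powr (p / 2 - d * (p - 2) / 4)))"
      by (intro tendsto_ennrealI) simp
    then have "(\<integral>\<^sup>+x. ennreal (\<bar>u x\<bar> powr p) \<partial>lborel) \<le> ennreal (M * (A powr (d * (p - 2) / 4) * B powr (p / 2 - d * (p - 2) / 4)))"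
    proof (rule LIMSEQ_le_const, intro exI allI impI)
      fix n
      have "A + e n > 0" "B + e n > 0" using AB e[of n] by auto
      then show "(\<integral>\<^sup>+x. ennreal (\<bar>u x\<bar> powr p) \<partial>lborel)
        \<le> ennreal (M * ((A + e n) powr (d * (p - 2) / 4) * (B + e n) powr (p / 2 - d * (p - 2) / 4)))"
        unfolding M_def d_def
        by (intro gagliardo_nirenberg_aux[OF u p]) (use e[of n] in \<open>auto simp: A_def B_def\<close>)
    qed
    also have "M * (A powr (d * (p - 2) / 4) * B powr (p / 2 - d * (p - 2) / 4)) = (M powr (2/p) * (A powr t * B powr (1 - t))) powr (p/2)"
    proof -
      have t: "t * (p/2) = d * (p - 2) / 4" "(1 - t) * (p/2) = p / 2 - d * (p - 2) / 4"
        using p by (auto simp: t_def vartheta_def d_def[symmetric] field_simps)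

      have "(M powr (2/p) * (A powr t * B powr (1 - t))) powr (p/2)
        = M powr (2/p * (p/2)) * (A powr (t * (p/2)) * B powr ((1 - t) * (p/2)))"
        using M AB by (simp only: powr_mult powr_powr powr_ge_zero mult_nonneg_nonneg)
      then show ?thesis using p M unfolding t by simp
    qed
    finally show ?thesis unfolding gn_ineq_def A_def B_def .
  qed
  then show ?thesis unfolding t_def by (intro exI[of _ "M powr (2/p)"]) auto
qed

subsection \<open>Interpolation on the line\<close>

text \<open>The functions are smooth and not merely C^1: they have to correspond exactly to the
  radial test functions on the punctured space.\<close>

definition Cc1 :: "(real \<Rightarrow> real) set" where
  "Cc1 = {v. smooth1 v \<and> (\<exists>R. \<forall>s. R < \<bar>s\<bar> \<longrightarrow> v s = 0)}"

text \<open>The support bound is relaxed from strict to non-strict so that v vanishes at the end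
  points of [-R, R] and no boundary terms survive in integrations by parts.\<close>

lemma Cc1E:
  assumes "v \<in> Cc1"
  obtains R where "R > 0" "smooth1 v" "\<And>s. R \<le> \<bar>s\<bar> \<Longrightarrow> v s = 0"
proof -
  from assms obtain R where "smooth1 v" "\<And>s. R < \<bar>s\<bar> \<Longrightarrow> v s = 0" by (auto simp: Cc1_def)
  then show ?thesis by (intro that[of "max 1 (R + 1)"]) auto
qed

lemma Cc1I: "smooth1 v \<Longrightarrow> (\<And>s. R < \<bar>s\<bar> \<Longrightarrow> v s = 0) \<Longrightarrow> v \<in> Cc1"
  by (auto simp: Cc1_def)

lemma smooth1_deriv_eq:
  assumes "smooth1 v"
  shows "(v has_real_derivative deriv v t) (at t)" "smooth1 (deriv v)"
proof -
  obtain w where w: "smooth1 w" "\<And>t. (v has_real_derivative w t) (at t)"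
    using smooth1_deriv[OF assms] by blast
  then have "deriv v = w" by (auto intro: DERIV_imp_deriv)
  with w show "(v has_real_derivative deriv v t) (at t)" "smooth1 (deriv v)" by auto
qed

lemma Cc1_deriv:
  assumes "v \<in> Cc1"
  shows "deriv v \<in> Cc1"
proof -
  obtain R where R: "R > 0" "smooth1 v" "\<And>s. R \<le> \<bar>s\<bar> \<Longrightarrow> v s = 0" using assms by (metis Cc1E)
  have "deriv v s = 0" if "R < \<bar>s\<bar>" for s
  proof -
    have "open {s. R < \<bar>s\<bar>}" by (intro open_Collect_less continuous_intros)
    with that have "\<forall>\<^sub>F y in nhds s. v y = 0" using R(3) by (auto simp: eventually_nhds)
    then have "(v has_real_derivative 0) (at s)" by (subst DERIV_cong_ev[OF refl _ refl]) auto
    then show ?thesis by (rule DERIV_imp_deriv)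
  qed
  then show ?thesis by (rule Cc1I[OF smooth1_deriv_eq(2)[OF R(2)]])
qed

lemma Cc1_mult_exp: "v \<in> Cc1 \<Longrightarrow> (\<lambda>s. exp (c * s) * v s) \<in> Cc1"
  unfolding Cc1_def by (auto intro: smooth1_mult smooth1_exp)

lemma Cc1_scale: "v \<in> Cc1 \<Longrightarrow> c > 0 \<Longrightarrow> (\<lambda>s. v (c * s)) \<in> Cc1"
proof -
  assume v: "v \<in> Cc1" and c: "c > 0"
  obtain R where R: "R > 0" "smooth1 v" "\<And>s. R \<le> \<bar>s\<bar> \<Longrightarrow> v s = 0" using v by (metis Cc1E)
  show ?thesis
  proof (rule Cc1I)
    show "smooth1 (\<lambda>s. v (c * s))" using smooth1_affine[OF R(2), of c 0] by simp
    show "v (c * s) = 0" if "R / c < \<bar>s\<bar>" for s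
      using that c by (intro R) (simp add: field_simps abs_mult)
  qed
qed

lemma Cc1_continuous: "v \<in> Cc1 \<Longrightarrow> continuous_on A v"
  by (auto simp: Cc1_def intro: continuous_on_subset smooth1_imp_continuous)

lemma Cc1_measurable: "v \<in> Cc1 \<Longrightarrow> v \<in> borel_measurable borel"
  by (intro borel_measurable_continuous_onI Cc1_continuous)

lemma Cc1_integrable:
  assumes v: "v \<in> Cc1" and g: "continuous_on UNIV g" "\<And>s. v s = 0 \<Longrightarrow> g s = 0"
  shows "integrable lborel (g :: real \<Rightarrow> real)"
proof -
  obtain R where R: "\<And>s. R \<le> \<bar>s\<bar> \<Longrightarrow> v s = 0" using v by (metis Cc1E)
  show ?thesis by (rule integrable_bounded_support[OF g(1), of R]) (use R g(2) in auto)
qed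

lemma Cc1_integrable_sq: "v \<in> Cc1 \<Longrightarrow> integrable lborel (\<lambda>s. (v s)\<^sup>2)"
  by (rule Cc1_integrable[of v]) (auto intro!: continuous_intros Cc1_continuous[of v])

lemma Cc1_nonzero:
  obtains v where "v \<in> Cc1" "v 0 > 0" "\<And>s. v s \<ge> 0"
proof (rule that[of "\<lambda>s. bump (1 * s + 1) * bump ((-1) * s + 1)"])
  show "(\<lambda>s. bump (1 * s + 1) * bump ((-1) * s + 1)) \<in> Cc1"
  proof (rule Cc1I[of _ 1])
    show "smooth1 (\<lambda>s. bump (1 * s + 1) * bump ((-1) * s + 1))"
      by (intro smooth1_mult smooth1_affine smooth1_bump)
  qed (auto simp: bump_eq_0_iff)
qed (auto simp: bump_pos_iff bump_nonneg)

lemma Cc1_integral_pos: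
  assumes v: "v \<in> Cc1" "v s0 \<noteq> 0" and g: "continuous_on UNIV g" "\<And>s. v s = 0 \<Longrightarrow> g s = 0"
    "\<And>s. g s \<ge> 0" "g s0 > 0"
  shows "(LINT s|lborel. g s :: real) > 0"
proof -
  have i: "integrable lborel g" by (rule Cc1_integrable[OF v(1) g(1,2)])
  have "(LINT s|lborel. g s) \<noteq> 0"
  proof
    assume "(LINT s|lborel. g s) = 0"
    then have "AE s in lborel. g s = 0" using integral_nonneg_eq_0_iff_AE[OF i] g(3) by simp
    then have "AE s in lborel. s \<notin> {s. 0 < g s}" by eventually_elim simp
    moreover have o: "open {s. 0 < g s}" by (intro open_Collect_less continuous_intros g)
    ultimately have "{s. 0 < g s} \<in> null_sets lborel" using AE_iff_null_sets[of "{s. 0 < g s}" lborel] by simp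
    then have "negligible {s. 0 < g s}" by (simp add: negligible_iff_null_sets null_sets_completionI)
    then show False using open_not_negligible[OF o] g(4) by blast
  qed
  moreover have "(LINT s|lborel. g s) \<ge> 0" by (rule Bochner_Integration.integral_nonneg) (use g in auto)
  ultimately show ?thesis by simp
qed

lemma integral_Cauchy_Schwarz:
  fixes f g :: "'a \<Rightarrow> real"
  assumes "integrable M (\<lambda>x. (f x)\<^sup>2)" "integrable M (\<lambda>x. (g x)\<^sup>2)" "integrable M (\<lambda>x. f x * g x)"
  shows "(LINT x|M. f x * g x)\<^sup>2 \<le> (LINT x|M. (f x)\<^sup>2) * (LINT x|M. (g x)\<^sup>2)"
proof -
  define X A B where "X = (LINT x|M. f x * g x)" and "A = (LINT x|M. (f x)\<^sup>2)" and "B = (LINT x|M. (g x)\<^sup>2)"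
  have q: "0 \<le> A * s\<^sup>2 - 2 * X * s * t + B * t\<^sup>2" for s t
  proof -
    have "0 \<le> (LINT x|M. (s * f x - t * g x)\<^sup>2)" by (rule Bochner_Integration.integral_nonneg) simp
    also have "(\<lambda>x. (s * f x - t * g x)\<^sup>2) = (\<lambda>x. s\<^sup>2 * (f x)\<^sup>2 - (2 * s * t) * (f x * g x) + t\<^sup>2 * (g x)\<^sup>2)"
      by (rule ext) (simp add: power2_eq_square algebra_simps)
    also have "(LINT x|M. \<dots> x) = s\<^sup>2 * A - (2 * s * t) * X + t\<^sup>2 * B"
      using assms by (simp add: A_def B_def X_def)
    finally show ?thesis by (simp add: mult_ac)
  qed
  show ?thesis unfolding X_def[symmetric] A_def[symmetric] B_def[symmetric]
  proof (cases "B = 0")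
    case True
    \<comment> \<open>With s = 1 and this t the quadratic form equals A - (A + 1) < 0, a
      contradiction unless X = 0.\<close>
    then show "X\<^sup>2 \<le> A * B" using q[of 1 "(A + 1) / (2 * X)"] by (cases "X = 0") (auto simp: field_simps)
  next
    case False
    have "B \<ge> 0" unfolding B_def by (rule Bochner_Integration.integral_nonneg) simp
    with False have B: "B > 0" by simp
    have "0 \<le> A * B\<^sup>2 - X\<^sup>2 * B" using q[of B X] by (simp add: power2_eq_square algebra_simps)
    then have "X\<^sup>2 * B \<le> (A * B) * B" by (simp add: power2_eq_square mult_ac)
    then show "X\<^sup>2 \<le> A * B" using B by (simp only: mult_le_cancel_right)
  qed
qed

text \<open>With \<open>F s = \<integral>\<^bsub>-\<infinity>\<^esub>\<^bsup>s\<^esup> v\<^sup>2\<close> as a new variable \<open>v\<^sup>2\<close> becomes a function on \<open>[0, M]\<close> vanishing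
  at both ends, and the sharp inequality is Cauchy--Schwarz after integrating by parts against
  \<open>F - M/2\<close>.\<close>

lemma gn_line_4:
  assumes v: "v \<in> Cc1"
  shows "(LINT s|lborel. v s ^ 4)\<^sup>2 \<le> (LINT s|lborel. (deriv v s)\<^sup>2) * (LINT s|lborel. (v s)\<^sup>2) ^ 3 / 3"
proof -
  obtain R where R: "R > 0" "smooth1 v" "\<And>s. R \<le> \<bar>s\<bar> \<Longrightarrow> v s = 0" using v by (metis Cc1E)
  note dv = smooth1_deriv_eq(1)[OF R(2)]
  have cv: "continuous_on A v" and cdv: "continuous_on A (deriv v)" for A
    using v by (auto intro: Cc1_continuous Cc1_deriv)
  define I where "I s = (indicator {-R..R} s :: real)" for s
  define M where "M = (LINT s|lborel. (v s)\<^sup>2)"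
  \<comment> \<open>The primitive of v^2 is centred so that it runs from - M/2 to M/2. Integration
    by parts would allow any additive constant; this one minimises \<integral>G^2 v^2, the value
    being M^3 / 12.\<close>
  define G where "G s = integral {-R..s} (\<lambda>y. (v y)\<^sup>2) - M / 2" for s
  have dG: "(G has_real_derivative (v s)\<^sup>2) (at s within {-R..R})" if "s \<in> {-R..R}" for s
    unfolding G_def using that
    by (auto intro!: derivative_eq_intros integral_has_real_derivative continuous_intros cv)
  then have cG: "continuous_on {-R..R} G"
    by (meson DERIV_continuous continuous_on_eq_continuous_within)
  have FTC: "(LINT s|lborel. I s * f s) = F R - F (-R)"
    if "\<And>s. s \<in> {-R..R} \<Longrightarrow> (F has_real_derivative f s) (at s within {-R..R})" "continuous_on {-R..R} f" for F f
  proof -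
    have "(LINT s|lborel. indicator {-R..R} s *\<^sub>R f s) = F R - F (-R)"
      using R that by (intro integral_FTC_atLeastAtMost)
        (auto simp: has_real_derivative_iff_has_vector_derivative[symmetric])
    then show ?thesis by (simp add: I_def)
  qed
  have Ii: "integrable lborel (\<lambda>s. I s * f s)" if "continuous_on {-R..R} f" for f
    using borel_integrable_atLeastAtMost'[OF that] by (simp add: I_def set_integrable_def)
  have Iv: "I s * (v s * y) = v s * y" for s y using R(3)[of s] by (cases "R \<le> \<bar>s\<bar>") (auto simp: I_def indicator_def not_le abs_less_iff)
  have "(LINT s|lborel. I s * (v s)\<^sup>2) = G R - G (-R)"
    by (rule FTC[OF dG]) (auto intro!: continuous_intros cv)
  then have GM: "G R - G (-R) = M" by (simp add: M_def power2_eq_square Iv)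
  have Gm: "G (-R) = - M / 2" by (simp add: G_def)
  with GM have Gp: "G R = M / 2" by simp
  have vR: "v R = 0" "v (-R) = 0" using R by auto
  define X where "X = (LINT s|lborel. I s * (deriv v s * (v s * G s)))"
  have "(LINT s|lborel. I s * (2 * (deriv v s * (v s * G s)) + v s ^ 4)) = (v R)\<^sup>2 * G R - (v (-R))\<^sup>2 * G (-R)"
  proof (rule FTC)
    show "((\<lambda>s. (v s)\<^sup>2 * G s) has_real_derivative 2 * (deriv v s * (v s * G s)) + v s ^ 4) (at s within {-R..R})"
      if "s \<in> {-R..R}" for s
      using dG[OF that] has_field_derivative_at_within[OF dv[of s], of "{-R..R}"]
      by (auto intro!: derivative_eq_intros simp: power2_eq_square power4_eq_xxxx algebra_simps)
  qed (intro continuous_intros cv cdv cG)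
  then have "(LINT s|lborel. 2 * (I s * (deriv v s * (v s * G s))) + I s * v s ^ 4) = 0"
    by (simp add: vR algebra_simps)
  moreover have "integrable lborel (\<lambda>s. I s * (deriv v s * (v s * G s)))" "integrable lborel (\<lambda>s. I s * v s ^ 4)"
    by (intro Ii continuous_intros cv cdv cG)+
  ultimately have "2 * X + (LINT s|lborel. I s * v s ^ 4) = 0" by (simp add: X_def)
  moreover have "I s * v s ^ 4 = v s ^ 4" for s using Iv[of s "v s ^ 3"] by (simp add: power4_eq_xxxx power3_eq_cube)
  ultimately have N: "(LINT s|lborel. v s ^ 4) = - 2 * X" by simp
  have "(LINT s|lborel. I s * ((G s)\<^sup>2 * (v s)\<^sup>2)) = (G R) ^ 3 / 3 - (G (-R)) ^ 3 / 3"
  proof (rule FTC)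
    show "((\<lambda>s. G s ^ 3 / 3) has_real_derivative (G s)\<^sup>2 * (v s)\<^sup>2) (at s within {-R..R})"
      if "s \<in> {-R..R}" for s
      using dG[OF that] by (auto intro!: derivative_eq_intros)
  qed (intro continuous_intros cv cG)
  then have G2: "(LINT s|lborel. I s * ((G s)\<^sup>2 * (v s)\<^sup>2)) = M ^ 3 / 12"
    unfolding Gp Gm by (simp add: power3_eq_cube field_simps)
  have II: "I s * I s = I s" for s by (simp add: I_def indicator_def)
  have "X = (LINT s|lborel. (deriv v s) * (I s * (v s * G s)))" by (simp add: X_def mult_ac)
  also have "\<dots>\<^sup>2 \<le> (LINT s|lborel. (deriv v s)\<^sup>2) * (LINT s|lborel. (I s * (v s * G s))\<^sup>2)"
  proof (rule integral_Cauchy_Schwarz)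
    show "integrable lborel (\<lambda>s. (deriv v s)\<^sup>2)" by (intro Cc1_integrable_sq Cc1_deriv v)
    have "(I s * (v s * G s))\<^sup>2 = I s * (v s * G s)\<^sup>2" for s by (simp add: I_def indicator_def)
    moreover have "integrable lborel (\<lambda>s. I s * (v s * G s)\<^sup>2)" by (intro Ii continuous_intros cv cG)
    ultimately show "integrable lborel (\<lambda>s. (I s * (v s * G s))\<^sup>2)" by simp
    have "integrable lborel (\<lambda>s. I s * (deriv v s * (v s * G s)))" by (intro Ii continuous_intros cv cdv cG)
    then show "integrable lborel (\<lambda>s. deriv v s * (I s * (v s * G s)))" by (simp add: mult_ac)
  qed
  also have "(\<lambda>s. (I s * (v s * G s))\<^sup>2) = (\<lambda>s. I s * ((G s)\<^sup>2 * (v s)\<^sup>2))"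
    by (rule ext) (simp add: I_def indicator_def power_mult_distrib)
  finally have "X\<^sup>2 \<le> (LINT s|lborel. (deriv v s)\<^sup>2) * (M ^ 3 / 12)" by (simp add: G2)
  then show ?thesis unfolding N M_def[symmetric] by (simp add: power_mult_distrib)
qed

text \<open>Hoelder's inequality with the weights \<open>al\<close> and \<open>be\<close>, which
  satisfy al + be = 1 and 2 al + 4 be = p. It is proved by integrating Young's inequality for the
  integrands normalised by X and Y.\<close>

lemma interpolation_2_4:
  assumes v: "v \<in> Cc1" and p: "2 < p" "p < 4" and nz: "v s0 \<noteq> 0"
  shows "(LINT s|lborel. \<bar>v s\<bar> powr p)
    \<le> (LINT s|lborel. (v s)\<^sup>2) powr ((4 - p) / 2) * (LINT s|lborel. v s ^ 4) powr ((p - 2) / 2)"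
proof -
  define X Y where "X = (LINT s|lborel. (v s)\<^sup>2)" and "Y = (LINT s|lborel. v s ^ 4)"
  have XY: "X > 0" "Y > 0" unfolding X_def Y_def
    using nz by (auto intro!: Cc1_integral_pos[OF v nz] continuous_intros Cc1_continuous[OF v])
  have i: "integrable lborel (\<lambda>s. (v s)\<^sup>2)" "integrable lborel (\<lambda>s. v s ^ 4)" "integrable lborel (\<lambda>s. \<bar>v s\<bar> powr p)"
    using p by (auto intro!: Cc1_integrable[OF v] continuous_intros Cc1_continuous[OF v] continuous_on_powr')
  define al be where "al = (4 - p) / 2" and "be = (p - 2) / 2"
  have ab: "0 \<le> al" "0 \<le> be" "al + be = 1" using p by (auto simp: al_def be_def field_simps)
  have pw: "\<bar>v s\<bar> powr p \<le> X powr al * Y powr be * (al / X * (v s)\<^sup>2 + be / Y * v s ^ 4)" for s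
  proof (cases "v s = 0")
    case False
    have "((v s)\<^sup>2 / X) powr al * (v s ^ 4 / Y) powr be \<le> al * ((v s)\<^sup>2 / X) + be * (v s ^ 4 / Y)"
      using ab XY False by (intro Youngs_inequality_0) auto
    moreover have "((v s)\<^sup>2) powr al * (v s ^ 4) powr be = \<bar>v s\<bar> powr p"
    proof -
      have "(v s)\<^sup>2 = \<bar>v s\<bar> powr 2" "v s ^ 4 = \<bar>v s\<bar> powr 4" using False by simp_all
      moreover have "2 * al + 4 * be = p" by (simp add: al_def be_def field_simps)
      ultimately show ?thesis by (simp only: powr_powr powr_add[symmetric])
    qed
    ultimately have "\<bar>v s\<bar> powr p / (X powr al * Y powr be) \<le> al / X * (v s)\<^sup>2 + be / Y * v s ^ 4"
      using XY by (simp add: powr_divide)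
    then show ?thesis using XY by (simp add: field_simps)
  qed (use XY ab in simp)
  have "(LINT s|lborel. \<bar>v s\<bar> powr p) \<le> (LINT s|lborel. X powr al * Y powr be * (al / X * (v s)\<^sup>2 + be / Y * v s ^ 4))"
    by (intro integral_mono i pw integrable_mult_right Bochner_Integration.integrable_add)
  also have "\<dots> = X powr al * Y powr be * (al / X * X + be / Y * Y)" using i by (simp add: X_def Y_def)
  also have "\<dots> = X powr al * Y powr be" using XY ab by simp
  finally show ?thesis unfolding X_def Y_def al_def be_def .
qed

text \<open>The exponents are forced by dilation on the line. The 1/3 comes from the exponent 4, and
  its power (p - 2) / (2 p) makes the constant tend to 1 as p tends to 2.\<close>

lemma gn_line:
  assumes v: "v \<in> Cc1" and p: "2 < p" "p < 4"
  shows "(LINT s|lborel. \<bar>v s\<bar> powr p) powr (2/p)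
    \<le> ((LINT s|lborel. (deriv v s)\<^sup>2) / 3) powr ((p - 2) / (2*p)) * (LINT s|lborel. (v s)\<^sup>2) powr (1 - (p - 2) / (2*p))"
proof (cases "\<forall>s. v s = 0")
  case True
  then show ?thesis using p by simp
next
  case False
  then obtain s0 where s0: "v s0 \<noteq> 0" by auto
  define A B Y where "A = (LINT s|lborel. (deriv v s)\<^sup>2)" and "B = (LINT s|lborel. (v s)\<^sup>2)" and "Y = (LINT s|lborel. v s ^ 4)"
  have BY: "B > 0" "Y > 0" unfolding B_def Y_def
    using s0 by (auto intro!: Cc1_integral_pos[OF v s0] continuous_intros Cc1_continuous[OF v])
  have A: "A \<ge> 0" unfolding A_def by (rule Bochner_Integration.integral_nonneg) simp
  have "Y\<^sup>2 \<le> (A / 3) * B ^ 3" using gn_line_4[OF v] by (simp add: A_def B_def Y_def)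
  then have "(Y\<^sup>2) powr (1/2) \<le> ((A / 3) * B ^ 3) powr (1/2)" by (intro powr_mono2) auto
  also have "(Y\<^sup>2) powr (1/2) = Y" using BY by (simp add: powr_half_sqrt)
  also have "((A / 3) * B ^ 3) powr (1/2) = (A / 3) powr (1/2) * B powr (3/2)"
  proof -
    have "B ^ 3 = B powr 3" using BY by simp
    then show ?thesis using A BY by (simp only: powr_mult powr_powr divide_nonneg_nonneg) simp
  qed
  finally have Y: "Y \<le> (A / 3) powr (1/2) * B powr (3/2)" .
  have "(LINT s|lborel. \<bar>v s\<bar> powr p) \<le> B powr ((4 - p) / 2) * Y powr ((p - 2) / 2)"
    using interpolation_2_4[OF v p s0] by (simp add: B_def Y_def)
  also have "\<dots> \<le> B powr ((4 - p) / 2) * ((A / 3) powr (1/2) * B powr (3/2)) powr ((p - 2) / 2)"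
    using Y BY p by (intro mult_left_mono powr_mono2) auto
  finally have "(LINT s|lborel. \<bar>v s\<bar> powr p) powr (2/p) \<le> (B powr ((4 - p) / 2) * ((A / 3) powr (1/2) * B powr (3/2)) powr ((p - 2) / 2)) powr (2/p)"
    using p by (intro powr_mono2) (auto intro: Bochner_Integration.integral_nonneg)
  also have "\<dots> = (A / 3) powr (1/2 * ((p - 2) / 2) * (2/p)) * B powr ((4 - p) / 2 * (2/p) + 3/2 * ((p - 2) / 2) * (2/p))"
    using A BY by (simp only: powr_mult powr_powr powr_add mult_nonneg_nonneg powr_ge_zero mult_ac)
  also have "1/2 * ((p - 2) / 2) * (2/p) = (p - 2) / (2*p)" using p by (simp add: field_simps)
  also have "(4 - p) / 2 * (2/p) + 3/2 * ((p - 2) / 2) * (2/p) = 1 - (p - 2) / (2*p)" using p by (simp add: field_simps)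
  finally show ?thesis by (simp add: A_def B_def)
qed

subsection \<open>Emden--Fowler coordinates\<close>

definition sphere_area :: "nat \<Rightarrow> real" where
  "sphere_area d = real d * unit_ball_vol (real d)"

lemma sphere_area_pos: "d > 0 \<Longrightarrow> sphere_area d > 0"
  by (simp add: sphere_area_def)

text \<open>Polar coordinates as an image measure. The sign in - ln |x| turns upper half-lines into
  preimages that are balls around 0, up to the origin, and these have finite measure; that is what
  comparing two measures on half-lines requires.\<close>

lemma distr_neg_ln_norm:
  "distr lborel borel (\<lambda>x::real^'n. - ln (norm x))
    = density lborel (\<lambda>s. ennreal (sphere_area CARD('n) * exp (- (real CARD('n) * s))))"
proof (rule measure_eqI_lessThan)
  let ?d = "real CARD('n)" and ?V = "unit_ball_vol (real CARD('n))"
  have ball: "emeasure (distr lborel borel (\<lambda>x::real^'n. - ln (norm x))) {t<..} = ennreal (?V * exp (- (?d * t)))" for t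
  proof -
    have "emeasure (distr lborel borel (\<lambda>x::real^'n. - ln (norm x))) {t<..}
        = emeasure lborel {x::real^'n. t < - ln (norm x)}"
      by (subst emeasure_distr) (auto simp: vimage_def)
    also have "\<dots> = emeasure lborel (ball (0::real^'n) (exp (- t)))"
    proof (rule emeasure_eq_AE)
      have "AE x::real^'n in lborel. x \<noteq> 0" by (rule AE_lborel_singleton)
      then show "AE x::real^'n in lborel. x \<in> {x. t < - ln (norm x)} \<longleftrightarrow> x \<in> ball 0 (exp (- t))"
      proof eventually_elim
        case (elim x)
        have "t < - ln (norm x) \<longleftrightarrow> ln (norm x) < ln (exp (- t))" by auto
        also have "\<dots> \<longleftrightarrow> norm x < exp (- t)" using elim by (subst ln_less_cancel_iff) auto
        finally show ?case by simp
      qed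
    qed auto
    also have "\<dots> = ennreal (?V * exp (- t) ^ CARD('n))" by (simp add: emeasure_ball)
    also have "exp (- t) ^ CARD('n) = exp (- (?d * t))" by (simp add: exp_of_nat_mult[symmetric])
    finally show ?thesis .
  qed
  show "emeasure (distr lborel borel (\<lambda>x::real^'n. - ln (norm x))) {t<..} < \<infinity>" for t
    by (simp add: ball)
  show "emeasure (distr lborel borel (\<lambda>x::real^'n. - ln (norm x))) {t<..}
      = emeasure (density lborel (\<lambda>s. ennreal (sphere_area CARD('n) * exp (- (?d * s))))) {t<..}" for t
  proof -
    have "emeasure (density lborel (\<lambda>s. ennreal (sphere_area CARD('n) * exp (- (?d * s))))) {t<..}
        = (\<integral>\<^sup>+s. ennreal (sphere_area CARD('n) * exp (- (?d * s))) * indicator {t<..} s \<partial>lborel)"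
      by (subst emeasure_density) auto
    also have "\<dots> = (\<integral>\<^sup>+s. ennreal (sphere_area CARD('n) * exp (- (?d * s))) * indicator {t..} s \<partial>lborel)"
    proof (rule nn_integral_cong_AE)
      have "AE s in lborel. s \<noteq> t" by (rule AE_lborel_singleton)
      then show "AE s in lborel. ennreal (sphere_area CARD('n) * exp (- (?d * s))) * indicator {t<..} s
          = ennreal (sphere_area CARD('n) * exp (- (?d * s))) * indicator {t..} s"
        by eventually_elim (auto simp: indicator_def)
    qed
    also have "\<dots> = ennreal (0 - (- ?V * exp (- (?d * t))))"
    proof (rule nn_integral_FTC_atLeast)
      show "DERIV (\<lambda>s. - ?V * exp (- (?d * s))) s :> sphere_area CARD('n) * exp (- (?d * s))" for s
        by (auto intro!: derivative_eq_intros simp: sphere_area_def)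
      have "filterlim (\<lambda>s. ?d * s) at_top at_top"
        by (rule filterlim_tendsto_pos_mult_at_top[OF tendsto_const _ filterlim_ident]) simp
      then have "((\<lambda>s. exp (- (?d * s))) \<longlongrightarrow> 0) at_top"
        by (intro filterlim_compose[OF exp_at_bot] filterlim_uminus_at_top[THEN iffD1])
      then show "((\<lambda>s. - ?V * exp (- (?d * s))) \<longlongrightarrow> 0) at_top" by (rule tendsto_mult_right_zero)
    qed (auto simp: sphere_area_def)
    finally show ?thesis by (simp add: ball)
  qed
qed auto

lemma integral_log_polar:
  fixes g :: "real \<Rightarrow> real"
  assumes [measurable]: "g \<in> borel_measurable borel"
    and f: "\<And>x::real^'n. x \<noteq> 0 \<Longrightarrow> f x = g (ln (norm x))" "f \<in> borel_measurable borel"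
  shows "(LINT x|lborel. f x) = sphere_area CARD('n) * (LINT s|lborel. exp (real CARD('n) * s) * g s)"
proof -
  let ?d = "real CARD('n)"
  have "(LINT x|lborel. f x) = (LINT x|lborel. g (- (- ln (norm (x::real^'n)))))"
  proof (rule integral_cong_AE)
    have "AE x::real^'n in lborel. x \<noteq> 0" by (rule AE_lborel_singleton)
    then show "AE x in lborel. f x = g (- (- ln (norm x)))" by eventually_elim (simp add: f)
  qed (use f in simp_all)
  also have "\<dots> = (LINT s|distr lborel borel (\<lambda>x::real^'n. - ln (norm x)). g (- s))"
    by (subst integral_distr) auto
  also have "\<dots> = (LINT s|lborel. (sphere_area CARD('n) * exp (- (?d * s))) * g (- s))"
    unfolding distr_neg_ln_norm by (subst integral_density) (auto simp: sphere_area_def)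
  also have "\<dots> = (LINT s|lborel. (sphere_area CARD('n) * exp (?d * s)) * g s)"
    using integral_lborel_shift(3)[of "\<lambda>s. (sphere_area CARD('n) * exp (?d * s)) * g s" 0] by simp
  finally show ?thesis by (simp add: mult.assoc)
qed

text \<open>The cross term is a multiple of the derivative of v^2 and integrates to 0. This is where
  the term \<Lambda>(a) = (a_c - a)^2 of the energy comes from.\<close>

lemma integral_deriv_sq_twist:
  assumes v: "v \<in> Cc1"
  shows "(LINT s|lborel. (deriv v s - m * v s)\<^sup>2) = (LINT s|lborel. (deriv v s)\<^sup>2) + m\<^sup>2 * (LINT s|lborel. (v s)\<^sup>2)"
proof -
  obtain R where R: "R > 0" "smooth1 v" "\<And>s. R \<le> \<bar>s\<bar> \<Longrightarrow> v s = 0" using v by (metis Cc1E)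
  note dv = smooth1_deriv_eq(1)[OF R(2)]
  have cv: "continuous_on A v" and cdv: "continuous_on A (deriv v)" for A
    using v by (auto intro: Cc1_continuous Cc1_deriv)
  have i: "integrable lborel (\<lambda>s. v s * deriv v s)"
    by (rule Cc1_integrable[OF v]) (auto intro!: continuous_intros cv cdv)
  have "(LINT s|lborel. indicator {-R..R} s *\<^sub>R (2 * (v s * deriv v s))) = (v R)\<^sup>2 - (v (-R))\<^sup>2"
  proof (rule integral_FTC_atLeastAtMost)
    show "((\<lambda>s. (v s)\<^sup>2) has_vector_derivative 2 * (v s * deriv v s)) (at s within {-R..R})" for s
      unfolding has_real_derivative_iff_has_vector_derivative[symmetric]
      using has_field_derivative_at_within[OF dv[of s], of "{-R..R}"] by (auto intro!: derivative_eq_intros)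
  qed (use R in \<open>auto intro!: continuous_intros cv cdv\<close>)
  moreover have "(\<lambda>s. indicator {-R..R} s *\<^sub>R (2 * (v s * deriv v s))) = (\<lambda>s. 2 * (v s * deriv v s))"
  proof
    fix s
    show "indicator {-R..R} s *\<^sub>R (2 * (v s * deriv v s)) = 2 * (v s * deriv v s)"
      using R(3)[of s] by (cases "R \<le> \<bar>s\<bar>") (auto simp: indicator_def not_le abs_less_iff)
  qed
  ultimately have 0: "(LINT s|lborel. v s * deriv v s) = 0" using R by simp
  have "(\<lambda>s. (deriv v s - m * v s)\<^sup>2) = (\<lambda>s. (deriv v s)\<^sup>2 - 2 * m * (v s * deriv v s) + m\<^sup>2 * (v s)\<^sup>2)"
    by (rule ext) (simp add: power2_eq_square algebra_simps)
  then show ?thesis using i 0 Cc1_integrable_sq[OF v] Cc1_integrable_sq[OF Cc1_deriv[OF v]] by simp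
qed

lemma grad_log_radial:
  fixes u :: "real^'n \<Rightarrow> real"
  assumes u: "\<And>x. x \<noteq> 0 \<Longrightarrow> u x = w (ln (norm x))" and w: "smooth1 w" and x: "x \<noteq> 0"
  shows "(u has_derivative (\<lambda>h. ((deriv w (ln (norm x)) / (norm x)\<^sup>2) *\<^sub>R x) \<bullet> h)) (at x)"
proof -
  have "((\<lambda>x. ln (norm x)) has_derivative (\<lambda>h. (inverse (norm x)) * ((x \<bullet> h) / norm x))) (at x)"
  proof -
    have "(norm has_derivative (\<lambda>h. (x \<bullet> h) / norm x)) (at x)"
      using has_derivative_norm[OF x] by (simp add: sgn_div_norm inner_commute divide_inverse_commute)
    then show ?thesis
      using x by (auto intro!: derivative_eq_intros simp: divide_inverse)
  qed
  from DERIV_compose_FDERIV[OF smooth1_deriv_eq(1)[OF w] this]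
  have "((\<lambda>x. w (ln (norm x))) has_derivative (\<lambda>h. ((deriv w (ln (norm x)) / (norm x)\<^sup>2) *\<^sub>R x) \<bullet> h)) (at x)"
    by (rule has_derivative_eq_rhs) (auto simp: power2_eq_square field_simps)
  then show ?thesis
    by (rule has_derivative_transform_within_open[where s = "- {0}"]) (use x u in auto)
qed

text \<open>The exponential factor in v absorbs the weights together with the volume element exp(d
  s). The exponents match because d - 2 (a + 1) = 2 (a_c - a), and because d - b p = p (a_c - a),
  which is how b was chosen.\<close>

lemma radial_integrals:
  fixes u :: "real^'n \<Rightarrow> real" and a p :: real
  assumes u: "\<And>x. x \<noteq> 0 \<Longrightarrow> u x = w (ln (norm x))" and w: "w \<in> Cc1" and sm: "smooth u" and p: "p > 0"
  defines "d \<equiv> CARD('n)"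
  defines "v \<equiv> (\<lambda>s. exp ((a_crit d - a) * s) * w s)"
  shows "(LINT x|lborel. \<bar>norm x powr (- b_exp d p a) * u x\<bar> powr p) = sphere_area d * (LINT s|lborel. \<bar>v s\<bar> powr p)"
    and "(LINT x|lborel. (norm (norm x powr (- a) *\<^sub>R grad u x))\<^sup>2)
      = sphere_area d * ((LINT s|lborel. (deriv v s)\<^sup>2) + (a_crit d - a)\<^sup>2 * (LINT s|lborel. (v s)\<^sup>2))"
    and "(LINT x|lborel. (norm x powr (- (a + 1)) * u x)\<^sup>2) = sphere_area d * (LINT s|lborel. (v s)\<^sup>2)"
proof -
  have sw: "smooth1 w" using w by (simp add: Cc1_def)
  have [measurable]: "u \<in> borel_measurable borel" "grad u \<in> borel_measurable borel"
    using sm by (auto intro: smooth_measurable grad_measurable)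
  have [measurable]: "w \<in> borel_measurable borel" "deriv w \<in> borel_measurable borel"
    using w by (auto intro: Cc1_measurable Cc1_deriv)
  have nx: "norm x powr c = exp (c * ln (norm x))" if "x \<noteq> 0" for x :: "real^'n" and c
    using that by (simp add: powr_def)
  have "(LINT x|lborel. \<bar>norm x powr (- b_exp d p a) * u x\<bar> powr p)
    = sphere_area d * (LINT s|lborel. exp (real d * s) * \<bar>exp (- b_exp d p a * s) * w s\<bar> powr p)"
    unfolding d_def by (rule integral_log_polar) (auto simp: nx u)
  also have "(\<lambda>s. exp (real d * s) * \<bar>exp (- b_exp d p a * s) * w s\<bar> powr p) = (\<lambda>s. \<bar>v s\<bar> powr p)"
  proof
    fix s
    have "exp (real d * s) * \<bar>exp (- b_exp d p a * s) * w s\<bar> powr p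
      = exp (real d * s) * (exp (- b_exp d p a * s) powr p * \<bar>w s\<bar> powr p)"
      by (simp add: abs_mult powr_mult)
    also have "\<dots> = exp (real d * s - b_exp d p a * s * p) * \<bar>w s\<bar> powr p"
    proof -
      have "exp (- b_exp d p a * s) powr p = exp (- (b_exp d p a * s * p))" by (simp add: powr_def)
      then show ?thesis by (simp add: exp_diff exp_minus field_simps)
    qed
    also have "real d * s - b_exp d p a * s * p = p * ((a_crit d - a) * s)"
      using p by (simp add: b_exp_def field_simps)
    also have "exp (p * ((a_crit d - a) * s)) * \<bar>w s\<bar> powr p = \<bar>v s\<bar> powr p"
      by (simp add: v_def abs_mult powr_mult powr_def[of "exp _"])
    finally show "exp (real d * s) * \<bar>exp (- b_exp d p a * s) * w s\<bar> powr p = \<bar>v s\<bar> powr p" .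
  qed
  finally show "(LINT x|lborel. \<bar>norm x powr (- b_exp d p a) * u x\<bar> powr p) = sphere_area d * (LINT s|lborel. \<bar>v s\<bar> powr p)" .
  have "(LINT x|lborel. (norm x powr (- (a + 1)) * u x)\<^sup>2)
    = sphere_area d * (LINT s|lborel. exp (real d * s) * (exp (- (a + 1) * s) * w s)\<^sup>2)"
    unfolding d_def by (rule integral_log_polar) (auto simp: nx u)
  also have "(\<lambda>s. exp (real d * s) * (exp (- (a + 1) * s) * w s)\<^sup>2) = (\<lambda>s. (v s)\<^sup>2)"
  proof
    fix s
    have "exp (real d * s) * (exp (- (a + 1) * s) * w s)\<^sup>2 = exp (real d * s + (- (a + 1) * s) + (- (a + 1) * s)) * (w s)\<^sup>2"
      by (simp only: exp_add power_mult_distrib power2_eq_square mult_ac)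
    also have "real d * s + (- (a + 1) * s) + (- (a + 1) * s) = (a_crit d - a) * s + (a_crit d - a) * s"
      by (simp add: a_crit_def field_simps)
    also have "exp ((a_crit d - a) * s + (a_crit d - a) * s) * (w s)\<^sup>2 = (v s)\<^sup>2"
      by (simp only: v_def exp_add power_mult_distrib power2_eq_square mult_ac)
    finally show "exp (real d * s) * (exp (- (a + 1) * s) * w s)\<^sup>2 = (v s)\<^sup>2" .
  qed
  finally show "(LINT x|lborel. (norm x powr (- (a + 1)) * u x)\<^sup>2) = sphere_area d * (LINT s|lborel. (v s)\<^sup>2)" .
  have v: "v \<in> Cc1" unfolding v_def by (rule Cc1_mult_exp[OF w])
  have dv: "deriv v s = (a_crit d - a) * v s + exp ((a_crit d - a) * s) * deriv w s" for s
  proof (rule DERIV_imp_deriv)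
    show "(v has_real_derivative (a_crit d - a) * v s + exp ((a_crit d - a) * s) * deriv w s) (at s)"
      unfolding v_def by (auto intro!: derivative_eq_intros smooth1_deriv_eq(1)[OF sw] simp: algebra_simps)
  qed
  have g: "norm (grad u x) = \<bar>deriv w (ln (norm x))\<bar> / norm x" if "x \<noteq> 0" for x
  proof -
    have "grad u x = (deriv w (ln (norm x)) / (norm x)\<^sup>2) *\<^sub>R x"
      by (rule grad_eqI[OF grad_log_radial[OF u sw that]])
    then show ?thesis using that by (simp add: power2_eq_square)
  qed
  have "(LINT x|lborel. (norm (norm x powr (- a) *\<^sub>R grad u x))\<^sup>2)
    = sphere_area d * (LINT s|lborel. exp (real d * s) * (exp (- (a + 1) * s) * deriv w s)\<^sup>2)"
    unfolding d_def
  proof (rule integral_log_polar)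
    fix x :: "real^'n" assume x: "x \<noteq> 0"
    have "norm (norm x powr (- a) *\<^sub>R grad u x) = norm x powr (- a) * norm x powr (- 1) * \<bar>deriv w (ln (norm x))\<bar>"
      using x by (simp add: g powr_minus_divide[of _ 1])
    also have "norm x powr (- a) * norm x powr (- 1) = exp (- (a + 1) * ln (norm x))"
      by (simp only: nx[OF x] exp_add[symmetric]) (simp add: algebra_simps)
    finally show "(norm (norm x powr (- a) *\<^sub>R grad u x))\<^sup>2 = (exp (- (a + 1) * ln (norm x)) * deriv w (ln (norm x)))\<^sup>2"
      by (simp add: power_mult_distrib)
  qed auto
  also have "(\<lambda>s. exp (real d * s) * (exp (- (a + 1) * s) * deriv w s)\<^sup>2) = (\<lambda>s. (deriv v s - (a_crit d - a) * v s)\<^sup>2)"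
  proof
    fix s
    have "exp (real d * s) * (exp (- (a + 1) * s) * deriv w s)\<^sup>2 = exp (real d * s + (- (a + 1) * s) + (- (a + 1) * s)) * (deriv w s)\<^sup>2"
      by (simp only: exp_add power_mult_distrib power2_eq_square mult_ac)
    also have "real d * s + (- (a + 1) * s) + (- (a + 1) * s) = (a_crit d - a) * s + (a_crit d - a) * s"
      by (simp add: a_crit_def field_simps)
    also have "exp ((a_crit d - a) * s + (a_crit d - a) * s) * (deriv w s)\<^sup>2 = (exp ((a_crit d - a) * s) * deriv w s)\<^sup>2"
      by (simp only: exp_add power_mult_distrib power2_eq_square mult_ac)
    finally show "exp (real d * s) * (exp (- (a + 1) * s) * deriv w s)\<^sup>2 = (deriv v s - (a_crit d - a) * v s)\<^sup>2"
      by (simp add: dv)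
  qed
  also have "(LINT s|lborel. (deriv v s - (a_crit d - a) * v s)\<^sup>2) = (LINT s|lborel. (deriv v s)\<^sup>2) + (a_crit d - a)\<^sup>2 * (LINT s|lborel. (v s)\<^sup>2)"
    by (rule integral_deriv_sq_twist[OF v])
  finally show "(LINT x|lborel. (norm (norm x powr (- a) *\<^sub>R grad u x))\<^sup>2)
      = sphere_area d * ((LINT s|lborel. (deriv v s)\<^sup>2) + (a_crit d - a)\<^sup>2 * (LINT s|lborel. (v s)\<^sup>2))" .
qed

section \<open>Radial test functions as functions on the line\<close>

lemma radial_test_log:
  fixes u :: "real^'n \<Rightarrow> real"
  assumes u: "u \<in> test_functions (- {0})" "radial u"
  obtains w where "w \<in> Cc1" "\<And>x. x \<noteq> 0 \<Longrightarrow> u x = w (ln (norm x))"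
proof -
  obtain r where r: "r > 0" "\<And>x. norm x < r \<Longrightarrow> u x = 0" "u \<in> test_functions UNIV"
    using u(1) by (auto simp: test_functions_punctured_iff)
  obtain R where R: "R > 0" "smooth u" "\<And>x. R < norm x \<Longrightarrow> u x = 0" using r(3) by (metis test_functionsE)
  define i :: 'n where "i = undefined"
  define e where "e = (axis i 1 :: real^'n)"
  have e: "norm e = 1" by (simp add: e_def)
  define w where "w s = u (exp s *\<^sub>R e)" for s
  have "smooth1 w"
  \<comment> \<open>Restrictions of smooth functions to the ray through e, in the variable s = ln
    |x|, are closed under differentiation: d/ds becomes the vector field x_i times the i-th partial
    derivative.\<close>
  proof (rule smooth1_coinduct[where S = "(\<lambda>v s. v (exp s *\<^sub>R e)) ` Collect smooth"])
    show "w \<in> (\<lambda>v s. v (exp s *\<^sub>R e)) ` Collect smooth" using R(2) by (auto simp: w_def[abs_def])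
    fix f assume "f \<in> (\<lambda>v s. v (exp s *\<^sub>R e)) ` Collect smooth"
    then obtain v where v: "smooth v" "f = (\<lambda>s. v (exp s *\<^sub>R e))" by auto
    show "\<exists>g\<in>(\<lambda>v s. v (exp s *\<^sub>R e)) ` Collect smooth. \<forall>t. (f has_real_derivative g t) (at t)"
    proof (intro bexI[of _ "\<lambda>s. (\<lambda>x. x $ i * partial i v x) (exp s *\<^sub>R e)"] allI)
      fix t
      have "((\<lambda>s. v (exp s *\<^sub>R e)) has_derivative (\<lambda>h. grad v (exp t *\<^sub>R e) \<bullet> ((exp t * h) *\<^sub>R e))) (at t)"
        by (rule has_derivative_compose[where g = v and f = "\<lambda>s. exp s *\<^sub>R e"])
           (auto intro!: derivative_eq_intros has_derivative_grad smooth_differentiable[OF v(1)])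
      then show "(f has_real_derivative (\<lambda>x. x $ i * partial i v x) (exp t *\<^sub>R e)) (at t)"
        unfolding has_field_derivative_def v(2)
        by (rule has_derivative_eq_rhs) (auto simp: e_def inner_axis grad_def)
      show "(\<lambda>s. (\<lambda>x. x $ i * partial i v x) (exp s *\<^sub>R e)) \<in> (\<lambda>v s. v (exp s *\<^sub>R e)) ` Collect smooth"
        using v(1) by (intro image_eqI[of _ _ "\<lambda>x. x $ i * partial i v x"]) (auto intro!: smooth_mult smooth_partial)
    qed
  qed
  moreover have "w s = 0" if "max (ln R) (- ln r) < \<bar>s\<bar>" for s
  proof (cases "s \<ge> 0")
    case True
    with that have "exp (ln R) < exp s" by (subst exp_less_cancel_iff) simp
    then show ?thesis using R e by (simp add: w_def)
  next
    case False
    with that have "exp s < exp (ln r)" by (subst exp_less_cancel_iff) simp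
    then show ?thesis using r e by (simp add: w_def)
  qed
  ultimately have "w \<in> Cc1" by (rule Cc1I)
  moreover have "u x = w (ln (norm x))" if "x \<noteq> 0" for x
  proof -
    have "norm x = norm (exp (ln (norm x)) *\<^sub>R e)" using e that by simp
    then show ?thesis using u(2) unfolding radial_def w_def by blast
  qed
  ultimately show ?thesis by (rule that)
qed

text \<open>The norm is not smooth at 0, so u is written as a function of |x|^2: with t = |x|^2 one
  has ln |x| = ln t / 2. Since w vanishes near minus infinity, the function of t vanishes near t = 0
  and extends by 0 to all real t.\<close>

lemma log_radial_test:
  assumes w: "w \<in> Cc1"
  obtains u :: "real^'n \<Rightarrow> real" where "u \<in> test_functions (- {0})" "radial u" "\<And>x. x \<noteq> 0 \<Longrightarrow> u x = w (ln (norm x))"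
proof -
  obtain R where R: "R > 0" "smooth1 w" "\<And>s. R \<le> \<bar>s\<bar> \<Longrightarrow> w s = 0" using w by (metis Cc1E)
  define L where "L f t = (if t > 0 then f (ln t / 2) else 0)" for f :: "real \<Rightarrow> real" and t :: real
  have L0: "L f t = 0" if f: "\<And>s. R' \<le> \<bar>s\<bar> \<Longrightarrow> f s = 0" and "t < exp (- 2 * R')" "R' > 0" for f t R'
  proof (cases "t > 0")
    case True
    then have "ln t < ln (exp (- 2 * R'))" using that by (subst ln_less_cancel_iff) auto
    then show ?thesis using that by (auto simp: L_def intro!: f)
  qed (simp add: L_def)
  have sm: "smooth1 (L w)"
  proof (rule smooth1_coinduct[where S = "L ` Cc1"])
    show "L w \<in> L ` Cc1" using w by blast
    fix f assume "f \<in> L ` Cc1"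
    then obtain v where v: "v \<in> Cc1" "f = L v" by auto
    obtain R' where R': "R' > 0" "smooth1 v" "\<And>s. R' \<le> \<bar>s\<bar> \<Longrightarrow> v s = 0" using v(1) by (metis Cc1E)
    \<comment> \<open>From t = exp(2 s) follows d/dt = (1/2) exp(-2 s) d/ds, so differentiating
      \<open>L v\<close> again gives L of a member of \<open>Cc1\<close>.\<close>
    define v' where "v' s = (1/2) * (exp ((-2) * s) * deriv v s)" for s
    have v': "v' \<in> Cc1"
    proof -
      have "(\<lambda>s. exp ((-2) * s) * deriv v s) \<in> Cc1" by (intro Cc1_mult_exp Cc1_deriv v)
      moreover have "smooth1 (\<lambda>s. 1 / 2)"
        by (rule smooth1_coinduct[where S = "range (\<lambda>c s. c)"]) (auto intro!: exI[of _ 0])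
      ultimately have "smooth1 v'" using smooth1_mult[of "\<lambda>s. 1 / 2" "\<lambda>s. exp ((-2) * s) * deriv v s"]
        by (simp add: v'_def[abs_def] Cc1_def)
      moreover obtain R'' where "\<And>s. R'' \<le> \<bar>s\<bar> \<Longrightarrow> deriv v s = 0" using Cc1_deriv[OF v(1)] by (metis Cc1E)
      ultimately show ?thesis by (intro Cc1I[of v' R'']) (auto simp: v'_def)
    qed
    have "(L v has_real_derivative L v' t) (at t)" for t
    proof (cases "t > 0")
      case True
      have "((\<lambda>t. v (ln t / 2)) has_real_derivative deriv v (ln t / 2) * (1 / t / 2)) (at t)"
        by (rule DERIV_chain2[OF smooth1_deriv_eq(1)[OF R'(2)]])
           (use True in \<open>auto intro!: derivative_eq_intros\<close>)
      moreover have "deriv v (ln t / 2) * (1 / t / 2) = L v' t"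
        using True by (simp add: L_def v'_def exp_minus field_simps)
      moreover have "\<forall>\<^sub>F s in nhds t. L v s = v (ln s / 2)"
        using eventually_nhds_in_open[of "{0<..}" t] True by (simp add: L_def eventually_mono)
      ultimately show ?thesis by (subst DERIV_cong_ev[OF refl _ refl]) auto
    next
      case False
      have "t < exp (- 2 * R')" using False by (meson exp_gt_zero linorder_not_less order_le_less_trans)
      then have "\<forall>\<^sub>F s in nhds t. s \<in> {..<exp (- 2 * R')}" by (intro eventually_nhds_in_open) auto
      then have "\<forall>\<^sub>F s in nhds t. L v s = 0"
        by eventually_elim (use R' in \<open>auto intro: L0[of R' v]\<close>)
      moreover have "L v' t = 0" using False by (simp add: L_def)
      ultimately show ?thesis by (subst DERIV_cong_ev[OF refl _ refl]) auto
    qed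
    with v' v(2) show "\<exists>g\<in>L ` Cc1. \<forall>t. (f has_real_derivative g t) (at t)" by blast
  qed
  define u where "u x = L w (x \<bullet> x)" for x :: "real^'n"
  have eq: "u x = w (ln (norm x))" if "x \<noteq> 0" for x
    using that by (simp add: u_def L_def power2_norm_eq_inner[symmetric] ln_realpow)
  have su: "smooth u" unfolding u_def by (intro smooth_compose[OF sm] smooth_inner_self)
  have "u x = 0" if "exp R < norm x" for x
  proof -
    have x: "x \<noteq> 0" using that by auto
    have "ln (exp R) < ln (norm x)" using that x by (subst ln_less_cancel_iff) auto
    then show ?thesis using eq[OF x] R by simp
  qed
  then have t: "u \<in> test_functions UNIV" by (rule test_functionsI[OF su])
  have "u x = 0" if "norm x < exp (- R)" for x
  proof (cases "x = 0")
    case False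
    have "ln (norm x) < ln (exp (- R))" using that False by (subst ln_less_cancel_iff) auto
    then show ?thesis using eq[OF False] R by simp
  qed (simp add: u_def L_def)
  then have "u \<in> test_functions (- {0})"
    using t by (auto simp: test_functions_punctured_iff intro!: exI[of _ "exp (- R)"])
  moreover have "radial u" unfolding radial_def u_def by (metis power2_norm_eq_inner)
  ultimately show ?thesis using eq by (rule that)
qed

lemma Lp_norm_powr: "Lp_norm p f powr q = (LINT x|lborel. norm (f x) powr p) powr (q / p)"
  by (simp add: Lp_norm_def powr_powr)

lemma Lp_norm_sq: "(Lp_norm p f)\<^sup>2 = (LINT x|lborel. norm (f x) powr p) powr (2 / p)"
proof -
  have "(Lp_norm p f)\<^sup>2 = Lp_norm p f powr 2" by (cases "Lp_norm p f = 0") (auto simp: Lp_norm_def)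
  then show ?thesis by (simp add: Lp_norm_powr)
qed

lemma Lp_norm_2_powr: "Lp_norm 2 f powr (2 * t) = (LINT x|lborel. (norm (f x))\<^sup>2) powr t"
  by (simp add: Lp_norm_powr)

section \<open>The optimal constant on the line and its scaling\<close>

definition line_energy :: "real \<Rightarrow> (real \<Rightarrow> real) \<Rightarrow> real" where
  "line_energy m v = (LINT s|lborel. (deriv v s)\<^sup>2) + m\<^sup>2 * (LINT s|lborel. (v s)\<^sup>2)"

text \<open>\<omega> stands for the area of the unit sphere, a factor of each integral in polar
  coordinates. It does not cancel: the left-hand side has degree 2/p in \<omega>, the right-hand
  side degree 1.\<close>

definition line_ineq :: "real \<Rightarrow> real \<Rightarrow> real \<Rightarrow> real \<Rightarrow> ennreal \<Rightarrow> (real \<Rightarrow> real) \<Rightarrow> bool" where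
  "line_ineq \<omega> \<theta> p m C v \<longleftrightarrow> ennreal ((\<omega> * (LINT s|lborel. \<bar>v s\<bar> powr p)) powr (2/p))
     \<le> C * ennreal ((\<omega> * line_energy m v) powr \<theta> * (\<omega> * (LINT s|lborel. (v s)\<^sup>2)) powr (1 - \<theta>))"

definition line_constant :: "real \<Rightarrow> real \<Rightarrow> real \<Rightarrow> real \<Rightarrow> ennreal" where
  "line_constant \<omega> \<theta> p m = Inf {C. \<forall>v\<in>Cc1. line_ineq \<omega> \<theta> p m C v}"

text \<open>Multiplication by exp(m s) maps \<open>Cc1\<close> onto itself, so the two inequalities
  hold for exactly the same constants C, finite or not, and the infima are over the same
  set.\<close>

lemma C_CKN_rad_eq_line_constant:
  assumes p: "p > 0"
  shows "C_CKN_rad TYPE('n::finite) \<theta> p a = line_constant (sphere_area CARD('n)) \<theta> p (a_crit CARD('n) - a)"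
proof -
  let ?d = "CARD('n)"
  let ?m = "a_crit ?d - a"
  define ckn_ineq where "ckn_ineq C u \<longleftrightarrow> ennreal ((Lp_norm p (\<lambda>x. norm x powr (- b_exp ?d p a) * u x))\<^sup>2)
     \<le> C * ennreal (Lp_norm 2 (\<lambda>x. norm x powr (- a) *\<^sub>R grad u x) powr (2 * \<theta>)
                   * Lp_norm 2 (\<lambda>x. norm x powr (- (a + 1)) * u x) powr (2 * (1 - \<theta>)))" for C and u :: "real^'n \<Rightarrow> real"
  have key: "ckn_ineq C u \<longleftrightarrow> line_ineq (sphere_area ?d) \<theta> p ?m C v"
    if u: "\<forall>x. x \<noteq> 0 \<longrightarrow> u x = w (ln (norm x))" and w: "w \<in> Cc1" and sm: "smooth u"
      and v: "v = (\<lambda>s. exp (?m * s) * w s)" for u :: "real^'n \<Rightarrow> real" and w v C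
  proof -
    note ri = radial_integrals[of u w, OF u[rule_format] w sm p, of a]
    have a1: "(LINT x|lborel. norm (norm x powr (- b_exp ?d p a) * u x) powr p) = sphere_area ?d * (LINT s|lborel. \<bar>v s\<bar> powr p)"
      using ri(1) by (simp add: v)
    have a2: "(LINT x|lborel. (norm (norm x powr (- a) *\<^sub>R grad u x))\<^sup>2) = sphere_area ?d * line_energy ?m v"
      using ri(2) by (simp add: v line_energy_def)
    have a3: "(LINT x|lborel. (norm (norm x powr (- (a + 1)) * u x))\<^sup>2) = sphere_area ?d * (LINT s|lborel. (v s)\<^sup>2)"
      using ri(3) unfolding v real_norm_def power2_abs .
    show ?thesis
      unfolding ckn_ineq_def line_ineq_def Lp_norm_sq Lp_norm_2_powr a1 a2 a3 by (rule refl)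
  qed
  have "(\<forall>u\<in>{u \<in> test_functions (- {0}). radial u}. ckn_ineq C u) \<longleftrightarrow> (\<forall>v\<in>Cc1. line_ineq (sphere_area ?d) \<theta> p ?m C v)" for C
  proof (intro iffI ballI)
    fix v assume C: "\<forall>u\<in>{u \<in> test_functions (- {0}). radial u}. ckn_ineq C u" and v: "v \<in> Cc1"
    define w where "w s = exp ((- ?m) * s) * v s" for s
    have w: "w \<in> Cc1" unfolding w_def by (rule Cc1_mult_exp[OF v])
    have vw: "v = (\<lambda>s. exp (?m * s) * w s)"
    proof
      fix s
      show "v s = exp (?m * s) * w s" using exp_minus_inverse[of "?m * s"] unfolding w_def
        by (metis mult.assoc mult.left_neutral mult_minus_left)
    qed
    obtain u :: "real^'n \<Rightarrow> real" where u: "u \<in> test_functions (- {0})" "radial u" "\<And>x. x \<noteq> 0 \<Longrightarrow> u x = w (ln (norm x))"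
      using log_radial_test[OF w] by blast
    have su: "smooth u" using u(1) by (simp add: test_functions_def)
    have "\<forall>x. x \<noteq> 0 \<longrightarrow> u x = w (ln (norm x))" using u(3) by blast
    from key[OF this w su vw, of C] C u(1,2) show "line_ineq (sphere_area ?d) \<theta> p ?m C v" by blast
  next
    fix u assume C: "\<forall>v\<in>Cc1. line_ineq (sphere_area ?d) \<theta> p ?m C v"
      and "u \<in> {u \<in> test_functions (- {0 :: real^'n}). radial u}"
    then have u: "u \<in> test_functions (- {0})" "radial u" by auto
    obtain w where w: "w \<in> Cc1" "\<And>x. x \<noteq> 0 \<Longrightarrow> u x = w (ln (norm x))"
      using radial_test_log[OF u] by blast
    have su: "smooth u" using u(1) by (simp add: test_functions_def)
    have *: "\<forall>x. x \<noteq> 0 \<longrightarrow> u x = w (ln (norm x))" using w(2) by blast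
    show "ckn_ineq C u"
      unfolding key[OF * w(1) su refl] by (rule bspec[OF C Cc1_mult_exp[OF w(1), of ?m]])
  qed
  then show ?thesis unfolding C_CKN_rad_def ckn_constant_on_def line_constant_def ckn_ineq_def by simp
qed

lemma line_integrals_scale:
  assumes v: "v \<in> Cc1" and c: "c > 0"
  shows "(LINT s|lborel. \<bar>v (c * s)\<bar> powr p) = (LINT s|lborel. \<bar>v s\<bar> powr p) / c"
    and "(LINT s|lborel. (v (c * s))\<^sup>2) = (LINT s|lborel. (v s)\<^sup>2) / c"
    and "line_energy (m * c) (\<lambda>s. v (c * s)) = c * line_energy m v"
proof -
  have sc: "(LINT s|lborel. f (c * s)) = (LINT s|lborel. f s) / c" for f :: "real \<Rightarrow> real"
    using lborel_integral_real_affine[of c f 0] c by simp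
  show "(LINT s|lborel. \<bar>v (c * s)\<bar> powr p) = (LINT s|lborel. \<bar>v s\<bar> powr p) / c"
    and 2: "(LINT s|lborel. (v (c * s))\<^sup>2) = (LINT s|lborel. (v s)\<^sup>2) / c"
    using sc[of "\<lambda>s. \<bar>v s\<bar> powr p"] sc[of "\<lambda>s. (v s)\<^sup>2"] by auto
  have "smooth1 v" using v by (simp add: Cc1_def)
  then have "((\<lambda>s. v (c * s)) has_real_derivative deriv v (c * s) * c) (at s)" for s
    by (intro DERIV_chain2[where f = v and g = "\<lambda>s. c * s"] smooth1_deriv_eq) (auto intro!: derivative_eq_intros)
  then have "deriv (\<lambda>s. v (c * s)) = (\<lambda>s. c * deriv v (c * s))"
    by (intro ext DERIV_imp_deriv) (simp add: mult.commute)
  then have "(LINT s|lborel. (deriv (\<lambda>s. v (c * s)) s)\<^sup>2) = c\<^sup>2 * ((LINT s|lborel. (deriv v s)\<^sup>2) / c)"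
    using sc[of "\<lambda>s. (deriv v s)\<^sup>2"] by (simp add: power_mult_distrib)
  then show "line_energy (m * c) (\<lambda>s. v (c * s)) = c * line_energy m v"
    using c 2 by (simp add: line_energy_def power2_eq_square field_simps)
qed

lemma line_energy_nonneg: "line_energy m v \<ge> 0"
  unfolding line_energy_def by (intro add_nonneg_nonneg mult_nonneg_nonneg Bochner_Integration.integral_nonneg) auto

text \<open>Testing with v(s / c) multiplies the integrals of |v|^p and v^2 by c and divides the
  energy by c, its parameter passing from m c to m. The two sides gain c^(2/p) and c^(1 - 2
  \<theta>), and the quotient is the stated power.\<close>

lemma line_constant_scale_le:
  assumes m: "m > 0" and c: "c > 0" and p: "p > 0" and w: "\<omega> > 0"
  shows "ennreal (c powr (2 * \<theta> - 1 + 2/p)) * line_constant \<omega> \<theta> p (m * c) \<le> line_constant \<omega> \<theta> p m"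
proof -
  define k where "k = c powr (2 * \<theta> - 1 + 2/p)"
  have k: "k > 0" using c by (simp add: k_def)
  show ?thesis unfolding k_def[symmetric] line_constant_def[of \<omega> \<theta> p m]
  proof (rule Inf_greatest)
    fix C assume "C \<in> {C. \<forall>v\<in>Cc1. line_ineq \<omega> \<theta> p m C v}"
    then have C: "line_ineq \<omega> \<theta> p m C v" if "v \<in> Cc1" for v
      using that by auto
    have "line_constant \<omega> \<theta> p (m * c) \<le> C * ennreal (1 / k)"
      unfolding line_constant_def
    proof (rule Inf_lower, safe)
      fix v assume v: "v \<in> Cc1"
      define v' where "v' s = v (1 / c * s)" for s
      have v': "v' \<in> Cc1" unfolding v'_def using c by (intro Cc1_scale v) auto
      have c': "1 / c > 0" using c by simp
      define N B E where "N = (LINT s|lborel. \<bar>v s\<bar> powr p)" and "B = (LINT s|lborel. (v s)\<^sup>2)" and "E = line_energy (m * c) v"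
      have nn: "N \<ge> 0" "B \<ge> 0" "E \<ge> 0"
        unfolding N_def B_def E_def by (auto intro: Bochner_Integration.integral_nonneg line_energy_nonneg)
      have N': "(LINT s|lborel. \<bar>v' s\<bar> powr p) = N * c" and B': "(LINT s|lborel. (v' s)\<^sup>2) = B * c"
        and E': "line_energy m v' = E / c"
        using line_integrals_scale(1)[OF v c', where p = p] line_integrals_scale(2)[OF v c']
          line_integrals_scale(3)[OF v c', where m = "m * c"] c
        by (simp_all add: v'_def[abs_def] N_def B_def E_def)
      have "ennreal ((\<omega> * (N * c)) powr (2/p)) \<le> C * ennreal ((\<omega> * (E / c)) powr \<theta> * (\<omega> * (B * c)) powr (1 - \<theta>))"
        using C[OF v'] by (simp add: line_ineq_def N' B' E')
      also have "(\<omega> * (N * c)) powr (2/p) = c powr (2/p) * (\<omega> * N) powr (2/p)"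
        using w nn c by (simp add: powr_mult mult_ac)
      also have "(\<omega> * (E / c)) powr \<theta> * (\<omega> * (B * c)) powr (1 - \<theta>)
          = c powr (1 - 2 * \<theta>) * ((\<omega> * E) powr \<theta> * (\<omega> * B) powr (1 - \<theta>))"
      proof -
        have "(\<omega> * (E / c)) powr \<theta> = (\<omega> * E) powr \<theta> * c powr (- \<theta>)"
          using w nn c powr_mult[of "\<omega> * E" "inverse c" \<theta>] by (simp add: divide_inverse powr_minus inverse_powr mult.assoc)
        moreover have "(\<omega> * (B * c)) powr (1 - \<theta>) = (\<omega> * B) powr (1 - \<theta>) * c powr (1 - \<theta>)"
          using w nn c powr_mult[of "\<omega> * B" c "1 - \<theta>"] by (simp add: mult.assoc)
        moreover have "c powr (- \<theta>) * c powr (1 - \<theta>) = c powr (1 - 2 * \<theta>)" by (simp add: powr_add[symmetric])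
        ultimately show ?thesis by (metis (no_types, opaque_lifting) mult.assoc mult.commute)
      qed
      finally have "ennreal (c powr (2/p) * (\<omega> * N) powr (2/p)) \<le> C * ennreal (c powr (1 - 2 * \<theta>) * ((\<omega> * E) powr \<theta> * (\<omega> * B) powr (1 - \<theta>)))" .
      then have "ennreal (c powr (-(2/p))) * ennreal (c powr (2/p) * (\<omega> * N) powr (2/p))
        \<le> ennreal (c powr (-(2/p))) * (C * ennreal (c powr (1 - 2 * \<theta>) * ((\<omega> * E) powr \<theta> * (\<omega> * B) powr (1 - \<theta>))))"
        by (rule mult_left_mono) simp
      also have "ennreal (c powr (-(2/p))) * ennreal (c powr (2/p) * (\<omega> * N) powr (2/p)) = ennreal ((\<omega> * N) powr (2/p))"
        using c by (simp add: ennreal_mult[symmetric] mult.assoc[symmetric] powr_add[symmetric])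
      also have "ennreal (c powr (-(2/p))) * (C * ennreal (c powr (1 - 2 * \<theta>) * ((\<omega> * E) powr \<theta> * (\<omega> * B) powr (1 - \<theta>))))
         = C * ennreal (c powr (-(2/p)) * c powr (1 - 2 * \<theta>)) * ennreal ((\<omega> * E) powr \<theta> * (\<omega> * B) powr (1 - \<theta>))"
        by (simp add: ennreal_mult mult_ac)
      also have "c powr (-(2/p)) * c powr (1 - 2 * \<theta>) = c powr (- (2 * \<theta> - 1 + 2/p))"
        by (simp only: powr_add[symmetric]) simp
      also have "\<dots> = 1 / k" unfolding k_def by (rule powr_minus_divide)
      finally show "line_ineq \<omega> \<theta> p (m * c) (C * ennreal (1 / k)) v"
        by (simp add: line_ineq_def N_def B_def E_def)
    qed
    then have "ennreal k * line_constant \<omega> \<theta> p (m * c) \<le> ennreal k * (C * ennreal (1 / k))"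
      by (rule mult_left_mono) simp
    also have "\<dots> = C * ennreal (k * (1 / k))" using k by (simp only: ennreal_mult less_imp_le zero_le_divide_1_iff mult_ac)
    also have "\<dots> = C" using k by simp
    finally show "ennreal k * line_constant \<omega> \<theta> p (m * c) \<le> C" .
  qed
qed

text \<open>Dilations are invertible, so the one-sided bound from 1 to m and back gives equality,
  without knowing that the constant is finite. This power law in m = a_c - a is what makes
  \<open>a_star\<close> unique.\<close>

lemma line_constant_scale:
  assumes m: "m > 0" and p: "p > 0" and w: "\<omega> > 0"
  shows "line_constant \<omega> \<theta> p m = ennreal (m powr (- (2 * \<theta> - 1 + 2/p))) * line_constant \<omega> \<theta> p 1"
proof (rule antisym)
  define e where "e = 2 * \<theta> - 1 + 2/p"
  have "ennreal (m powr e) * line_constant \<omega> \<theta> p m \<le> line_constant \<omega> \<theta> p 1"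
    using line_constant_scale_le[of 1 m p \<omega> \<theta>] assms by (simp add: e_def)
  then have "ennreal (m powr (- e)) * (ennreal (m powr e) * line_constant \<omega> \<theta> p m) \<le> ennreal (m powr (- e)) * line_constant \<omega> \<theta> p 1"
    by (rule mult_left_mono) simp
  also have "ennreal (m powr (- e)) * (ennreal (m powr e) * line_constant \<omega> \<theta> p m) = line_constant \<omega> \<theta> p m"
    using m by (simp add: mult.assoc[symmetric] ennreal_mult[symmetric] powr_add[symmetric])
  finally show "line_constant \<omega> \<theta> p m \<le> ennreal (m powr (- (2 * \<theta> - 1 + 2/p))) * line_constant \<omega> \<theta> p 1"
    by (simp add: e_def)
  have "ennreal ((1/m) powr e) * line_constant \<omega> \<theta> p 1 \<le> line_constant \<omega> \<theta> p m"
    using line_constant_scale_le[of m "1/m" p \<omega> \<theta>] assms by (simp add: e_def)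
  then show "ennreal (m powr (- (2 * \<theta> - 1 + 2/p))) * line_constant \<omega> \<theta> p 1 \<le> line_constant \<omega> \<theta> p m"
    using m by (simp add: e_def[symmetric] powr_minus_divide powr_divide)
qed

lemma line_constant_pos:
  assumes p: "p > 0" and w: "\<omega> > 0"
  shows "line_constant \<omega> \<theta> p m > 0"
proof -
  obtain v where v: "v \<in> Cc1" "v 0 > 0" "\<And>s. v s \<ge> 0" by (rule Cc1_nonzero) blast
  have "(LINT s|lborel. \<bar>v s\<bar> powr p) > 0"
    using p v by (intro Cc1_integral_pos[OF v(1), of 0])
      (auto intro!: continuous_intros continuous_on_powr' Cc1_continuous[OF v(1)])
  then have L: "(\<omega> * (LINT s|lborel. \<bar>v s\<bar> powr p)) powr (2/p) > 0" (is "?L > 0") using w by simp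
  let ?R = "(\<omega> * line_energy m v) powr \<theta> * (\<omega> * (LINT s|lborel. (v s)\<^sup>2)) powr (1 - \<theta>)"
  \<comment> \<open>The added 1 avoids a division by zero; any positive lower bound will do.\<close>
  have "ennreal (?L / (?R + 1)) \<le> line_constant \<omega> \<theta> p m"
    unfolding line_constant_def
  proof (rule Inf_greatest)
    fix C assume "C \<in> {C. \<forall>v\<in>Cc1. line_ineq \<omega> \<theta> p m C v}"
    then have C: "ennreal ?L \<le> C * ennreal ?R" using v(1) by (auto simp: line_ineq_def)
    show "ennreal (?L / (?R + 1)) \<le> C"
    proof (cases C)
      case (real c)
      with C have "?L \<le> c * ?R" by (simp add: ennreal_mult[symmetric])
      also have "\<dots> \<le> c * (?R + 1)" using real by (intro mult_left_mono) auto
      finally have "?L / (?R + 1) \<le> c" by (subst pos_divide_le_eq) (auto intro!: add_nonneg_pos)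
      with real show ?thesis by (simp add: ennreal_leI)
    qed simp
  qed
  moreover have "?L / (?R + 1) > 0" using L by (intro divide_pos_pos add_nonneg_pos) auto
  ultimately show ?thesis by (meson ennreal_less_zero_iff order_less_le_trans)
qed

text \<open>\<open>gn_line\<close> controls the left-hand side by a power t1 of A B^(d - 1) and a
  rest in B alone. The arithmetic-geometric mean inequality bounds A B^(d - 1) by a multiple of the
  d-th power of the energy A + m^2 B, which produces the required exponent \<theta> = d t1.\<close>

lemma line_constant_le:
  assumes p: "2 < p" "p < 4" and w: "\<omega> > 0" and m: "m > 0" and d: "d \<ge> 2"
  defines "t1 \<equiv> (p - 2) / (2*p)"
  shows "line_constant \<omega> (real d * t1) p m
    \<le> ennreal ((((real d - 1) / m\<^sup>2) ^ (d - 1) / real d ^ d / (3 * \<omega>\<^sup>2)) powr t1)"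
  unfolding line_constant_def
proof (rule Inf_lower, safe)
  fix v assume v: "v \<in> Cc1"
  define th where "th = real d * t1"
  define N A B where "N = (LINT s|lborel. \<bar>v s\<bar> powr p)" and "A = (LINT s|lborel. (deriv v s)\<^sup>2)" and "B = (LINT s|lborel. (v s)\<^sup>2)"
  have nn: "N \<ge> 0" "A \<ge> 0" "B \<ge> 0"
    unfolding N_def A_def B_def by (auto intro: Bochner_Integration.integral_nonneg)
  have t1: "t1 > 0" using p by (simp add: t1_def)
  define E where "E = A + m\<^sup>2 * B"
  have E: "E \<ge> 0" using nn by (simp add: E_def)
  define k where "k = ((real d - 1) / m\<^sup>2) ^ (d - 1) / real d ^ d"
  have k: "k > 0" using d m by (simp add: k_def)
  have gn: "N powr (2/p) \<le> (A / 3) powr t1 * B powr (1 - t1)"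
    using gn_line[OF v p] by (simp add: N_def A_def B_def t1_def)
  have amgm: "A * B ^ (d - 1) \<le> k * E ^ d"
  proof (cases "A = 0 \<or> B = 0")
    case True
    then show ?thesis using E k d by (auto simp: zero_power)
  next
    case False
    then have pos: "A > 0" "B > 0" using nn by auto
    \<comment> \<open>Scaled so that the weighted mean of A and y, with weights 1/d and (d - 1)/d,
      is exactly E / d. Equality would hold for A = y.\<close>
    define y where "y = m\<^sup>2 * B / (real d - 1)"
    have y: "y > 0" using pos d m by (simp add: y_def)
    have "A powr (1 / real d) * y powr ((real d - 1) / real d) \<le> 1 / real d * A + (real d - 1) / real d * y"
      using pos y d by (intro Youngs_inequality_0) (auto simp: field_simps)
    also have "\<dots> = E / real d" using d by (simp add: y_def E_def field_simps)
    finally have "(A powr (1 / real d) * y powr ((real d - 1) / real d)) ^ d \<le> (E / real d) ^ d"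
      by (intro power_mono) auto
    also have "(A powr (1 / real d) * y powr ((real d - 1) / real d)) ^ d = A * y ^ (d - 1)"
    proof -
      have "(A powr (1 / real d)) ^ d = A" using pos d by (simp add: powr_realpow[symmetric] powr_powr)
      moreover have "(y powr ((real d - 1) / real d)) ^ d = y powr (real d - 1)"
        using y d by (simp add: powr_realpow[symmetric] powr_powr)
      moreover have "y powr (real d - 1) = y ^ (d - 1)"
        using y d by (simp add: powr_realpow[symmetric] of_nat_diff)
      ultimately show ?thesis by (simp add: power_mult_distrib)
    qed
    finally have *: "A * y ^ (d - 1) \<le> (E / real d) ^ d" .
    have "B = (real d - 1) / m\<^sup>2 * y" using d m by (simp add: y_def)
    then have "A * B ^ (d - 1) = ((real d - 1) / m\<^sup>2) ^ (d - 1) * (A * y ^ (d - 1))"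
      by (simp only: power_mult_distrib mult.left_commute)
    also have "\<dots> \<le> ((real d - 1) / m\<^sup>2) ^ (d - 1) * (E / real d) ^ d"
      using d by (intro mult_left_mono *) auto
    finally show ?thesis by (simp add: k_def power_divide)
  qed
  have "A powr t1 * B powr (1 - t1) \<le> k powr t1 * (E powr th * B powr (1 - th))"
  proof (cases "B = 0")
    case False
    then have B: "B > 0" using nn by simp
    have "(A * B ^ (d - 1)) powr t1 \<le> (k * E ^ d) powr t1"
      using amgm nn t1 by (intro powr_mono2) auto
    also have "(A * B ^ (d - 1)) powr t1 = A powr t1 * B powr (th - t1)"
    proof -
      have "B ^ (d - 1) = B powr (real d - 1)" using B d by (simp add: powr_realpow[symmetric] of_nat_diff)
      then show ?thesis using nn by (simp add: powr_mult powr_powr th_def left_diff_distrib)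
    qed
    also have "(k * E ^ d) powr t1 = k powr t1 * E powr th"
    proof (cases "E = 0")
      case False
      then have "E ^ d = E powr (real d)" using E by (simp add: powr_realpow)
      then show ?thesis using k E by (simp add: powr_mult powr_powr th_def)
    qed (use d in \<open>simp add: zero_power\<close>)
    finally have "A powr t1 * B powr (th - t1) * B powr (1 - th) \<le> k powr t1 * E powr th * B powr (1 - th)"
      by (rule mult_right_mono) simp
    moreover have "B powr (th - t1) * B powr (1 - th) = B powr (1 - t1)" by (simp add: powr_add[symmetric])
    ultimately show ?thesis by (simp add: mult.assoc)
  qed simp
  moreover have "(A / 3) powr t1 = A powr t1 / 3 powr t1" using nn by (simp add: powr_divide)
  ultimately have NE: "N powr (2/p) \<le> (k / 3) powr t1 * (E powr th * B powr (1 - th))"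
    using gn k by (simp add: powr_divide divide_right_mono order_trans)
  have "(\<omega> * N) powr (2/p) = \<omega> powr (2/p) * N powr (2/p)" using w nn by (simp add: powr_mult)
  also have "\<dots> \<le> \<omega> powr (2/p) * ((k / 3) powr t1 * (E powr th * B powr (1 - th)))"
    by (intro mult_left_mono NE) simp
  \<comment> \<open>Since 2/p = 1 - 2 t1, one power of \<omega> is shared by the two factors on the
    right and \<omega>^(-2 t1) remains, the source of the square in the stated constant.\<close>
  also have "\<omega> powr (2/p) = \<omega> powr (- 2 * t1) * (\<omega> powr th * \<omega> powr (1 - th))"
  proof -
    have "2/p = - 2 * t1 + (th + (1 - th))" using p by (simp add: t1_def field_simps)
    then show ?thesis by (simp only: powr_add)
  qed
  also have "\<omega> powr (- 2 * t1) = (1 / \<omega>\<^sup>2) powr t1"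
  proof -
    have "\<omega> powr (- 2 * t1) = (\<omega> powr (- 2)) powr t1" by (simp add: powr_powr)
    also have "\<omega> powr (- 2) = 1 / \<omega>\<^sup>2" using w by (simp add: powr_minus_divide)
    finally show ?thesis .
  qed
  also have "(1 / \<omega>\<^sup>2) powr t1 * (\<omega> powr th * \<omega> powr (1 - th)) * ((k / 3) powr t1 * (E powr th * B powr (1 - th)))
    = ((1 / \<omega>\<^sup>2) powr t1 * (k / 3) powr t1) * ((\<omega> * E) powr th * (\<omega> * B) powr (1 - th))"
    using w E nn by (simp add: powr_mult mult_ac)
  also have "(1 / \<omega>\<^sup>2) powr t1 * (k / 3) powr t1 = (k / (3 * \<omega>\<^sup>2)) powr t1"
    using k by (subst powr_mult[symmetric]) (auto simp: field_simps)
  finally have "ennreal ((\<omega> * N) powr (2/p)) \<le> ennreal ((k / (3 * \<omega>\<^sup>2)) powr t1) * ennreal ((\<omega> * E) powr th * (\<omega> * B) powr (1 - th))"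
    by (simp add: ennreal_mult[symmetric] ennreal_leI)
  then show "line_ineq \<omega> (real d * t1) p m (ennreal ((((real d - 1) / m\<^sup>2) ^ (d - 1) / real d ^ d / (3 * \<omega>\<^sup>2)) powr t1)) v"
    by (simp add: line_ineq_def k_def E_def line_energy_def N_def A_def B_def th_def)
qed

subsection \<open>Comparison with the Gagliardo--Nirenberg constant\<close>

lemma powr_between_half_two:
  fixes r q :: real
  assumes "1/2 \<le> r" "r \<le> 2"
  shows "r powr q \<le> 2 powr \<bar>q\<bar>"
proof (cases "q \<ge> 0")
  case True
  then show ?thesis using assms by (auto intro!: powr_mono2)
next
  case False
  have "r powr q \<le> (1/2) powr q" using False assms by (intro powr_mono2') auto
  also have "(1/2) powr q = 2 powr (- q)" by (simp add: powr_divide powr_minus_divide)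
  finally show ?thesis using False by simp
qed

text \<open>Relative to its value at the centre of the translated support, the weight tends to 1
  pointwise. It stays bounded above and below on the support, so dominated convergence applies for
  either sign of q.\<close>

lemma weighted_translate_tendsto:
  fixes f :: "real^'n \<Rightarrow> real"
  assumes f: "continuous_on UNIV f" "\<And>x. R < norm x \<Longrightarrow> f x = 0" and e: "norm e = 1"
  shows "(\<lambda>n. LINT x|lborel. (norm (x + real n *\<^sub>R e) / real n) powr q * f x) \<longlonglongrightarrow> (LINT x|lborel. f x)"
proof -
  \<comment> \<open>From this index on the support of f has radius at most n / 2, which keeps |x + n
    e| / n between 1/2 and 2.\<close>
  obtain N :: nat where N: "2 * max 1 R \<le> real N" using real_arch_simple by blast
  have N1: "real N \<ge> 2" using N by simp
  have [measurable]: "f \<in> borel_measurable borel" by (rule borel_measurable_continuous_onI[OF f(1)])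
  have "(\<lambda>n. LINT x|lborel. (norm (x + real (n + N) *\<^sub>R e) / real (n + N)) powr q * f x) \<longlonglongrightarrow> (LINT x|lborel. f x)"
  proof (rule integral_dominated_convergence)
    show "integrable lborel (\<lambda>x. 2 powr \<bar>q\<bar> * norm (f x))"
      by (intro integrable_mult_right integrable_norm integrable_bounded_support[OF f])
    show "AE x in lborel. (\<lambda>n. (norm (x + real (n + N) *\<^sub>R e) / real (n + N)) powr q * f x) \<longlonglongrightarrow> f x"
    proof (intro AE_I2)
      fix x
      have "(\<lambda>n. norm ((1 / real (n + N)) *\<^sub>R x + e)) \<longlonglongrightarrow> norm (0 *\<^sub>R x + e)"
        by (intro tendsto_intros LIMSEQ_ignore_initial_segment[OF lim_1_over_n])
      moreover have "norm (x + real (n + N) *\<^sub>R e) / real (n + N) = norm ((1 / real (n + N)) *\<^sub>R x + e)" for n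
      proof -
        have "x + real (n + N) *\<^sub>R e = real (n + N) *\<^sub>R ((1 / real (n + N)) *\<^sub>R x + e)"
          using N1 by (simp add: scaleR_add_right)
        then show ?thesis using N1 by (metis abs_of_nat nonzero_mult_div_cancel_left norm_scaleR of_nat_0_less_iff
              add_gr_0 less_irrefl not_numeral_le_zero of_nat_0 neq0_conv)
      qed
      ultimately have "(\<lambda>n. norm (x + real (n + N) *\<^sub>R e) / real (n + N)) \<longlonglongrightarrow> 1" using e by simp
      then have "(\<lambda>n. (norm (x + real (n + N) *\<^sub>R e) / real (n + N)) powr q * f x) \<longlonglongrightarrow> 1 powr q * f x"
        by (intro tendsto_mult tendsto_powr tendsto_const) auto
      then show "(\<lambda>n. (norm (x + real (n + N) *\<^sub>R e) / real (n + N)) powr q * f x) \<longlonglongrightarrow> f x" by simp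
    qed
    fix n
    have "norm ((norm (x + real (n + N) *\<^sub>R e) / real (n + N)) powr q * f x) \<le> 2 powr \<bar>q\<bar> * norm (f x)" for x
    proof (cases "R < norm x")
      case False
      have nN: "real (n + N) > 0" "norm x \<le> real (n + N) / 2" using N N1 False by auto
      have ne: "norm (real (n + N) *\<^sub>R e) = real (n + N)" using e by simp
      have "norm (x + real (n + N) *\<^sub>R e) \<le> norm x + real (n + N)"
        using norm_triangle_ineq[of x "real (n + N) *\<^sub>R e"] unfolding ne .
      moreover have "real (n + N) \<le> norm (x + real (n + N) *\<^sub>R e) + norm x"
        using norm_triangle_ineq4[of "x + real (n + N) *\<^sub>R e" x] unfolding add_diff_cancel_left' ne .
      ultimately have "1/2 \<le> norm (x + real (n + N) *\<^sub>R e) / real (n + N)" "norm (x + real (n + N) *\<^sub>R e) / real (n + N) \<le> 2"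
        using nN by (auto simp: field_simps)
      from powr_between_half_two[OF this, of q] show ?thesis
        by (simp add: abs_mult mult_right_mono)
    qed (simp add: f)
    then show "AE x in lborel. norm ((norm (x + real (n + N) *\<^sub>R e) / real (n + N)) powr q * f x) \<le> 2 powr \<bar>q\<bar> * norm (f x)" by simp
  qed measurable
  then show ?thesis by (rule LIMSEQ_offset)
qed

lemma vartheta_bounds:
  assumes "d > 0" "2 < p" "p < 2 + 4 / real d"
  shows "0 < vartheta p d" "vartheta p d < 1"
proof -
  show "0 < vartheta p d" using assms by (simp add: vartheta_def)
  have "real d * (p - 2) < 4" using assms by (simp add: field_simps)
  then show "vartheta p d < 1" using assms by (simp add: vartheta_def field_simps)
qed

text \<open>Equivalently b = \<theta> a + (1 - \<theta>) (a + 1) at \<theta> =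
  \<open>vartheta p d\<close>. This is why the powers of the translation distance cancel when a test
  function is moved to infinity.\<close>

lemma b_exp_vartheta: "p > 0 \<Longrightarrow> b_exp d p a = a + 1 - vartheta p d"
  by (simp add: b_exp_def vartheta_def a_crit_def field_simps)

lemma gn_ineq_of_ckn:
  fixes u :: "real^'n \<Rightarrow> real"
  assumes p: "2 < p" "p < 2 + 4 / real CARD('n)" and c: "c \<ge> 0"
  defines "\<theta> \<equiv> vartheta p CARD('n)"
  assumes C: "\<And>u::real^'n \<Rightarrow> real. u \<in> test_functions (- {0}) \<Longrightarrow>
     ennreal ((Lp_norm p (\<lambda>x. norm x powr (- b_exp CARD('n) p a) * u x))\<^sup>2)
     \<le> ennreal c * ennreal (Lp_norm 2 (\<lambda>x. norm x powr (- a) *\<^sub>R grad u x) powr (2 * \<theta>)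
                   * Lp_norm 2 (\<lambda>x. norm x powr (- (a + 1)) * u x) powr (2 * (1 - \<theta>)))"
    and u: "u \<in> test_functions UNIV"
  shows "gn_ineq c p \<theta> u (grad u)"
proof -
  have th: "0 < \<theta>" "\<theta> < 1" unfolding \<theta>_def using vartheta_bounds[of "CARD('n)" p] p by auto
  define b where "b = b_exp CARD('n) p a"
  have b: "b = a + 1 - \<theta>" using p by (simp add: b_def \<theta>_def b_exp_vartheta)
  obtain R where R: "R > 0" "smooth u" "\<And>x. R < norm x \<Longrightarrow> u x = 0" using u by (metis test_functionsE)
  have cu: "continuous_on UNIV u" "continuous_on UNIV (grad u)"
    using R(2) by (auto intro: smooth_continuous continuous_on_grad)
  have [measurable]: "u \<in> borel_measurable borel" "grad u \<in> borel_measurable borel"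
    using R(2) by (auto intro: smooth_measurable grad_measurable)
  define e where "e = (axis undefined 1 :: real^'n)"
  have e: "norm e = 1" by (simp add: e_def)
  define N A B where "N n = (LINT x|lborel. (norm (x + real n *\<^sub>R e) / real n) powr (- b * p) * \<bar>u x\<bar> powr p)"
    and "A n = (LINT x|lborel. (norm (x + real n *\<^sub>R e) / real n) powr (- 2 * a) * (norm (grad u x))\<^sup>2)"
    and "B n = (LINT x|lborel. (norm (x + real n *\<^sub>R e) / real n) powr (- 2 * (a + 1)) * (u x)\<^sup>2)" for n
  have lim: "N \<longlonglongrightarrow> (LINT x|lborel. \<bar>u x\<bar> powr p)" "A \<longlonglongrightarrow> (LINT x|lborel. (norm (grad u x))\<^sup>2)"
      "B \<longlonglongrightarrow> (LINT x|lborel. (u x)\<^sup>2)"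
    unfolding N_def A_def B_def using R(3) grad_eq_0_support[OF R(3)] p
    by (auto intro!: weighted_translate_tendsto[where R = R] continuous_intros continuous_on_powr' cu e)
  have nn: "N n \<ge> 0" "A n \<ge> 0" "B n \<ge> 0" for n
    unfolding N_def A_def B_def by (auto intro!: Bochner_Integration.integral_nonneg)
  have main: "N n powr (2/p) \<le> c * (A n powr \<theta> * B n powr (1 - \<theta>))" if n: "R < real n" for n
  proof -
    define m where "m = real n"
    have m: "m > 0" using n R by (simp add: m_def)
    define z where "z = m *\<^sub>R e"
    define w where "w x = u (1 *\<^sub>R x + (- z))" for x
    have wz: "w x = u (x - z)" for x by (simp add: w_def)
    have gw: "grad w x = grad u (x - z)" for x
      unfolding w_def[abs_def] by (subst grad_affine) (auto intro: smooth_differentiable R)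
    have "w \<in> test_functions UNIV" unfolding w_def by (rule test_functions_affine[OF u]) simp
    \<comment> \<open>Once the distance exceeds R, the translate vanishes near the origin and is
      admissible in the weighted inequality.\<close>
    moreover have "w x = 0" if "norm x < m - R" for x
    proof -
      have "norm z \<le> norm (x - z) + norm x" using norm_triangle_ineq4[of "x - z" x] by simp
      moreover have "norm z = m" using m e by (simp add: z_def)
      ultimately show ?thesis using that R(3)[of "x - z"] by (simp add: wz)
    qed
    ultimately have w: "w \<in> test_functions (- {0})"
      using n by (auto simp: test_functions_punctured_iff m_def intro!: exI[of _ "real n - R"])
    have pw: "norm (x + z) powr q = m powr q * (norm (x + z) / m) powr q" for x q
      using m by (simp add: powr_mult[symmetric])
    have 1: "(LINT x|lborel. norm (norm x powr (- b) * w x) powr p) = m powr (- b * p) * N n"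
    proof -
      have "(LINT x|lborel. norm (norm x powr (- b) * w x) powr p) = (LINT x|lborel. norm (norm (x + z) powr (- b) * w (x + z)) powr p)"
        by (rule integral_lborel_shift(1)[symmetric]) (simp add: wz)
      also have "\<dots> = (LINT x|lborel. m powr (- b * p) * ((norm (x + z) / m) powr (- b * p) * \<bar>u x\<bar> powr p))"
      proof (rule Bochner_Integration.integral_cong[OF refl])
        fix x
        have "norm (norm (x + z) powr (- b) * w (x + z)) powr p = norm (x + z) powr (- b * p) * \<bar>u x\<bar> powr p"
          by (simp add: wz abs_mult powr_mult powr_powr)
        then show "norm (norm (x + z) powr (- b) * w (x + z)) powr p = m powr (- b * p) * ((norm (x + z) / m) powr (- b * p) * \<bar>u x\<bar> powr p)"
          unfolding pw[of x "- b * p"] by (simp only: mult.assoc)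
      qed
      also have "\<dots> = m powr (- b * p) * N n"
        by (subst integral_mult_right_zero) (simp add: N_def m_def z_def)
      finally show ?thesis .
    qed
    have 2: "(LINT x|lborel. (norm (norm x powr (- a) *\<^sub>R grad w x))\<^sup>2) = m powr (- 2 * a) * A n"
    proof -
      have "(LINT x|lborel. (norm (norm x powr (- a) *\<^sub>R grad w x))\<^sup>2) = (LINT x|lborel. (norm (norm (x + z) powr (- a) *\<^sub>R grad w (x + z)))\<^sup>2)"
        by (rule integral_lborel_shift(1)[symmetric]) (simp add: gw)
      also have "\<dots> = (LINT x|lborel. m powr (- 2 * a) * ((norm (x + z) / m) powr (- 2 * a) * (norm (grad u x))\<^sup>2))"
      proof (rule Bochner_Integration.integral_cong[OF refl])
        fix x
        have "(norm (x + z) powr (- a))\<^sup>2 = norm (x + z) powr (- 2 * a)"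
          by (simp add: power2_eq_square powr_add[symmetric])
        then have "(norm (norm (x + z) powr (- a) *\<^sub>R grad w (x + z)))\<^sup>2 = norm (x + z) powr (- 2 * a) * (norm (grad u x))\<^sup>2"
          by (simp add: gw power_mult_distrib)
        then show "(norm (norm (x + z) powr (- a) *\<^sub>R grad w (x + z)))\<^sup>2 = m powr (- 2 * a) * ((norm (x + z) / m) powr (- 2 * a) * (norm (grad u x))\<^sup>2)"
          unfolding pw[of x "- 2 * a"] by (simp only: mult.assoc)
      qed
      also have "\<dots> = m powr (- 2 * a) * A n"
        by (subst integral_mult_right_zero) (simp add: A_def m_def z_def)
      finally show ?thesis .
    qed
    have 3: "(LINT x|lborel. (norm (norm x powr (- (a + 1)) * w x))\<^sup>2) = m powr (- 2 * (a + 1)) * B n"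
    proof -
      have "(LINT x|lborel. (norm (norm x powr (- (a + 1)) * w x))\<^sup>2) = (LINT x|lborel. (norm (norm (x + z) powr (- (a + 1)) * w (x + z)))\<^sup>2)"
        by (rule integral_lborel_shift(1)[symmetric]) (simp add: wz)
      also have "\<dots> = (LINT x|lborel. m powr (- 2 * (a + 1)) * ((norm (x + z) / m) powr (- 2 * (a + 1)) * (u x)\<^sup>2))"
      proof (rule Bochner_Integration.integral_cong[OF refl])
        fix x
        have "(norm (x + z) powr (- (a + 1)))\<^sup>2 = norm (x + z) powr (- 2 * (a + 1))"
          by (simp add: power2_eq_square powr_add[symmetric] algebra_simps)
        then have "(norm (norm (x + z) powr (- (a + 1)) * w (x + z)))\<^sup>2 = norm (x + z) powr (- 2 * (a + 1)) * (u x)\<^sup>2"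
          by (simp only: wz norm_mult real_norm_def power_mult_distrib power2_abs add_diff_cancel_right')
        then show "(norm (norm (x + z) powr (- (a + 1)) * w (x + z)))\<^sup>2 = m powr (- 2 * (a + 1)) * ((norm (x + z) / m) powr (- 2 * (a + 1)) * (u x)\<^sup>2)"
          unfolding pw[of x "- 2 * (a + 1)"] by (simp only: mult.assoc)
      qed
      also have "\<dots> = m powr (- 2 * (a + 1)) * B n"
        by (subst integral_mult_right_zero) (simp add: B_def m_def z_def)
      finally show ?thesis .
    qed
    have "(m powr (- b * p) * N n) powr (2/p) \<le> c * ((m powr (- 2 * a) * A n) powr \<theta> * (m powr (- 2 * (a + 1)) * B n) powr (1 - \<theta>))"
      using C[OF w] c unfolding Lp_norm_sq Lp_norm_2_powr b_def[symmetric] 1 2 3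
      by (subst (asm) ennreal_mult[symmetric]) auto
    also have "(m powr (- b * p) * N n) powr (2/p) = m powr (- 2 * b) * N n powr (2/p)"
      using nn p by (simp add: powr_mult powr_powr mult.commute[of b])
    also have "(m powr (- 2 * a) * A n) powr \<theta> * (m powr (- 2 * (a + 1)) * B n) powr (1 - \<theta>)
       = (m powr (- 2 * a * \<theta>) * m powr (- 2 * (a + 1) * (1 - \<theta>))) * (A n powr \<theta> * B n powr (1 - \<theta>))"
      using nn by (simp only: powr_mult powr_powr powr_ge_zero mult_ac)
    also have "m powr (- 2 * a * \<theta>) * m powr (- 2 * (a + 1) * (1 - \<theta>)) = m powr (- 2 * b)"
      unfolding powr_add[symmetric] b by (simp add: algebra_simps)
    finally have "m powr (- 2 * b) * N n powr (2/p) \<le> m powr (- 2 * b) * (c * (A n powr \<theta> * B n powr (1 - \<theta>)))"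
      by (simp only: mult.left_commute)
    then show ?thesis using m by (subst (asm) mult_le_cancel_left_pos) auto
  qed
  have "\<forall>\<^sub>F n in sequentially. R < real n"
    using filterlim_real_sequentially by (simp add: filterlim_at_top_dense)
  then have ev: "\<forall>\<^sub>F n in sequentially. N n powr (2/p) \<le> c * (A n powr \<theta> * B n powr (1 - \<theta>))"
    by eventually_elim (rule main)
  have "(LINT x|lborel. \<bar>u x\<bar> powr p) powr (2/p) \<le> c * ((LINT x|lborel. (norm (grad u x))\<^sup>2) powr \<theta> * (LINT x|lborel. (u x)\<^sup>2) powr (1 - \<theta>))"
  proof (rule tendsto_le[OF _ _ _ ev])
    show "(\<lambda>n. N n powr (2/p)) \<longlonglongrightarrow> (LINT x|lborel. \<bar>u x\<bar> powr p) powr (2/p)"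
      using p nn by (intro tendsto_powr' lim tendsto_const) (auto intro!: always_eventually)
    show "(\<lambda>n. c * (A n powr \<theta> * B n powr (1 - \<theta>))) \<longlonglongrightarrow> c * ((LINT x|lborel. (norm (grad u x))\<^sup>2) powr \<theta> * (LINT x|lborel. (u x)\<^sup>2) powr (1 - \<theta>))"
      using th nn by (intro tendsto_mult tendsto_powr' lim tendsto_const) (auto intro!: always_eventually)
  qed simp
  then have "((LINT x|lborel. \<bar>u x\<bar> powr p) powr (2/p)) powr (p/2) \<le> (c * ((LINT x|lborel. (norm (grad u x))\<^sup>2) powr \<theta> * (LINT x|lborel. (u x)\<^sup>2) powr (1 - \<theta>))) powr (p/2)"
    using p by (intro powr_mono2) auto
  also have "((LINT x|lborel. \<bar>u x\<bar> powr p) powr (2/p)) powr (p/2) = (LINT x|lborel. \<bar>u x\<bar> powr p)"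
    using p by (simp add: powr_powr Bochner_Integration.integral_nonneg)
  finally show ?thesis unfolding gn_ineq_def
    using p by (subst nn_integral_eq_integral)
      (auto intro!: integrable_bounded_support[where R = R] continuous_intros continuous_on_powr' cu ennreal_leI simp: R)
qed

text \<open>The bound is carried to H^1 for the nonnegative integral, so its finiteness also
  supplies the condition \<open>in_Lp p u\<close> contained in the definition of
  \<open>C_GN\<close>.\<close>

lemma C_GN_le:
  fixes a :: real
  assumes p: "2 < p" "p < 2 + 4 / real CARD('n::finite)" and c: "c \<ge> 0"
    and gn: "\<And>u::real^'n \<Rightarrow> real. u \<in> test_functions UNIV \<Longrightarrow> gn_ineq c p (vartheta p CARD('n)) u (grad u)"
  shows "C_GN TYPE('n) p \<le> ennreal c"
  unfolding C_GN_def
proof (rule Inf_lower, safe)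
  let ?t = "vartheta p CARD('n)"
  have th: "0 < ?t" "?t < 1" using vartheta_bounds[of "CARD('n)" p] p by auto
  fix u :: "real^'n \<Rightarrow> real" and G assume H: "H1 u G"
  have [measurable]: "u \<in> borel_measurable borel" using H by (simp add: H1_def in_Lp_def)
  let ?K = "c * ((LINT x|lborel. (norm (G x))\<^sup>2) powr ?t * (LINT x|lborel. (u x)\<^sup>2) powr (1 - ?t))"
  have g: "(\<integral>\<^sup>+x. ennreal (\<bar>u x\<bar> powr p) \<partial>lborel) \<le> ennreal (?K powr (p/2))"
    using gn_ineq_H1[OF gn c th _ H] p by (simp add: gn_ineq_def)
  then have i: "integrable lborel (\<lambda>x. \<bar>u x\<bar> powr p)"
    by (intro integrableI_bounded) (auto simp: less_top[symmetric] top_unique)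
  then show "in_Lp p u" by (simp add: in_Lp_def)
  have "(LINT x|lborel. \<bar>u x\<bar> powr p) \<le> ?K powr (p/2)"
    using g nn_integral_eq_integral[OF i] by simp
  then have "(LINT x|lborel. \<bar>u x\<bar> powr p) powr (2/p) \<le> (?K powr (p/2)) powr (2/p)"
    using p by (intro powr_mono2) (auto intro!: Bochner_Integration.integral_nonneg)
  also have "\<dots> = ?K" using p c by (simp add: powr_powr)
  finally show "ennreal ((Lp_norm p u)\<^sup>2) \<le> ennreal c * ennreal (Lp_norm 2 G powr (2 * ?t) * Lp_norm 2 u powr (2 * (1 - ?t)))"
    using c unfolding Lp_norm_sq Lp_norm_2_powr by (subst ennreal_mult[symmetric]) (auto intro!: ennreal_leI)
qed

theorem C_GN_le_C_CKN:
  assumes p: "2 < p" "p < 2 + 4 / real CARD('n::finite)"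
  shows "C_GN TYPE('n) p \<le> C_CKN TYPE('n) (vartheta p CARD('n)) p a"
  unfolding C_CKN_def ckn_constant_on_def
proof (rule Inf_greatest)
  fix C :: ennreal
  assume C: "C \<in> {C. \<forall>u\<in>test_functions (- {0 :: real^'n}).
     ennreal ((Lp_norm p (\<lambda>x. norm x powr (- b_exp CARD('n) p a) * u x))\<^sup>2)
     \<le> C * ennreal (Lp_norm 2 (\<lambda>x. norm x powr (- a) *\<^sub>R grad u x) powr (2 * vartheta p CARD('n))
                   * Lp_norm 2 (\<lambda>x. norm x powr (- (a + 1)) * u x) powr (2 * (1 - vartheta p CARD('n))))}"
  show "C_GN TYPE('n) p \<le> C"
  proof (cases C)
    case (real c)
    then show ?thesis using C by (auto intro!: C_GN_le[OF p] gn_ineq_of_ckn[OF p])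
  qed simp
qed

subsection \<open>A Gaussian trial function\<close>

lemma gaussian_line:
  "has_bochner_integral lborel (\<lambda>x::real. exp (- x\<^sup>2) * x ^ (2 * k)) (sqrt pi * (fact (2 * k) / (2 ^ (2 * k) * fact k)))"
  using has_bochner_integral_even_function[OF gaussian_moment_even_pos[where k=k]] by simp

lemma nn_integral_gaussian_line:
  assumes c: "c > 0"
  shows "(\<integral>\<^sup>+x. ennreal (exp (- c * x\<^sup>2)) \<partial>(lborel :: (real) measure)) = ennreal (sqrt (pi / c))"
proof -
  have 1: "(\<integral>\<^sup>+x. ennreal (exp (- x\<^sup>2)) \<partial>(lborel :: (real) measure)) = ennreal (sqrt pi)"
    using gaussian_line[of 0] by (subst nn_integral_eq_integral) (auto simp: has_bochner_integral_iff)
  have "(\<integral>\<^sup>+x. ennreal (exp (- x\<^sup>2)) \<partial>(lborel :: (real) measure)) = ennreal \<bar>sqrt c\<bar> * (\<integral>\<^sup>+x. ennreal (exp (- (0 + sqrt c * x)\<^sup>2)) \<partial>lborel)"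
    using c by (intro nn_integral_real_affine) auto
  also have "(\<lambda>x. ennreal (exp (- (0 + sqrt c * x)\<^sup>2))) = (\<lambda>x. ennreal (exp (- c * x\<^sup>2)))"
    using c by (simp add: power_mult_distrib)
  finally have "ennreal (sqrt pi) = ennreal (sqrt c) * (\<integral>\<^sup>+x. ennreal (exp (- c * x\<^sup>2)) \<partial>(lborel :: (real) measure))"
    using c by (simp add: 1)
  then have "ennreal (1 / sqrt c) * ennreal (sqrt pi) = ennreal (1 / sqrt c) * (ennreal (sqrt c) * (\<integral>\<^sup>+x. ennreal (exp (- c * x\<^sup>2)) \<partial>(lborel :: (real) measure)))"
    by simp
  also have "\<dots> = ennreal (1 / sqrt c * sqrt c) * (\<integral>\<^sup>+x. ennreal (exp (- c * x\<^sup>2)) \<partial>(lborel :: (real) measure))"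
    using c by (subst ennreal_mult) (auto simp: mult.assoc)
  also have "\<dots> = (\<integral>\<^sup>+x. ennreal (exp (- c * x\<^sup>2)) \<partial>(lborel :: (real) measure))" using c by simp
  finally show ?thesis using c by (simp add: ennreal_mult[symmetric] real_sqrt_divide)
qed

lemma inner_self_sum: "(x::'a::euclidean_space) \<bullet> x = (\<Sum>b\<in>Basis. (x \<bullet> b)\<^sup>2)"
  by (subst euclidean_inner) (simp add: power2_eq_square)

lemma DIM_vec: "DIM(real^'n::finite) = CARD('n)" by simp

lemma nn_integral_gaussian:
  assumes c: "c > 0"
  shows "(\<integral>\<^sup>+x. ennreal (exp (- c * (x \<bullet> x))) \<partial>(lborel :: (real^'n) measure)) = ennreal ((pi / c) powr (real CARD('n) / 2))"
proof -
  have "(\<integral>\<^sup>+x. ennreal (exp (- c * (x \<bullet> x))) \<partial>(lborel :: (real^'n) measure)) = (\<integral>\<^sup>+x. (\<Prod>b\<in>Basis. ennreal (exp (- c * (x \<bullet> b)\<^sup>2))) \<partial>(lborel :: (real^'n) measure))"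
    by (intro nn_integral_cong) (simp add: inner_self_sum sum_distrib_left exp_sum[symmetric] prod_ennreal sum_negf[symmetric])
  also have "\<dots> = (\<Prod>b\<in>(Basis :: (real^'n) set). \<integral>\<^sup>+y. ennreal (exp (- c * y\<^sup>2)) \<partial>lborel)"
    by (rule nn_integral_lborel_prod) auto
  also have "\<dots> = ennreal (sqrt (pi / c)) ^ CARD('n)"
    by (simp only: nn_integral_gaussian_line[OF c] prod_constant DIM_vec)
  also have "\<dots> = ennreal ((pi / c) powr (real CARD('n) / 2))"
    using c by (simp add: ennreal_power powr_half_sqrt[symmetric] powr_realpow[symmetric] powr_powr)
  finally show ?thesis .
qed

text \<open>|x|^2 is a sum over coordinates, and each summand times the Gaussian is a product of
  one-dimensional functions, with the second moment sqrt(pi) / 2 in one coordinate and sqrt(pi) in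
  the others.\<close>

lemma nn_integral_gaussian_sq:
  "(\<integral>\<^sup>+x. ennreal ((x \<bullet> x) * exp (- (x \<bullet> x))) \<partial>(lborel :: (real^'n) measure)) = ennreal (real CARD('n) / 2 * pi powr (real CARD('n) / 2))"
proof -
  let ?d = "CARD('n)"
  define f where "f i b y = (if b = i then y\<^sup>2 else 1) * exp (- y\<^sup>2)" for i b :: "real^'n" and y :: real
  have f1: "(\<integral>\<^sup>+y. ennreal (f i b y) \<partial>lborel) = ennreal (if b = i then sqrt pi / 2 else sqrt pi)" for i b
  proof -
    have "has_bochner_integral lborel (f i b) (if b = i then sqrt pi / 2 else sqrt pi)"
      using gaussian_line[of 0] gaussian_line[of 1]
      by (cases "b = i") (simp_all add: f_def[abs_def] mult.commute fact_2)
    then show ?thesis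
      by (subst nn_integral_eq_integral) (auto simp: has_bochner_integral_iff f_def)
  qed
  have "(\<integral>\<^sup>+x. ennreal ((x \<bullet> x) * exp (- (x \<bullet> x))) \<partial>(lborel :: (real^'n) measure))
    = (\<integral>\<^sup>+x. (\<Sum>i\<in>Basis. \<Prod>b\<in>Basis. ennreal (f i b (x \<bullet> b))) \<partial>(lborel :: (real^'n) measure))"
  proof (rule nn_integral_cong)
    fix x :: "real^'n"
    have "(\<Prod>b\<in>Basis. f i b (x \<bullet> b)) = (x \<bullet> i)\<^sup>2 * exp (- (x \<bullet> x))" if "i \<in> Basis" for i
    proof -
      have "(\<Prod>b\<in>Basis. f i b (x \<bullet> b)) = (\<Prod>b\<in>Basis. (if b = i then (x \<bullet> b)\<^sup>2 else 1)) * (\<Prod>b\<in>Basis. exp (- (x \<bullet> b)\<^sup>2))"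
        by (simp add: f_def prod.distrib)
      also have "(\<Prod>b\<in>Basis. (if b = i then (x \<bullet> b)\<^sup>2 else 1)) = (x \<bullet> i)\<^sup>2"
        using that by (subst prod.delta) auto
      also have "(\<Prod>b\<in>Basis. exp (- (x \<bullet> b)\<^sup>2)) = exp (- (x \<bullet> x))"
        by (simp add: inner_self_sum exp_sum[symmetric] sum_negf)
      finally show ?thesis .
    qed
    then have "(\<Sum>i\<in>Basis. \<Prod>b\<in>Basis. f i b (x \<bullet> b)) = (x \<bullet> x) * exp (- (x \<bullet> x))"
      by (simp add: sum_distrib_right[symmetric] inner_self_sum)
    moreover have "(\<Sum>i\<in>Basis. \<Prod>b\<in>Basis. ennreal (f i b (x \<bullet> b))) = ennreal (\<Sum>i\<in>Basis. \<Prod>b\<in>Basis. f i b (x \<bullet> b))"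
      by (subst sum_ennreal[symmetric]) (auto simp: prod_ennreal f_def intro!: prod_nonneg)
    ultimately show "ennreal ((x \<bullet> x) * exp (- (x \<bullet> x))) = (\<Sum>i\<in>Basis. \<Prod>b\<in>Basis. ennreal (f i b (x \<bullet> b)))" by simp
  qed
  also have "\<dots> = (\<Sum>i\<in>Basis. \<integral>\<^sup>+x. (\<Prod>b\<in>Basis. ennreal (f i b (x \<bullet> b))) \<partial>(lborel :: (real^'n) measure))"
    by (rule nn_integral_sum) (auto simp: f_def)
  also have "\<dots> = (\<Sum>i\<in>(Basis::(real^'n) set). \<Prod>b\<in>(Basis::(real^'n) set). \<integral>\<^sup>+y. ennreal (f i b y) \<partial>lborel)"
    by (intro sum.cong refl nn_integral_lborel_prod) (auto simp: f_def)
  also have "\<dots> = (\<Sum>i\<in>(Basis::(real^'n) set). ennreal (sqrt pi ^ ?d / 2))"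
  proof (rule sum.cong[OF refl])
    fix i :: "real^'n" assume i: "i \<in> Basis"
    have "(\<Prod>b\<in>(Basis::(real^'n) set). if b = i then sqrt pi / 2 else sqrt pi) = sqrt pi / 2 * sqrt pi ^ (?d - 1)"
      using i by (subst prod.remove[OF _ i]) (auto simp: card_Diff_singleton)
    also have "\<dots> = sqrt pi ^ ?d / 2" by (simp add: power_eq_if)
    finally have "(\<Prod>b\<in>(Basis::(real^'n) set). if b = i then sqrt pi / 2 else sqrt pi) = sqrt pi ^ ?d / 2" .
    moreover have "(\<Prod>b\<in>(Basis::(real^'n) set). ennreal (if b = i then sqrt pi / 2 else sqrt pi))
        = ennreal (\<Prod>b\<in>(Basis::(real^'n) set). if b = i then sqrt pi / 2 else sqrt pi)"
      by (rule prod_ennreal) auto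
    ultimately show "(\<Prod>b\<in>(Basis::(real^'n) set). \<integral>\<^sup>+y. ennreal (f i b y) \<partial>lborel) = ennreal (sqrt pi ^ ?d / 2)"
      by (simp only: f1)
  qed
  also have "\<dots> = ennreal (\<Sum>i\<in>(Basis::(real^'n) set). sqrt pi ^ ?d / 2)" by (rule sum_ennreal) simp
  also have "(\<Sum>i\<in>(Basis::(real^'n) set). sqrt pi ^ ?d / 2) = real ?d / 2 * pi powr (real ?d / 2)"
    by (simp add: powr_half_sqrt[symmetric] powr_realpow[symmetric] powr_powr)
  finally show ?thesis .
qed

lemma smooth_gaussian: "smooth (\<lambda>x::real^'n. exp (- (x \<bullet> x) / 2))"
  using smooth_compose[OF smooth1_exp[of "-1/2"] smooth_inner_self] by simp

lemma grad_gaussian: "grad (\<lambda>x::real^'n. exp (- (x \<bullet> x) / 2)) x = - exp (- (x \<bullet> x) / 2) *\<^sub>R x"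
  by (rule grad_eqI) (auto intro!: derivative_eq_intros simp: inner_commute)

text \<open>Integration by parts: u \<phi> is a test function, so its partial derivatives have
  integral 0.\<close>

lemma H1_smooth:
  fixes u :: "real^'n \<Rightarrow> real"
  assumes sm: "smooth u" and "in_Lp 2 u" "in_Lp 2 (grad u)"
  shows "H1 u (grad u)"
  unfolding H1_def
proof (intro conjI assms ballI allI)
  fix \<phi> :: "real^'n \<Rightarrow> real" and i assume \<phi>: "\<phi> \<in> test_functions UNIV"
  have t: "(\<lambda>x. u x * \<phi> x) \<in> test_functions UNIV" by (rule test_functions_mult[OF \<phi> sm])
  have i1: "integrable lborel (\<lambda>x. u x * partial i \<phi> x)"
    by (intro test_integrable test_functions_mult[OF _ sm] test_functions_partial \<phi>)
  have i2: "integrable lborel (\<lambda>x. partial i u x * \<phi> x)"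
    by (intro test_integrable test_functions_mult \<phi> smooth_partial sm)
  have "partial i (\<lambda>x. u x * \<phi> x) x = u x * partial i \<phi> x + partial i u x * \<phi> x" for x
    using \<phi> sm by (intro partial_mult smooth_differentiable) (auto simp: test_functions_def)
  then have "(LINT x|lborel. u x * partial i \<phi> x) + (LINT x|lborel. partial i u x * \<phi> x) = 0"
    using integral_partial_eq_0[OF t, of i] i1 i2 by simp
  then show "(LINT x|lborel. u x * partial i \<phi> x) = - (LINT x|lborel. grad u x $ i * \<phi> x)"
    by (simp add: grad_def)
qed

text \<open>The Gaussian quotient depends on p not only through its exponent. After taking
  logarithms, ln(p/2) \<le> p/2 - 1 replaces it by a pure power t, since (d/p) (p/2 - 1) = t. The
  base 2 / (pi e d) is the constant of the logarithmic Sobolev inequality.\<close>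

lemma gaussian_bound_aux:
  fixes d p :: real
  assumes d: "d > 0" and p: "p > 2"
  defines "t \<equiv> d * (p - 2) / (2 * p)"
  shows "(2 / (pi * exp 1 * d)) powr t * ((d/2 * pi powr (d/2)) powr t * (pi powr (d/2)) powr (1 - t)) \<le> (2 * pi / p) powr (d / p)"
proof -
  have ln: "ln (p / 2) \<le> p / 2 - 1" using p by (intro ln_le_minus_one) simp
  have "ln ((2 / (pi * exp 1 * d)) powr t * ((d/2 * pi powr (d/2)) powr t * (pi powr (d/2)) powr (1 - t)))
     = t * (ln 2 - (ln pi + 1 + ln d)) + (t * (ln d - ln 2 + d/2 * ln pi) + (1 - t) * (d/2 * ln pi))"
    using d by (simp add: ln_mult ln_div ln_powr)
  also have "\<dots> = d/2 * ln pi - t * ln pi - t" by (simp add: field_simps)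
  also have "\<dots> \<le> d / p * (ln pi - ln (p / 2))"
  proof -
    have "d/2 - t = d/p" using p by (simp add: t_def field_simps)
    then have *: "d/2 * ln pi - t * ln pi = d/p * ln pi" by (metis left_diff_distrib)
    have "d / p * ln (p / 2) \<le> d / p * (p / 2 - 1)" using ln d p by (intro mult_left_mono) auto
    also have "\<dots> = t" using p by (simp add: t_def field_simps)
    finally show ?thesis unfolding * by (simp add: right_diff_distrib)
  qed
  also have "\<dots> = ln ((2 * pi / p) powr (d / p))"
    using p by (simp add: ln_powr ln_div ln_mult)
  finally show ?thesis using d p by (subst (asm) ln_le_cancel_iff) auto
qed

text \<open>The trial function is exp(-|x|^2 / 2). Its width is immaterial, because the
  Gagliardo-Nirenberg quotient is invariant under dilations.\<close>

theorem C_GN_ge: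
  assumes p: "2 < p"
  shows "ennreal ((2 / (pi * exp 1 * real CARD('n::finite))) powr vartheta p CARD('n)) \<le> C_GN TYPE('n) p"
  unfolding C_GN_def
proof (rule Inf_greatest)
  let ?d = "real CARD('n)" and ?t = "vartheta p CARD('n)"
  define u where "u x = exp (- (x \<bullet> x) / 2)" for x :: "real^'n"
  have su: "smooth u" unfolding u_def by (rule smooth_gaussian)
  have gu: "grad u x = - u x *\<^sub>R x" for x unfolding u_def by (rule grad_gaussian)
  have [measurable]: "u \<in> borel_measurable borel" "grad u \<in> borel_measurable borel"
    using su by (auto intro: smooth_measurable grad_measurable)
  have iI: "integrable lborel f \<and> (LINT x|lborel. f x) = I"
    if "f \<in> borel_measurable borel" "\<And>x. f x \<ge> 0" "I \<ge> 0" "(\<integral>\<^sup>+x. ennreal (f x) \<partial>lborel) = ennreal I"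
    for f :: "real^'n \<Rightarrow> real" and I
  proof -
    have "has_bochner_integral lborel f I"
      by (rule has_bochner_integral_nn_integral) (use that in simp_all)
    then show ?thesis by (simp add: has_bochner_integral_iff)
  qed
  have B: "integrable lborel (\<lambda>x. (norm (u x))\<^sup>2) \<and> (LINT x|lborel. (norm (u x))\<^sup>2) = pi powr (?d/2)"
  proof (rule iI)
    have "(norm (u x))\<^sup>2 = exp (- 1 * (x \<bullet> x))" for x by (simp add: u_def power2_eq_square exp_add[symmetric])
    then show "(\<integral>\<^sup>+x. ennreal ((norm (u x))\<^sup>2) \<partial>lborel) = ennreal (pi powr (?d/2))"
      using nn_integral_gaussian[of 1, where 'n = 'n] by simp
  qed auto
  have A: "integrable lborel (\<lambda>x. (norm (grad u x))\<^sup>2) \<and> (LINT x|lborel. (norm (grad u x))\<^sup>2) = ?d/2 * pi powr (?d/2)"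
  proof (rule iI)
    have "(norm (grad u x))\<^sup>2 = (x \<bullet> x) * exp (- (x \<bullet> x))" for x
    proof -
      have "(norm (grad u x))\<^sup>2 = (u x * u x) * (norm x)\<^sup>2"
        unfolding gu by (simp add: power_mult_distrib power2_eq_square)
      also have "u x * u x = exp (- (x \<bullet> x))" by (simp add: u_def exp_add[symmetric])
      finally show ?thesis by (simp add: power2_norm_eq_inner)
    qed
    then show "(\<integral>\<^sup>+x. ennreal ((norm (grad u x))\<^sup>2) \<partial>lborel) = ennreal (?d/2 * pi powr (?d/2))"
      using nn_integral_gaussian_sq[where 'n = 'n] by simp
  qed auto
  have P: "integrable lborel (\<lambda>x. norm (u x) powr p) \<and> (LINT x|lborel. norm (u x) powr p) = (2 * pi / p) powr (?d/2)"
  proof (rule iI)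
    have "norm (u x) powr p = exp (- (p/2) * (x \<bullet> x))" for x by (simp add: u_def powr_def)
    then show "(\<integral>\<^sup>+x. ennreal (norm (u x) powr p) \<partial>lborel) = ennreal ((2 * pi / p) powr (?d/2))"
      using nn_integral_gaussian[of "p/2", where 'n = 'n] p by (simp add: mult.commute)
  qed (use p in auto)
  have H: "H1 u (grad u)"
    using A B by (intro H1_smooth su) (auto simp: in_Lp_2_iff)
  fix C assume "C \<in> {C. \<forall>(u :: real^'n \<Rightarrow> real) G. H1 u G \<longrightarrow>
     in_Lp p u \<and>
     ennreal ((Lp_norm p u)\<^sup>2)
     \<le> C * ennreal (Lp_norm 2 G powr (2 * vartheta p CARD('n))
                   * Lp_norm 2 u powr (2 * (1 - vartheta p CARD('n))))}"
  then have "ennreal ((Lp_norm p u)\<^sup>2) \<le> C * ennreal (Lp_norm 2 (grad u) powr (2 * ?t) * Lp_norm 2 u powr (2 * (1 - ?t)))"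
    using H by blast
  then have C: "ennreal ((2 * pi / p) powr (?d/p)) \<le> C * ennreal ((?d/2 * pi powr (?d/2)) powr ?t * (pi powr (?d/2)) powr (1 - ?t))"
    unfolding Lp_norm_sq Lp_norm_2_powr using A B P p by (simp add: powr_powr)
  show "ennreal ((2 / (pi * exp 1 * ?d)) powr ?t) \<le> C"
  proof (cases C)
    case (real c)
    let ?X = "(?d/2 * pi powr (?d/2)) powr ?t * (pi powr (?d/2)) powr (1 - ?t)"
    have X: "?X > 0" by simp
    have "(2 * pi / p) powr (?d/p) \<le> c * ?X" using C real by (simp add: ennreal_mult[symmetric])
    moreover have "(2 / (pi * exp 1 * ?d)) powr ?t * ?X \<le> (2 * pi / p) powr (?d/p)"
      unfolding vartheta_def by (rule gaussian_bound_aux) (use p in auto)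
    ultimately have "(2 / (pi * exp 1 * ?d)) powr ?t * ?X \<le> c * ?X" by linarith
    then have "(2 / (pi * exp 1 * ?d)) powr ?t \<le> c" using X by (rule mult_right_le_imp_le)
    with real show ?thesis by (simp add: ennreal_leI)
  qed simp
qed

subsection \<open>The strict inequality at the end point\<close>

text \<open>In the limit \<open>p \<rightarrow> 2\<close> the comparison of the two constants at \<open>a_lower\<close> becomes \<open>1 < gap d\<close>.\<close>

definition gap :: "nat \<Rightarrow> real" where
  "gap d = 6 / (pi * exp 1) * (sphere_area d)\<^sup>2 * ((real d - 1) / (2 * pi * exp 1)) ^ (d - 1)"

lemma sphere_area_Gamma:
  assumes d: "d > 0"
  shows "sphere_area d = 2 * pi powr (real d / 2) / Gamma (real d / 2)"
proof -
  have G: "Gamma (real d / 2 + 1) = real d / 2 * Gamma (real d / 2)"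
    using d by (intro Gamma_plus1) (auto simp: nonpos_Ints_def)
  show ?thesis unfolding sphere_area_def unit_ball_vol_def G using d by simp
qed

lemma sphere_area_add_2:
  assumes "d > 0"
  shows "sphere_area (d + 2) = 2 * pi / real d * sphere_area d"
proof -
  have G: "Gamma (real d / 2 + 1) = real d / 2 * Gamma (real d / 2)"
    using assms by (intro Gamma_plus1) (auto simp: nonpos_Ints_def)
  have "sphere_area (d + 2) = 2 * pi powr (real (d + 2) / 2) / Gamma (real (d + 2) / 2)"
    by (rule sphere_area_Gamma) simp
  also have "real (d + 2) / 2 = real d / 2 + 1" by simp
  finally show ?thesis
    unfolding sphere_area_Gamma[OF assms] G powr_add by simp
qed

text \<open>Steps of two are natural because the sphere area then changes by the elementary factor 2
  pi / d; a single step would involve a quotient of Gamma values.\<close>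

lemma gap_add_2:
  assumes d: "d \<ge> 2"
  shows "gap (d + 2) = gap d * (((real d + 1) / real d)\<^sup>2 * ((real d + 1) / (real d - 1)) ^ (d - 1) / (exp 1)\<^sup>2)"
proof -
  obtain k where k: "d = Suc k" "k > 0" using d by (cases d) auto
  have kp: "real k > 0" using k by simp
  have "gap (d + 2) = 6 / (pi * exp 1) * (2 * pi / real d * sphere_area d)\<^sup>2 * ((real d + 1) / (2 * pi * exp 1)) ^ (k + 2)"
    using sphere_area_add_2[of d] k by (simp add: gap_def add.commute)
  also have "\<dots> = (6 / (pi * exp 1) * (sphere_area d)\<^sup>2 * ((real d + 1) / (2 * pi * exp 1)) ^ k) * (((real d + 1) / real d)\<^sup>2 / (exp 1)\<^sup>2)"
  proof -
    have "2 * pi / real d * ((real d + 1) / (2 * pi * exp 1)) = (real d + 1) / real d / exp 1" by simp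
    then have "(2 * pi / real d)\<^sup>2 * ((real d + 1) / (2 * pi * exp 1))\<^sup>2 = ((real d + 1) / real d)\<^sup>2 / (exp 1)\<^sup>2"
      by (metis power_divide power_mult_distrib)
    then have *: "X * ((2 * pi / real d)\<^sup>2 * ((real d + 1) / (2 * pi * exp 1))\<^sup>2) = X * (((real d + 1) / real d)\<^sup>2 / (exp 1)\<^sup>2)" for X
      by simp
    have "K * (al * S)\<^sup>2 * y ^ (k + 2) = (K * S\<^sup>2 * y ^ k) * (al\<^sup>2 * y\<^sup>2)" for K al S y :: real
      by (simp only: power_add power_mult_distrib mult_ac)
    then show ?thesis unfolding *[symmetric] .
  qed
  also have "((real d + 1) / (2 * pi * exp 1)) ^ k = ((real d - 1) / (2 * pi * exp 1)) ^ k * ((real d + 1) / (real d - 1)) ^ k"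
    using kp k by (simp add: power_mult_distrib[symmetric])
  finally show ?thesis using k by (simp add: gap_def mult_ac)
qed

text \<open>The bound is correct up to third order in y. The simpler y / (1 + y) would leave a loss
  of order 1/d per step in \<open>gap\<close>, which is not summable; this one leaves order
  1/d^2.\<close>

lemma ln_one_plus_ge:
  assumes "y \<ge> (0::real)"
  shows "ln (1 + y) \<ge> 2 * y / (2 + y)"
proof -
  define f where "f y = ln (1 + y) - 2 * y / (2 + y)" for y :: real
  have "f 0 \<le> f y"
  proof (rule DERIV_nonneg_imp_nondecreasing[OF assms])
    fix x :: real assume x: "0 \<le> x" "x \<le> y"
    have "(f has_real_derivative 1 / (1 + x) - 4 / (2 + x)\<^sup>2) (at x)"
      unfolding f_def using x by (auto intro!: derivative_eq_intros simp: power2_eq_square field_simps)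
    moreover have "1 / (1 + x) - 4 / (2 + x)\<^sup>2 = x\<^sup>2 / ((1 + x) * (2 + x)\<^sup>2)"
      using x by (simp add: power2_eq_square divide_simps) (simp add: algebra_simps)
    moreover have "x\<^sup>2 / ((1 + x) * (2 + x)\<^sup>2) \<ge> 0" using x by simp
    ultimately show "\<exists>z. (f has_real_derivative z) (at x) \<and> 0 \<le> z" by metis
  qed
  then show ?thesis by (simp add: f_def)
qed

text \<open>\<open>gap\<close> decreases in steps of two, but so slowly that dividing it by \<open>gap_corr\<close> makes it increase: with
  \<open>x = (d - 1) / 2\<close> the loss \<open>ln (gap d) - ln (gap (d + 2))\<close> is at most \<open>1 / (4 (x + 1/8) (x + 9/8))\<close>,
  which telescopes.\<close>

definition gap_corr :: "nat \<Rightarrow> real" where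
  "gap_corr d = exp (2 / (4 * real d - 3))"

lemma gap_corr_step:
  assumes d: "d \<ge> 2"
  shows "gap d / gap_corr d \<le> gap (d + 2) / gap_corr (d + 2)"
proof -
  define D where "D = real d"
  have D: "D \<ge> 2" using d by (simp add: D_def)
  have g: "gap d > 0" unfolding gap_def using d sphere_area_pos[of d] by (intro mult_pos_pos zero_less_power divide_pos_pos) auto
  have 1: "ln ((D + 1) / (D - 1)) \<ge> 2 / D"
  proof -
    have "1 + 2 / (D - 1) = (D + 1) / (D - 1)" using D by (simp add: field_simps)
    moreover have "2 * (2 / (D - 1)) / (2 + 2 / (D - 1)) = 2 / D" using D by (simp add: field_simps)
    ultimately show ?thesis using ln_one_plus_ge[of "2 / (D - 1)"] D by simp
  qed
  have 2: "ln ((D + 1) / D) \<ge> 2 / (2 * D + 1)"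
  proof -
    have "1 + 1 / D = (D + 1) / D" using D by (simp add: field_simps)
    moreover have "2 * (1 / D) / (2 + 1 / D) = 2 / (2 * D + 1)" using D by (simp add: field_simps)
    ultimately show ?thesis using ln_one_plus_ge[of "1 / D"] D by simp
  qed
  have 3: "2 * (2 / (2 * D + 1)) + (D - 1) * (2 / D) - 2 \<ge> 2 / (4 * D + 5) - 2 / (4 * D - 3)"
  proof -
    have "2 * (2 / (2 * D + 1)) + (D - 1) * (2 / D) - 2 = - 2 / (D * (2 * D + 1))" using D by (simp add: divide_simps) (simp add: algebra_simps)
    moreover have "2 / (4 * D + 5) - 2 / (4 * D - 3) = - 16 / ((4 * D + 5) * (4 * D - 3))" using D by (simp add: divide_simps)
    \<comment> \<open>After cross-multiplication, 2 (4 D + 5) (4 D - 3) and 16 D (2 D + 1) agree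
      except for the constant -30. This is the origin of the shift in 4 D - 3: the correction
      telescopes and matches the loss to leading orders.\<close>
    moreover have "2 / (D * (2 * D + 1)) \<le> 16 / ((4 * D + 5) * (4 * D - 3))"
      using D by (simp add: divide_simps) (simp add: algebra_simps)
    ultimately show ?thesis by simp
  qed
  have "exp (2 / (4 * D + 5) - 2 / (4 * D - 3)) \<le> exp (2 * ln ((D + 1) / D) + (D - 1) * ln ((D + 1) / (D - 1)) - 2)"
  proof -
    have "(D - 1) * (2 / D) \<le> (D - 1) * ln ((D + 1) / (D - 1))" using 1 D by (intro mult_left_mono) auto
    with 2 3 show ?thesis by simp
  qed
  also have "\<dots> = ((D + 1) / D)\<^sup>2 * ((D + 1) / (D - 1)) ^ (d - 1) / (exp 1)\<^sup>2"
  proof -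
    have "exp (2 * ln ((D + 1) / D)) = ((D + 1) / D)\<^sup>2" using D by (simp add: exp_double)
    moreover have "exp ((D - 1) * ln ((D + 1) / (D - 1))) = ((D + 1) / (D - 1)) ^ (d - 1)"
    proof -
      have "D - 1 = real (d - 1)" using d by (simp add: D_def of_nat_diff)
      then have "exp ((D - 1) * ln ((D + 1) / (D - 1))) = exp (ln ((D + 1) / (D - 1))) ^ (d - 1)"
        by (simp only: exp_of_nat_mult)
      then show ?thesis using D by simp
    qed
    moreover have "exp (2::real) = (exp 1)\<^sup>2" by (simp add: exp_double[symmetric])
    ultimately show ?thesis by (simp add: exp_diff exp_add)
  qed
  finally have "exp (2 / (4 * D + 5) - 2 / (4 * D - 3)) * gap d \<le> gap (d + 2)"
    unfolding gap_add_2[OF d] D_def[symmetric] using g by (subst mult.commute) (rule mult_left_mono, auto)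
  then have "exp (2 / (4 * D + 5)) / exp (2 / (4 * D - 3)) * gap d \<le> gap (d + 2)" by (simp add: exp_diff)
  moreover have "gap_corr (d + 2) = exp (2 / (4 * D + 5))" "gap_corr d = exp (2 / (4 * D - 3))"
    by (simp_all add: gap_corr_def D_def algebra_simps)
  ultimately show ?thesis by (simp add: field_simps)
qed

lemma gap_gt_1:
  assumes "d \<ge> 2"
  shows "gap d > 1"
proof -
  have e: "exp (1::real) < 272/100" by (rule e_less_272)
  have "gap d / gap_corr d > 1" using assms
  proof (induction d rule: less_induct)
    case (less d)
    consider "d = 2" | "d = 3" | "d \<ge> 4" using less.prems by linarith
    then show ?case
    proof cases
      case 1
      have "gap 2 = 12 / (exp 1)\<^sup>2"
        by (simp add: gap_def sphere_area_def eval_unit_ball_vol power2_eq_square)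
      moreover have "gap_corr 2 = exp (2/5)" by (simp add: gap_corr_def)
      moreover have "(exp 1)\<^sup>2 * exp (2/5 :: real) < 12"
      proof -
        \<comment> \<open>The fifth power clears the fractional exponent and leaves e^12, to be
          compared with a rational power. In dimension 3 the ninth power plays the same
          part.\<close>
        have "((exp 1)\<^sup>2 * exp (2/5 :: real)) ^ 5 = exp 1 ^ 12"
          by (simp add: power_mult_distrib exp_of_nat_mult[symmetric] flip: exp_add)
        also have "\<dots> < (272/100) ^ 12" using e by (intro power_strict_mono) auto
        also have "\<dots> < (12::real) ^ 5" by (simp add: power_divide)
        finally show ?thesis by (rule power_less_imp_less_base) simp
      qed
      ultimately show ?thesis unfolding 1 by (simp only: divide_divide_eq_left less_divide_eq_1_pos mult_pos_pos zero_less_power exp_gt_zero)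
    next
      case 2
      have "gap 3 = 96 / (pi * exp 1 ^ 3)"
        by (simp add: gap_def sphere_area_def eval_unit_ball_vol power2_eq_square power3_eq_cube)
      moreover have "gap_corr 3 = exp (2/9)" by (simp add: gap_corr_def)
      moreover have "pi * exp 1 ^ 3 * exp (2/9 :: real) < 96"
      proof -
        have "(exp 1 ^ 3 * exp (2/9 :: real)) ^ 9 = exp 1 ^ 29"
          by (simp add: power_mult_distrib exp_of_nat_mult[symmetric] flip: exp_add)
        also have "\<dots> < (272/100) ^ 29" using e by (intro power_strict_mono) auto
        also have "\<dots> < (30::real) ^ 9" by (simp add: power_divide)
        finally have "exp 1 ^ 3 * exp (2/9 :: real) < 30" by (rule power_less_imp_less_base) simp
        moreover have "pi < 3.2" using pi_approx by simp
        ultimately have "pi * (exp 1 ^ 3 * exp (2/9 :: real)) < 3.2 * 30" by (intro mult_strict_mono) auto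
        then show ?thesis by (simp add: mult.assoc)
      qed
      ultimately show ?thesis unfolding 2
        by (simp only: divide_divide_eq_left less_divide_eq_1_pos mult_pos_pos zero_less_power exp_gt_zero pi_gt_zero)
    next
      case 3
      then have "gap (d - 2) / gap_corr (d - 2) > 1" by (intro less.IH) auto
      also have "gap (d - 2) / gap_corr (d - 2) \<le> gap (d - 2 + 2) / gap_corr (d - 2 + 2)"
        using 3 by (intro gap_corr_step) auto
      also have "d - 2 + 2 = d" using 3 by simp
      finally show ?thesis .
    qed
  qed
  moreover have "gap_corr d \<ge> 1" using assms by (simp add: gap_corr_def)
  ultimately show ?thesis by (simp add: field_simps)
qed

section \<open>The number \<open>a_star\<close> and the comparison at the end point\<close>

lemma rad_constant:
  fixes p :: real
  assumes d: "CARD('n::finite) \<ge> 2" and p: "2 < p" "p < 4"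
  obtains K where "K > 0" "\<And>a. a < a_crit CARD('n) \<Longrightarrow>
    C_CKN_rad TYPE('n) (vartheta p CARD('n)) p a
      = ennreal (K * (a_crit CARD('n) - a) powr (- ((real CARD('n) - 1) * (p - 2) / p)))"
proof -
  let ?d = "CARD('n)"
  define t where "t = vartheta p ?d"
  have w: "sphere_area ?d > 0" using d by (intro sphere_area_pos) auto
  have t: "t = real ?d * ((p - 2) / (2 * p))" by (simp add: t_def vartheta_def)
  define C where "C = line_constant (sphere_area ?d) t p 1"
  have "C \<le> ennreal ((((real ?d - 1) / 1\<^sup>2) ^ (?d - 1) / real ?d ^ ?d / (3 * (sphere_area ?d)\<^sup>2)) powr ((p - 2) / (2 * p)))"
    unfolding C_def t by (rule line_constant_le[OF p w _ d]) simp
  then have "C \<noteq> \<top>" by (auto simp: top_unique)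
  moreover have "C > 0" unfolding C_def using p by (intro line_constant_pos w) auto
  ultimately obtain K where K: "C = ennreal K" "K > 0"
    by (cases C) auto
  show ?thesis
  proof (rule that[OF K(2)])
    fix a assume a: "a < a_crit ?d"
    have "C_CKN_rad TYPE('n) t p a = line_constant (sphere_area ?d) t p (a_crit ?d - a)"
      using p by (intro C_CKN_rad_eq_line_constant) simp
    also have "\<dots> = ennreal ((a_crit ?d - a) powr (- (2 * t - 1 + 2/p))) * C"
      unfolding C_def using a p w by (intro line_constant_scale) auto
    also have "2 * t - 1 + 2/p = (real ?d - 1) * (p - 2) / p" using p by (simp add: t field_simps)
    finally show "C_CKN_rad TYPE('n) (vartheta p ?d) p a = ennreal (K * (a_crit ?d - a) powr (- ((real ?d - 1) * (p - 2) / p)))"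
      using K by (simp add: t_def ennreal_mult[symmetric] mult.commute)
  qed
qed

lemma C_GN_finite:
  assumes p: "2 < p" "p < 2 + 4 / real CARD('n::finite)"
  obtains c where "c > 0" "C_GN TYPE('n) p = ennreal c"
proof -
  obtain c where c: "c \<ge> 0" "\<forall>u\<in>test_functions UNIV. gn_ineq c p (vartheta p CARD('n)) (u :: real^'n \<Rightarrow> real) (grad u)"
    using gagliardo_nirenberg[OF p] by blast
  have "C_GN TYPE('n) p \<le> ennreal c" by (rule C_GN_le[OF p c(1)]) (use c(2) in blast)
  then have "C_GN TYPE('n) p \<noteq> \<top>" by (auto simp: top_unique)
  moreover have "0 < ennreal ((2 / (pi * exp 1 * real CARD('n))) powr vartheta p CARD('n))" by (simp add: ennreal_less_zero_iff)
  then have "C_GN TYPE('n) p > 0" using C_GN_ge[OF p(1), where 'n = 'n] by (rule order_less_le_trans)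
  ultimately show ?thesis by (cases "C_GN TYPE('n) p") (auto intro: that)
qed

text \<open>The radial constant is K m^(-e) in m = a_c - a with K, e > 0, a strictly decreasing
  bijection of the positive reals. It therefore takes the finite positive value \<open>C_GN\<close>
  exactly once, and lies below it exactly to the left of that point.\<close>

lemma a_star_unique:
  assumes d: "CARD('n::finite) \<ge> 2" and p: "2 < p" "p < 4" "p < 2 + 4 / real CARD('n)"
  shows "a_star TYPE('n) p < a_crit CARD('n)"
    and "C_GN TYPE('n) p = C_CKN_rad TYPE('n) (vartheta p CARD('n)) p (a_star TYPE('n) p)"
    and "\<And>a. a < a_crit CARD('n) \<Longrightarrow>
      C_CKN_rad TYPE('n) (vartheta p CARD('n)) p a < C_GN TYPE('n) p \<longleftrightarrow> a < a_star TYPE('n) p"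
proof -
  let ?d = "CARD('n)"
  define e where "e = (real ?d - 1) * (p - 2) / p"
  have e: "e > 0" using d p by (simp add: e_def)
  obtain K where K: "K > 0" "\<And>a. a < a_crit ?d \<Longrightarrow>
    C_CKN_rad TYPE('n) (vartheta p ?d) p a = ennreal (K * (a_crit ?d - a) powr (- e))"
    unfolding e_def using rad_constant[OF d p(1,2)] by blast
  obtain c where c: "c > 0" "C_GN TYPE('n) p = ennreal c" by (rule C_GN_finite[OF p(1,3)])
  define m where "m = (K / c) powr (1 / e)"
  have m: "m > 0" using K c by (simp add: m_def)
  have mc: "K * m powr (- e) = c"
    using K c e by (simp add: m_def powr_powr powr_minus_divide)
  have less: "C_CKN_rad TYPE('n) (vartheta p ?d) p a < C_GN TYPE('n) p \<longleftrightarrow> a < a_crit ?d - m" if "a < a_crit ?d" for a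
  proof -
    have "C_CKN_rad TYPE('n) (vartheta p ?d) p a < C_GN TYPE('n) p \<longleftrightarrow> (a_crit ?d - a) powr (- e) < m powr (- e)"
      using K c that by (simp add: mc[symmetric] ennreal_less_iff)
    also have "\<dots> \<longleftrightarrow> m < a_crit ?d - a"
    proof
      assume "(a_crit ?d - a) powr (- e) < m powr (- e)"
      then show "m < a_crit ?d - a" using that e m
        by (metis diff_gt_0_iff_gt linorder_not_less neg_le_0_iff_le order_less_imp_le powr_mono2')
    next
      assume "m < a_crit ?d - a"
      then show "(a_crit ?d - a) powr (- e) < m powr (- e)" using that e m by (intro powr_less_mono2_neg) auto
    qed
    finally show ?thesis by linarith
  qed
  have "a_star TYPE('n) p = a_crit ?d - m"
    unfolding a_star_def
  proof (rule the_equality)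
    show "a_crit ?d - m < a_crit ?d \<and> C_GN TYPE('n) p = C_CKN_rad TYPE('n) (vartheta p ?d) p (a_crit ?d - m)"
      using m K(2)[of "a_crit ?d - m"] c by (simp add: mc)
    fix a assume a: "a < a_crit ?d \<and> C_GN TYPE('n) p = C_CKN_rad TYPE('n) (vartheta p ?d) p a"
    then have "K * (a_crit ?d - a) powr (- e) = K * m powr (- e)"
      using K(2)[of a] K(1) c m by (simp add: mc)
    then have "(a_crit ?d - a) powr (- e) = m powr (- e)" using K by simp
    then have "((a_crit ?d - a) powr (- e)) powr (- 1 / e) = (m powr (- e)) powr (- 1 / e)" by simp
    then show "a = a_crit ?d - m" using a m e by (simp add: powr_powr)
  qed
  then show "a_star TYPE('n) p < a_crit ?d"
    "C_GN TYPE('n) p = C_CKN_rad TYPE('n) (vartheta p ?d) p (a_star TYPE('n) p)"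
    "\<And>a. a < a_crit ?d \<Longrightarrow> C_CKN_rad TYPE('n) (vartheta p ?d) p a < C_GN TYPE('n) p \<longleftrightarrow> a < a_star TYPE('n) p"
    using m K(2)[of "a_crit ?d - m"] c less by (simp_all add: mc)
qed

text \<open>At \<theta> = \<open>vartheta p d\<close> the second radicand is also d - 1, and the two
  square roots multiply to d - 1.\<close>

lemma a_lower_vartheta:
  assumes "2 < p" "d \<ge> 1"
  shows "a_lower d (vartheta p d) p = a_crit d - 2 * (real d - 1) / (p + 2)"
proof -
  have "2 * p * vartheta p d / (p - 2) - 1 = real d - 1" using assms by (simp add: vartheta_def field_simps)
  then have "a_lower d (vartheta p d) p = a_crit d - 2 * (sqrt (real d - 1) * sqrt (real d - 1)) / (p + 2)"
    by (simp add: a_lower_def)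
  then show ?thesis using assms(2) by simp
qed

text \<open>The two sides are what remains of \<open>line_constant_le\<close> at the end point m = 2
  (d - 1) / (p + 2) and of \<open>C_GN_ge\<close> after removing the common exponent (p - 2) / (2
  p); the power d on the right comes from \<open>vartheta\<close> being d times that exponent. Both
  are continuous at p = 2, so the strict inequality there extends to an interval.\<close>

lemma end_point_lim:
  assumes d: "d \<ge> 2"
  obtains p1 where "p1 > 2" "\<And>p. 2 < p \<Longrightarrow> p < p1 \<Longrightarrow>
    ((real d - 1) / (2 * (real d - 1) / (p + 2))\<^sup>2) ^ (d - 1) / real d ^ d / (3 * (sphere_area d)\<^sup>2)
      < (2 / (pi * exp 1 * real d)) ^ d"
proof -
  define f where "f p = ((real d - 1) / (2 * (real d - 1) / (p + 2))\<^sup>2) ^ (d - 1) / real d ^ d / (3 * (sphere_area d)\<^sup>2)" for p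
  have w: "sphere_area d > 0" using d by (intro sphere_area_pos) auto
  obtain k where k: "d = Suc k" "k > 0" using d by (cases d) auto
  have kp: "real k > 0" using k by simp
  have "isCont f 2" unfolding f_def using kp w k by (intro continuous_intros) auto
  moreover have "f 2 < (2 / (pi * exp 1 * real d)) ^ d"
  proof -
    \<comment> \<open>At p = 2 one has m = (d - 1) / 2 and thus (d - 1) / m^2 = 4 / (d - 1), with k
      = d - 1.\<close>
    have f2: "f 2 = (4 / real k) ^ k / real d ^ d / (3 * (sphere_area d)\<^sup>2)"
      using kp by (simp add: f_def k(1) power2_eq_square field_simps)
    have "1 < 6 / (pi * exp 1) * (sphere_area d)\<^sup>2 * (real k / (2 * pi * exp 1)) ^ k"
      using gap_gt_1[OF d] by (simp add: gap_def k(1))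
    then have "(4 / real k) ^ k * 1 < (4 / real k) ^ k * (6 / (pi * exp 1) * (sphere_area d)\<^sup>2 * (real k / (2 * pi * exp 1)) ^ k)"
      using kp by (intro mult_strict_left_mono) auto
    also have "\<dots> = 6 / (pi * exp 1) * (sphere_area d)\<^sup>2 * ((4 / real k) ^ k * (real k / (2 * pi * exp 1)) ^ k)"
      by (simp only: mult_ac)
    also have "(4 / real k) ^ k * (real k / (2 * pi * exp 1)) ^ k = (2 / (pi * exp 1)) ^ k"
      using kp unfolding power_mult_distrib[symmetric] by simp
    also have "6 / (pi * exp 1) * (sphere_area d)\<^sup>2 * (2 / (pi * exp 1)) ^ k = (2 / (pi * exp 1)) ^ d * (3 * (sphere_area d)\<^sup>2)"
      by (simp add: k(1))
    finally have "(4 / real k) ^ k / (3 * (sphere_area d)\<^sup>2) < (2 / (pi * exp 1)) ^ d"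
      using w by (simp add: pos_divide_less_eq)
    then have "(4 / real k) ^ k / (3 * (sphere_area d)\<^sup>2) / real d ^ d < (2 / (pi * exp 1)) ^ d / real d ^ d"
      using d by (intro divide_strict_right_mono) auto
    then show ?thesis unfolding f2 by (simp add: power_divide power_mult_distrib mult_ac)
  qed
  ultimately have "\<forall>\<^sub>F p in at 2. f p < (2 / (pi * exp 1 * real d)) ^ d"
    by (intro order_tendstoD) (auto simp: isCont_def)
  then have "\<forall>\<^sub>F p in at_right 2. f p < (2 / (pi * exp 1 * real d)) ^ d"
    by (simp add: eventually_at_split)
  then obtain p1 where "p1 > 2" "\<And>p. 2 < p \<Longrightarrow> p < p1 \<Longrightarrow> f p < (2 / (pi * exp 1 * real d)) ^ d"
    unfolding eventually_at_right_field by blast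
  then show ?thesis unfolding f_def by (rule that)
qed

theorem corollary1:
  assumes "CARD('n::finite) \<ge> 2"
  shows "\<exists>p0::real. 2 < p0 \<and> ereal p0 < two_star CARD('n) \<and>
    (\<forall>p. 2 < p \<and> p < p0 \<longrightarrow>
       a_lower CARD('n) (vartheta p CARD('n)) p < a_star TYPE('n) p \<and>
       (\<forall>a. a_lower CARD('n) (vartheta p CARD('n)) p < a \<and> a < a_star TYPE('n) p \<longrightarrow>
          radial_extremals_linearly_stable CARD('n) (vartheta p CARD('n)) p a \<and>
          C_CKN_rad TYPE('n) (vartheta p CARD('n)) p a < C_CKN TYPE('n) (vartheta p CARD('n)) p a))"
proof -
  let ?d = "CARD('n)"
  obtain p1 where p1: "p1 > 2" "\<And>p. 2 < p \<Longrightarrow> p < p1 \<Longrightarrow>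
    ((real ?d - 1) / (2 * (real ?d - 1) / (p + 2))\<^sup>2) ^ (?d - 1) / real ?d ^ ?d / (3 * (sphere_area ?d)\<^sup>2)
      < (2 / (pi * exp 1 * real ?d)) ^ ?d"
    using end_point_lim[OF assms] by blast
  \<comment> \<open>4 is for the interpolation on the line, p1 for the end point, and 2 + 4/d for
    the Gagliardo-Nirenberg inequality. For d \<ge> 3 the last also keeps p0 below the critical
    exponent 2 + 4 / (d - 2).\<close>
  define p0 where "p0 = min (min 4 p1) (2 + 4 / real ?d)"
  have p0: "2 < p0" using p1(1) by (simp add: p0_def)
  moreover have "ereal p0 < two_star ?d"
  proof (cases "?d \<ge> 3")
    case True
    then have "2 + 4 / real ?d < 2 * real ?d / (real ?d - 2)" by (simp add: field_simps)
    then have "p0 < 2 * real ?d / (real ?d - 2)" by (simp add: p0_def)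
    with True show ?thesis by (simp add: two_star_def)
  qed (simp add: two_star_def)
  moreover have "a_lower ?d (vartheta p ?d) p < a_star TYPE('n) p \<and>
       (\<forall>a. a_lower ?d (vartheta p ?d) p < a \<and> a < a_star TYPE('n) p \<longrightarrow>
          radial_extremals_linearly_stable ?d (vartheta p ?d) p a \<and>
          C_CKN_rad TYPE('n) (vartheta p ?d) p a < C_CKN TYPE('n) (vartheta p ?d) p a)"
    if "2 < p \<and> p < p0" for p
  proof -
    have p: "2 < p" "p < 4" "p < 2 + 4 / real ?d" "p < p1" using that by (auto simp: p0_def)
    note star = a_star_unique[OF assms p(1-3)]
    define m where "m = 2 * (real ?d - 1) / (p + 2)"
    have m: "m > 0" using assms p by (simp add: m_def)
    define s where "s = (p - 2) / (2 * p)"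
    have s: "s > 0" using p by (simp add: s_def)
    have t: "vartheta p ?d = real ?d * s" by (simp add: vartheta_def s_def)
    have low: "a_lower ?d (vartheta p ?d) p = a_crit ?d - m"
      using a_lower_vartheta[OF p(1), of ?d] assms by (simp add: m_def)
    have w: "sphere_area ?d > 0" using assms by (intro sphere_area_pos) auto
    have "C_CKN_rad TYPE('n) (vartheta p ?d) p (a_crit ?d - m) = line_constant (sphere_area ?d) (real ?d * s) p m"
      using C_CKN_rad_eq_line_constant[of p, where 'n = 'n and a = "a_crit ?d - m"] p by (simp add: t)
    also have "\<dots> \<le> ennreal ((((real ?d - 1) / m\<^sup>2) ^ (?d - 1) / real ?d ^ ?d / (3 * (sphere_area ?d)\<^sup>2)) powr s)"
      unfolding s_def by (rule line_constant_le[OF p(1,2) w m assms])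
    also have "\<dots> < ennreal (((2 / (pi * exp 1 * real ?d)) ^ ?d) powr s)"
      using p1(2)[OF p(1,4)] s w assms unfolding m_def[symmetric]
      by (intro ennreal_lessI powr_less_mono2) auto
    also have "((2 / (pi * exp 1 * real ?d)) ^ ?d) powr s = (2 / (pi * exp 1 * real ?d)) powr vartheta p ?d"
      by (simp add: t powr_realpow[symmetric] powr_powr)
    also have "ennreal \<dots> \<le> C_GN TYPE('n) p" by (rule C_GN_ge[OF p(1)])
    finally have lt: "a_lower ?d (vartheta p ?d) p < a_star TYPE('n) p"
      using star(3)[of "a_crit ?d - m"] m by (simp add: low)
    moreover have "radial_extremals_linearly_stable ?d (vartheta p ?d) p a \<and>
          C_CKN_rad TYPE('n) (vartheta p ?d) p a < C_CKN TYPE('n) (vartheta p ?d) p a"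
      if a: "a_lower ?d (vartheta p ?d) p < a" "a < a_star TYPE('n) p" for a
    proof
      show "radial_extremals_linearly_stable ?d (vartheta p ?d) p a"
        using a star(1) by (simp add: radial_extremals_linearly_stable_def)
      have "C_CKN_rad TYPE('n) (vartheta p ?d) p a < C_GN TYPE('n) p"
        using star(1) star(3)[of a] a by simp
      also have "\<dots> \<le> C_CKN TYPE('n) (vartheta p ?d) p a" by (rule C_GN_le_C_CKN[OF p(1,3)])
      finally show "C_CKN_rad TYPE('n) (vartheta p ?d) p a < C_CKN TYPE('n) (vartheta p ?d) p a" .
    qed
    ultimately show ?thesis by blast
  qed
  ultimately show ?thesis by blast
qed

end
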